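(* Let $\mathsf{M}$ be a $d\times d$ integer invertible matrix. Let $\Phi=\{\phi^1,\ldots,\phi^r\}$ and $\Psi=\{\psi^1,\ldots,\psi^s\}$ be finite subsets of $L_2(\mathbb{R}^d)$. Suppose that $\mathsf{WS}_J(\Phi;\Psi)$ is a nonhomogeneous Riesz $\mathsf{M}$-wavelet basis in $L_2(\mathbb{R}^d)$ for some integer $J$. Then the following statements are equivalent: (i) there exist subsets $\tilde\Phi=\{\tilde\phi^1,\ldots,\tilde\phi^r\}$ and $\tilde\Psi=\{\tilde\psi^1,\ldots,\tilde\psi^s\}$ of $L_2(\mathbb{R}^d)$ such that $(\mathsf{WS}_J(\Phi;\Psi),\mathsf{WS}_J(\tilde\Phi;\tilde\Psi))$ is a pair of nonhomogeneous biorthogonal $\mathsf{M}$-wavelet bases in $L_2(\mathbb{R}^d)$; (ii) there exist an $r\times r$ matrix $\mathbf{a}$ and an $s\times r$ matrix $\mathbf{b}$ of $2\pi\mathbb{Z}^d$-periodic measurable functions in $L_2(\mathbb{T}^d)$ such that $$\hat\phi(\mathsf{M}^T\xi)=\mathbf{a}(\xi)\hat\phi(\xi)\quad\text{and}\quad\hat\psi(\mathsf{M}^T\xi)=\mathbf{b}(\xi)\hat\phi(\xi),\qquad\text{a.e. }\xi\in\mathbb{R}^d,$$ where $\phi:=[\phi^1,\ldots,\phi^r]^T$ and $\psi:=[\psi^1,\ldots,\psi^s]^T$.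
   Context: For $f:\mathbb{R}^d\to\mathbb{C}$, a $d\times d$ real invertible matrix $U$ and $k\in\mathbb{R}^d$, put $f_{U;k}(x):=|\det U|^{1/2}f(Ux-k)$. For subsets $\Phi,\Psi$ of $L_2(\mathbb{R}^d)$ and $J\in\mathbb{Z}$, $$\mathsf{WS}_J(\Phi;\Psi):=\{\phi_{\mathsf{M}^J;k}: k\in\mathbb{Z}^d,\phi\in\Phi\}\cup\{\psi_{\mathsf{M}^j;k}: j\ge J,\ k\in\mathbb{Z}^d,\psi\in\Psi\}.$$ Elements of generator sets are counted with multiplicity (systems are indexed families). $\mathsf{WS}_J(\Phi;\Psi)$ is a nonhomogeneous Riesz $\mathsf{M}$-wavelet basis in $L_2(\mathbb{R}^d)$ if it is a Riesz basis: its linear span is dense and there are constants $C_3,C_4>0$ such that $C_3\sum_i|c_i|^2\le\|\sum_i c_ih_i\|^2\le C_4\sum_i|c_i|^2$ for all finitely supported coefficient sequences, where $\{h_i\}$ denotes the system. $\delta$ is the Dirac sequence: $\delta(0)=1$, $\delta(k)=0$ for $k\neq0$. The pair $(\mathsf{WS}_J(\Phi;\Psi),\mathsf{WS}_J(\tilde\Phi;\tilde\Psi))$ is a pair of nonhomogeneous biorthogonal $\mathsf{M}$-wavelet bases in $L_2(\mathbb{R}^d)$ if each of the two systems is a nonhomogeneous Riesz $\mathsf{M}$-wavelet basis in $L_2(\mathbb{R}^d)$ and $$\langle\phi^\ell_{\mathsf{M}^J;k},\tilde\phi^{\ell'}_{\mathsf{M}^J;k'}\rangle=\delta(k-k')\delta(\ell-\ell'),\quad\langle\psi^n_{\mathsf{M}^j;k},\tilde\phi^{\ell'}_{\mathsf{M}^J;k'}\rangle=0,\quad\langle\phi^\ell_{\mathsf{M}^J;k},\tilde\psi^{n'}_{\mathsf{M}^{j'};k'}\rangle=0,$$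 $$\langle\psi^n_{\mathsf{M}^j;k},\tilde\psi^{n'}_{\mathsf{M}^{j'};k'}\rangle=\delta(k-k')\delta(n-n')\delta(j-j')$$ for all $k,k'\in\mathbb{Z}^d$, all integers $j,j'\ge J$, $\ell,\ell'=1,\ldots,r$ and $n,n'=1,\ldots,s$. The Fourier transform is $\hat f(\xi)=\int_{\mathbb{R}^d}f(x)e^{-ix\cdot\xi}\,dx$ (extended to $L_2$), applied entrywise to vectors. $L_2(\mathbb{T}^d)$ denotes $2\pi\mathbb{Z}^d$-periodic measurable functions square integrable on $[-\pi,\pi)^d$. *)

theory Defs
  imports "HOL-Analysis.Analysis"
begin

text \<open>Elements of \<open>L\<^sub>2\<close> are represented by functions; equality almost everywhere
  is left implicit.\<close>

definition L2 :: "(real ^ 'd \<Rightarrow> complex) set" where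
  "L2 = {f. f \<in> borel_measurable lebesgue \<and> integrable lebesgue (\<lambda>x. (cmod (f x))\<^sup>2)}"

text \<open>The Bochner integrals in the next two definitions default to 0 when they do not exist, so
  these are meaningful on \<open>L\<^sub>2\<close> only, and are only applied there.\<close>

definition L2_norm :: "(real ^ 'd \<Rightarrow> complex) \<Rightarrow> real" where
  "L2_norm f = sqrt (LINT x|lebesgue. (cmod (f x))\<^sup>2)"

definition L2_inner :: "(real ^ 'd \<Rightarrow> complex) \<Rightarrow> (real ^ 'd \<Rightarrow> complex) \<Rightarrow> complex" where
  "L2_inner f g = (LINT x|lebesgue. f x * cnj (g x))"

definition int_lattice :: "(real ^ 'd) set" where
  "int_lattice = {k. \<forall>i. k $ i \<in> \<int>}"

definition L2_torus :: "(real ^ 'd \<Rightarrow> complex) set" where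
  "L2_torus = {f. f \<in> borel_measurable lebesgue
      \<and> (\<forall>k\<in>int_lattice. \<forall>\<xi>. f (\<xi> + (2 * pi) *\<^sub>R k) = f \<xi>)
      \<and> set_integrable lebesgue {\<xi>. \<forall>i. -pi \<le> \<xi> $ i \<and> \<xi> $ i < pi} (\<lambda>\<xi>. (cmod (f \<xi>))\<^sup>2)}"

definition fourier_L1 :: "(real ^ 'd \<Rightarrow> complex) \<Rightarrow> real ^ 'd \<Rightarrow> complex" where
  "fourier_L1 f \<xi> = (LINT x|lebesgue. f x * exp (- (\<i> * complex_of_real (x \<bullet> \<xi>))))"

text \<open>The extension by continuity from \<open>L\<^sub>1 \<inter> L\<^sub>2\<close> to \<open>L\<^sub>2\<close>. By Plancherel's theorem the
  requirement that the transforms \<open>fourier_L1 (u n)\<close> be in \<open>L\<^sub>2\<close> is automatic, and such a \<open>g\<close>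
  exists for each \<open>f\<close> in \<open>L\<^sub>2\<close> and is unique up to a null set.\<close>

definition is_fourier_L2 :: "(real ^ 'd \<Rightarrow> complex) \<Rightarrow> (real ^ 'd \<Rightarrow> complex) \<Rightarrow> bool" where
  "is_fourier_L2 f g \<longleftrightarrow> f \<in> L2 \<and> g \<in> L2 \<and>
     (\<exists>u :: nat \<Rightarrow> real ^ 'd \<Rightarrow> complex.
        (\<forall>n. integrable lebesgue (u n) \<and> u n \<in> L2 \<and> fourier_L1 (u n) \<in> L2)
      \<and> (\<lambda>n. L2_norm (\<lambda>x. u n x - f x)) \<longlonglongrightarrow> 0
      \<and> (\<lambda>n. L2_norm (\<lambda>\<xi>. fourier_L1 (u n) \<xi> - g \<xi>)) \<longlonglongrightarrow> 0)"

definition fourier_L2 :: "(real ^ 'd \<Rightarrow> complex) \<Rightarrow> real ^ 'd \<Rightarrow> complex" where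
  "fourier_L2 f = (SOME g. is_fourier_L2 f g)"

text \<open>Riesz bases of \<open>L\<^sub>2\<close>, for a family \<open>h\<close> indexed by the set \<open>I\<close>.\<close>

definition riesz_basis :: "'i set \<Rightarrow> ('i \<Rightarrow> real ^ 'd \<Rightarrow> complex) \<Rightarrow> bool" where
  "riesz_basis I h \<longleftrightarrow>
     (\<forall>i\<in>I. h i \<in> L2)
   \<and> (\<forall>f\<in>L2. \<forall>\<epsilon>>0. \<exists>F c. finite F \<and> F \<subseteq> I \<and>
        L2_norm (\<lambda>x. f x - (\<Sum>i\<in>F. c i * h i x)) < \<epsilon>)
   \<and> (\<exists>C3>0. \<exists>C4>0. \<forall>F c. finite F \<longrightarrow> F \<subseteq> I \<longrightarrow>
        C3 * (\<Sum>i\<in>F. (cmod (c i))\<^sup>2) \<le> (L2_norm (\<lambda>x. \<Sum>i\<in>F. c i * h i x))\<^sup>2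
      \<and> (L2_norm (\<lambda>x. \<Sum>i\<in>F. c i * h i x))\<^sup>2 \<le> C4 * (\<Sum>i\<in>F. (cmod (c i))\<^sup>2))"

text \<open>Integer powers of an invertible matrix: the type \<open>real ^ 'd ^ 'd\<close> is not an instance of
  the classes providing powers with respect to the matrix product.\<close>

definition mat_powi :: "real ^ 'd ^ 'd \<Rightarrow> int \<Rightarrow> real ^ 'd ^ 'd" where
  "mat_powi A j = (if 0 \<le> j then (((**) A) ^^ nat j) (mat 1)
                   else (((**) (matrix_inv A)) ^^ nat (- j)) (mat 1))"

definition dil_shift :: "real ^ 'd ^ 'd \<Rightarrow> real ^ 'd \<Rightarrow> (real ^ 'd \<Rightarrow> complex) \<Rightarrow> real ^ 'd \<Rightarrow> complex" where
  "dil_shift U k f = (\<lambda>x. complex_of_real (sqrt \<bar>det U\<bar>) * f (U *v x - k))"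

text \<open>The system \<open>WS\<^sub>J(\<Phi>; \<Psi>)\<close> as an indexed family: \<open>Inl (\<ell>, k)\<close> is the index of
  \<open>\<phi>\<^sup>\<ell>\<close> dilated by the \<open>J\<close>-th power of \<open>M\<close> and shifted by \<open>k\<close>, and \<open>Inr (n, j, k)\<close> that of
  \<open>\<psi>\<^sup>n\<close> dilated by the \<open>j\<close>-th power and shifted by \<open>k\<close>. A family of generators is a function on
  \<open>nat\<close> of which only the values at \<open>1, \<dots>, r\<close> (or \<open>1, \<dots>, s\<close>) are used.\<close>

definition WS_index :: "nat \<Rightarrow> nat \<Rightarrow> int \<Rightarrow> (nat \<times> (real ^ 'd) + nat \<times> int \<times> (real ^ 'd)) set" where
  "WS_index r s J = ({1..r} \<times> int_lattice) <+> ({1..s} \<times> {J..} \<times> int_lattice)"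

definition WS :: "real ^ 'd ^ 'd \<Rightarrow> int \<Rightarrow> (nat \<Rightarrow> real ^ 'd \<Rightarrow> complex) \<Rightarrow> (nat \<Rightarrow> real ^ 'd \<Rightarrow> complex)
    \<Rightarrow> nat \<times> (real ^ 'd) + nat \<times> int \<times> (real ^ 'd) \<Rightarrow> real ^ 'd \<Rightarrow> complex" where
  "WS M J \<phi> \<psi> i = (case i of Inl (l, k) \<Rightarrow> dil_shift (mat_powi M J) k (\<phi> l)
                           | Inr (n, j, k) \<Rightarrow> dil_shift (mat_powi M j) k (\<psi> n))"

definition riesz_wavelet_basis :: "real ^ 'd ^ 'd \<Rightarrow> int \<Rightarrow> nat \<Rightarrow> nat
    \<Rightarrow> (nat \<Rightarrow> real ^ 'd \<Rightarrow> complex) \<Rightarrow> (nat \<Rightarrow> real ^ 'd \<Rightarrow> complex) \<Rightarrow> bool" where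
  "riesz_wavelet_basis M J r s \<phi> \<psi> \<longleftrightarrow> riesz_basis (WS_index r s J) (WS M J \<phi> \<psi>)"

definition biorthogonal_wavelet_bases :: "real ^ 'd ^ 'd \<Rightarrow> int \<Rightarrow> nat \<Rightarrow> nat
    \<Rightarrow> (nat \<Rightarrow> real ^ 'd \<Rightarrow> complex) \<Rightarrow> (nat \<Rightarrow> real ^ 'd \<Rightarrow> complex)
    \<Rightarrow> (nat \<Rightarrow> real ^ 'd \<Rightarrow> complex) \<Rightarrow> (nat \<Rightarrow> real ^ 'd \<Rightarrow> complex) \<Rightarrow> bool" where
  "biorthogonal_wavelet_bases M J r s \<phi> \<psi> \<phi>' \<psi>' \<longleftrightarrow>
     riesz_wavelet_basis M J r s \<phi> \<psi> \<and> riesz_wavelet_basis M J r s \<phi>' \<psi>'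
   \<and> (\<forall>k\<in>int_lattice. \<forall>k'\<in>int_lattice. \<forall>l\<in>{1..r}. \<forall>l'\<in>{1..r}.
        L2_inner (dil_shift (mat_powi M J) k (\<phi> l)) (dil_shift (mat_powi M J) k' (\<phi>' l'))
          = of_bool (k = k' \<and> l = l'))
   \<and> (\<forall>k\<in>int_lattice. \<forall>k'\<in>int_lattice. \<forall>j\<ge>J. \<forall>n\<in>{1..s}. \<forall>l'\<in>{1..r}.
        L2_inner (dil_shift (mat_powi M j) k (\<psi> n)) (dil_shift (mat_powi M J) k' (\<phi>' l')) = 0)
   \<and> (\<forall>k\<in>int_lattice. \<forall>k'\<in>int_lattice. \<forall>j'\<ge>J. \<forall>l\<in>{1..r}. \<forall>n'\<in>{1..s}.
        L2_inner (dil_shift (mat_powi M J) k (\<phi> l)) (dil_shift (mat_powi M j') k' (\<psi>' n')) = 0)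
   \<and> (\<forall>k\<in>int_lattice. \<forall>k'\<in>int_lattice. \<forall>j\<ge>J. \<forall>j'\<ge>J. \<forall>n\<in>{1..s}. \<forall>n'\<in>{1..s}.
        L2_inner (dil_shift (mat_powi M j) k (\<psi> n)) (dil_shift (mat_powi M j') k' (\<psi>' n'))
          = of_bool (k = k' \<and> n = n' \<and> j = j'))"

end

theory Submission
  imports Defs "HOL-Probability.Probability"
begin

text \<open>
  Let \<open>V\<close> be the closed linear span of the integer shifts of the generators \<open>\<phi>\<close>, and let \<open>D\<close> be
  the unitary dilation by \<open>M\<close>. Each of the two statements of the theorem says that \<open>V\<close> contains
  the once coarser copies \<open>D\<inverse> (\<phi> l)\<close> and \<open>D\<inverse> (\<psi> n)\<close> of all generators.

  For the refinement equations this is Fourier analysis (\<open>refinement_iff\<close>). The Fourier transform turns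
  the shift by \<open>k\<close> into multiplication by \<open>exp (- \<i> k \<bullet> \<xi>)\<close>, so a finite combination of shifts becomes
  a sum of products \<open>p m\<close> times the transform of \<open>\<phi> m\<close>, with trigonometric polynomials \<open>p m\<close>. By
  Parseval's identity on the torus and the Riesz bounds, the norm of the combination is comparable
  with the norms of the \<open>p m\<close> (\<open>combination_bounds\<close>). Hence convergent sequences of combinations have
  convergent symbols, which gives the periodic coefficients
  (\<open>closed_span_imp_factorisation\<close>). Conversely, square-integrable periodic coefficients are limits of
  trigonometric polynomials (\<open>trigs_dense\<close>), and the limit of the corresponding combinations is the
  given function because the Fourier transform is injective (\<open>factorisation_imp_closed_span\<close>).

  From a biorthogonal pair to nestedness: if two Riesz bases are biorthogonal, a vector orthogonal to
  some of the dual vectors lies in the closed span of the remaining primal ones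
  (\<open>riesz_biorthogonal_closed_span\<close>). The vectors \<open>\<phi> l\<close> and \<open>\<psi> n\<close>, placed at level \<open>J - 1\<close>, are orthogonal
  to the dual wavelets of all levels \<open>j \<ge> J\<close>: raising both sides by one level gives a biorthogonality
  relation between level \<open>J\<close> and a level above \<open>J\<close>. They therefore lie in the closed span of the
  shifts of \<open>\<phi>\<close> at level \<open>J\<close> (\<open>biorthogonal_imp_closed_span\<close>).

  From nestedness to a biorthogonal pair (\<open>nested_imp_biorthogonal\<close>): every Riesz basis has dual vectors,
  found by orthogonal projection (\<open>dual_vector_exists\<close>). Only those belonging to the unshifted
  generators at level \<open>J\<close> are kept; moved to level \<open>0\<close> they are the dual generators. An inner product
  of a primal vector at level \<open>j\<close> and a dual one at level \<open>j'\<close> reduces to level \<open>j - j'\<close> against an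
  unshifted dual generator. If \<open>j \<ge> j'\<close>, the shift that appears is again an integer vector, since \<open>M\<close> has
  integer entries, and the inner product is known. If \<open>j < j'\<close>, the dual generator is a
  wavelet, hence orthogonal to \<open>V\<close>, and by nestedness the primal vector lies in \<open>V\<close>. A system
  biorthogonal to a Riesz basis is itself a Riesz basis (\<open>biorthogonal_riesz_basis\<close>).

  The analytic foundation is Plancherel's theorem (\<open>plancherel_L1_L2\<close>), derived by weighting with
  Gaussians of growing width, together with the change of variables for linear maps.
\<close>

section \<open>Square-integrable functions over a measure space\<close>

lemma borel_measurable_cnj [measurable]: "cnj \<in> borel_measurable borel"
  by (intro borel_measurable_continuous_onI continuous_intros)

lemma tendsto_of_norm_le:
  fixes f :: "nat \<Rightarrow> 'a::real_normed_vector"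
  assumes "g \<longlonglongrightarrow> 0" "\<And>n. norm (f n - l) \<le> g n"
  shows "f \<longlonglongrightarrow> l"
  by (rule LIM_zero_cancel, rule Lim_null_comparison[OF _ assms(1)]) (use assms(2) in simp)

text \<open>Functions are not identified when they agree almost everywhere. The measure is a parameter because
  three are needed: Lebesgue measure, its restriction to Borel sets, and the torus.\<close>
definition sq_int :: "'a measure \<Rightarrow> ('a \<Rightarrow> complex) set" where
  "sq_int M = {f. f \<in> borel_measurable M \<and> integrable M (\<lambda>x. (cmod (f x))\<^sup>2)}"

definition norm2 :: "'a measure \<Rightarrow> ('a \<Rightarrow> complex) \<Rightarrow> real" where
  "norm2 M f = sqrt (LINT x|M. (cmod (f x))\<^sup>2)"

definition ip2 :: "'a measure \<Rightarrow> ('a \<Rightarrow> complex) \<Rightarrow> ('a \<Rightarrow> complex) \<Rightarrow> complex" where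
  "ip2 M f g = (LINT x|M. f x * cnj (g x))"

lemma L2_eq: "L2 = sq_int lebesgue"
  and L2_norm_eq: "L2_norm = norm2 lebesgue"
  and L2_inner_eq: "L2_inner = ip2 lebesgue"
  by (auto simp: L2_def sq_int_def L2_norm_def norm2_def L2_inner_def ip2_def fun_eq_iff)

lemma sq_intD:
  assumes "f \<in> sq_int M"
  shows sq_int_meas: "f \<in> borel_measurable M"
    and sq_int_integrable: "integrable M (\<lambda>x. (cmod (f x))\<^sup>2)"
  using assms by (auto simp: sq_int_def)

lemma sq_intI: "f \<in> borel_measurable M \<Longrightarrow> integrable M (\<lambda>x. (cmod (f x))\<^sup>2) \<Longrightarrow> f \<in> sq_int M"
  by (simp add: sq_int_def)

lemma norm2_nonneg [simp]: "0 \<le> norm2 M f"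
  by (simp add: norm2_def)

lemma norm2_sq: "(norm2 M f)\<^sup>2 = (LINT x|M. (cmod (f x))\<^sup>2)"
  by (simp add: norm2_def)

lemma sq_int_bound:
  assumes g: "g \<in> sq_int M" and f: "f \<in> borel_measurable M"
    and le: "AE x in M. cmod (f x) \<le> C * cmod (g x)"
  shows "f \<in> sq_int M"
proof (rule sq_intI[OF f])
  have "integrable M (\<lambda>x. C\<^sup>2 * (cmod (g x))\<^sup>2)"
    using sq_int_integrable[OF g] by simp
  moreover have "AE x in M. norm ((cmod (f x))\<^sup>2) \<le> norm (C\<^sup>2 * (cmod (g x))\<^sup>2)"
    using le
  proof eventually_elim
    fix x assume "cmod (f x) \<le> C * cmod (g x)"
    then have "(cmod (f x))\<^sup>2 \<le> (C * cmod (g x))\<^sup>2" by (intro power_mono) auto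
    then show "norm ((cmod (f x))\<^sup>2) \<le> norm (C\<^sup>2 * (cmod (g x))\<^sup>2)"
      by (simp add: power_mult_distrib)
  qed
  ultimately show "integrable M (\<lambda>x. (cmod (f x))\<^sup>2)"
    using f by (elim Bochner_Integration.integrable_bound) auto
qed

lemma sum_sq_le: "(a + b)\<^sup>2 \<le> 2 * a\<^sup>2 + 2 * b\<^sup>2" for a b :: real
  using sum_squares_bound[of a b] by (simp add: power2_sum)

lemma sq_int_add:
  assumes f: "f \<in> sq_int M" and g: "g \<in> sq_int M"
  shows "(\<lambda>x. f x + g x) \<in> sq_int M"
proof (rule sq_intI)
  note [measurable] = sq_int_meas[OF f] sq_int_meas[OF g]
  show "(\<lambda>x. f x + g x) \<in> borel_measurable M" by measurable
  have "integrable M (\<lambda>x. 2 * (cmod (f x))\<^sup>2 + 2 * (cmod (g x))\<^sup>2)"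
    using sq_int_integrable[OF f] sq_int_integrable[OF g] by simp
  then show "integrable M (\<lambda>x. (cmod (f x + g x))\<^sup>2)"
  proof (rule Bochner_Integration.integrable_bound)
    show "AE x in M. norm ((cmod (f x + g x))\<^sup>2) \<le> norm (2 * (cmod (f x))\<^sup>2 + 2 * (cmod (g x))\<^sup>2)"
    proof (intro AE_I2)
      fix x
      have "(cmod (f x + g x))\<^sup>2 \<le> (cmod (f x) + cmod (g x))\<^sup>2"
        by (intro power_mono norm_triangle_ineq) auto
      also have "\<dots> \<le> 2 * (cmod (f x))\<^sup>2 + 2 * (cmod (g x))\<^sup>2" by (rule sum_sq_le)
      finally show "norm ((cmod (f x + g x))\<^sup>2) \<le> norm (2 * (cmod (f x))\<^sup>2 + 2 * (cmod (g x))\<^sup>2)"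
        by simp
    qed
  qed measurable
qed

lemma sq_int_cmult: "f \<in> sq_int M \<Longrightarrow> (\<lambda>x. c * f x) \<in> sq_int M"
  by (auto simp: sq_int_def norm_mult power_mult_distrib)

lemma sq_int_0 [simp]: "(\<lambda>x. 0) \<in> sq_int M"
  by (simp add: sq_int_def)

lemma sq_int_uminus: "f \<in> sq_int M \<Longrightarrow> (\<lambda>x. - f x) \<in> sq_int M"
  using sq_int_cmult[of f M "-1"] by simp

lemma sq_int_diff:
  "f \<in> sq_int M \<Longrightarrow> g \<in> sq_int M \<Longrightarrow> (\<lambda>x. f x - g x) \<in> sq_int M"
  using sq_int_add[OF _ sq_int_uminus, of f M g] by simp

lemma sq_int_sum:
  "(\<And>i. i \<in> F \<Longrightarrow> f i \<in> sq_int M) \<Longrightarrow> (\<lambda>x. \<Sum>i\<in>F. f i x) \<in> sq_int M"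
  by (induction F rule: infinite_finite_induct) (auto intro: sq_int_add)

lemma sq_int_lincomb:
  "(\<And>i. i \<in> F \<Longrightarrow> h i \<in> sq_int M) \<Longrightarrow> (\<lambda>x. \<Sum>i\<in>F. c i * h i x) \<in> sq_int M"
  by (intro sq_int_sum sq_int_cmult)

lemma sq_int_integrable_mult:
  assumes f: "f \<in> sq_int M" and g: "g \<in> sq_int M"
  shows "integrable M (\<lambda>x. f x * g x)"
proof -
  note [measurable] = sq_int_meas[OF f] sq_int_meas[OF g]
  have "integrable M (\<lambda>x. (cmod (f x))\<^sup>2 + (cmod (g x))\<^sup>2)"
    using sq_int_integrable[OF f] sq_int_integrable[OF g] by simp
  then show ?thesis
  proof (rule Bochner_Integration.integrable_bound)
    show "AE x in M. norm (f x * g x) \<le> norm ((cmod (f x))\<^sup>2 + (cmod (g x))\<^sup>2)"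
    proof (intro AE_I2)
      fix x
      have "cmod (f x) * cmod (g x) \<le> 2 * cmod (f x) * cmod (g x)" by simp
      also have "\<dots> \<le> (cmod (f x))\<^sup>2 + (cmod (g x))\<^sup>2" by (rule sum_squares_bound)
      finally show "norm (f x * g x) \<le> norm ((cmod (f x))\<^sup>2 + (cmod (g x))\<^sup>2)"
        by (simp add: norm_mult)
    qed
  qed measurable
qed

lemma sq_int_cnj: "f \<in> sq_int M \<Longrightarrow> (\<lambda>x. cnj (f x)) \<in> sq_int M"
  by (auto simp: sq_int_def)

lemma integrable_ip2:
  "f \<in> sq_int M \<Longrightarrow> g \<in> sq_int M \<Longrightarrow> integrable M (\<lambda>x. f x * cnj (g x))"
  by (intro sq_int_integrable_mult sq_int_cnj)

lemma norm2_cong_AE: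
  assumes "f \<in> borel_measurable M" "g \<in> borel_measurable M" "AE x in M. f x = g x"
  shows "norm2 M f = norm2 M g"
  unfolding norm2_def using assms by (intro arg_cong[where f=sqrt] integral_cong_AE) auto

lemma sq_int_cong_AE:
  assumes "f \<in> sq_int M" "g \<in> borel_measurable M" "AE x in M. f x = g x"
  shows "g \<in> sq_int M"
proof (rule sq_int_bound[OF assms(1,2)])
  show "AE x in M. cmod (g x) \<le> 1 * cmod (f x)" using assms(3) by eventually_elim auto
qed

lemma norm2_eq_0_iff:
  assumes f: "f \<in> sq_int M"
  shows "norm2 M f = 0 \<longleftrightarrow> (AE x in M. f x = 0)"
proof -
  have "norm2 M f = 0 \<longleftrightarrow> (LINT x|M. (cmod (f x))\<^sup>2) = 0"
    by (simp add: norm2_def)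
  also have "\<dots> \<longleftrightarrow> (AE x in M. (cmod (f x))\<^sup>2 = 0)"
    by (rule integral_nonneg_eq_0_iff_AE[OF sq_int_integrable[OF f]]) auto
  finally show ?thesis by simp
qed

lemma norm2_cmult: "norm2 M (\<lambda>x. c * f x) = cmod c * norm2 M f"
  by (simp add: norm2_def norm_mult power_mult_distrib real_sqrt_mult)

lemma norm2_uminus: "norm2 M (\<lambda>x. - f x) = norm2 M f"
  by (simp add: norm2_def)

lemma norm2_minus_commute: "norm2 M (\<lambda>x. f x - g x) = norm2 M (\<lambda>x. g x - f x)"
  by (simp add: norm2_def norm_minus_commute)

lemma ip2_self: "ip2 M f f = complex_of_real ((norm2 M f)\<^sup>2)"
proof -
  have "(\<lambda>x. f x * cnj (f x)) = (\<lambda>x. complex_of_real ((cmod (f x))\<^sup>2))"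
    by (simp only: complex_norm_square)
  then show ?thesis by (simp only: ip2_def norm2_sq integral_complex_of_real)
qed

lemma ip2_cnj: "ip2 M g f = cnj (ip2 M f g)"
proof -
  have "cnj (ip2 M f g) = (LINT x|M. cnj (f x * cnj (g x)))"
    unfolding ip2_def by (rule Bochner_Integration.integral_cnj[symmetric])
  then show ?thesis by (simp add: ip2_def mult.commute)
qed

lemma ip2_add_left:
  "f \<in> sq_int M \<Longrightarrow> g \<in> sq_int M \<Longrightarrow> h \<in> sq_int M \<Longrightarrow>
   ip2 M (\<lambda>x. f x + g x) h = ip2 M f h + ip2 M g h"
  unfolding ip2_def distrib_right by (intro Bochner_Integration.integral_add integrable_ip2)

lemma ip2_diff_left:
  "f \<in> sq_int M \<Longrightarrow> g \<in> sq_int M \<Longrightarrow> h \<in> sq_int M \<Longrightarrow>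
   ip2 M (\<lambda>x. f x - g x) h = ip2 M f h - ip2 M g h"
  unfolding ip2_def left_diff_distrib by (intro Bochner_Integration.integral_diff integrable_ip2)

lemma ip2_cmult_left: "ip2 M (\<lambda>x. c * f x) h = c * ip2 M f h"
  by (simp add: ip2_def mult.assoc)

lemma ip2_cmult_right: "ip2 M f (\<lambda>x. c * h x) = cnj c * ip2 M f h"
  by (subst (1 2) ip2_cnj) (simp add: ip2_cmult_left)

lemma ip2_diff_right:
  "f \<in> sq_int M \<Longrightarrow> g \<in> sq_int M \<Longrightarrow> h \<in> sq_int M \<Longrightarrow>
   ip2 M h (\<lambda>x. f x - g x) = ip2 M h f - ip2 M h g"
  by (subst (1 2 3) ip2_cnj) (simp add: ip2_diff_left)

lemma ip2_sum_left:
  assumes "\<And>i. i \<in> F \<Longrightarrow> h i \<in> sq_int M" "g \<in> sq_int M"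
  shows "ip2 M (\<lambda>x. \<Sum>i\<in>F. c i * h i x) g = (\<Sum>i\<in>F. c i * ip2 M (h i) g)"
  using assms(1)
proof (induction F rule: infinite_finite_induct)
  case (insert i F)
  then show ?case
    using assms(2) by (simp add: ip2_add_left sq_int_cmult sq_int_lincomb ip2_cmult_left)
qed (simp_all add: ip2_def)

lemma ip2_sum_right:
  assumes "\<And>i. i \<in> F \<Longrightarrow> h i \<in> sq_int M" "g \<in> sq_int M"
  shows "ip2 M g (\<lambda>x. \<Sum>i\<in>F. c i * h i x) = (\<Sum>i\<in>F. cnj (c i) * ip2 M g (h i))"
  by (subst (1 2) ip2_cnj) (simp add: ip2_sum_left assms)

lemma Cauchy_Schwarz_ip2:
  assumes f: "f \<in> sq_int M" and g: "g \<in> sq_int M"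
  shows "cmod (ip2 M f g) \<le> norm2 M f * norm2 M g"
proof (cases "norm2 M f = 0 \<or> norm2 M g = 0")
  case True
  note [measurable] = sq_int_meas[OF f] sq_int_meas[OF g]
  from True have "AE x in M. f x * cnj (g x) = 0"
    using norm2_eq_0_iff[OF f] norm2_eq_0_iff[OF g] by auto
  then have "ip2 M f g = (LINT x|M. 0)"
    unfolding ip2_def by (intro integral_cong_AE) auto
  then show ?thesis by simp
next
  case False
  define a b where "a = norm2 M f" and "b = norm2 M g"
  have ab: "a > 0" "b > 0"
    using False by (simp_all add: a_def b_def less_le)
  have "cmod (ip2 M f g) \<le> (LINT x|M. norm (f x * cnj (g x)))"
    unfolding ip2_def by (rule integral_norm_bound)
  also have "\<dots> \<le> (LINT x|M. (b / a * (cmod (f x))\<^sup>2 + a / b * (cmod (g x))\<^sup>2) / 2)"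
  proof (rule integral_mono)
    show "integrable M (\<lambda>x. norm (f x * cnj (g x)))"
      using integrable_ip2[OF f g] by simp
    show "integrable M (\<lambda>x. (b / a * (cmod (f x))\<^sup>2 + a / b * (cmod (g x))\<^sup>2) / 2)"
      using sq_int_integrable[OF f] sq_int_integrable[OF g] by simp
    fix x
    have "0 \<le> (b * cmod (f x) - a * cmod (g x))\<^sup>2 / (a * b)" using ab by simp
    also have "\<dots> = b / a * (cmod (f x))\<^sup>2 + a / b * (cmod (g x))\<^sup>2 - 2 * (cmod (f x) * cmod (g x))"
      using ab by (simp add: field_simps power2_eq_square)
    finally show "norm (f x * cnj (g x)) \<le> (b / a * (cmod (f x))\<^sup>2 + a / b * (cmod (g x))\<^sup>2) / 2"
      by (simp add: norm_mult)
  qed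
  also have "\<dots> = (b / a * a\<^sup>2 + a / b * b\<^sup>2) / 2"
    using sq_int_integrable[OF f] sq_int_integrable[OF g]
    by (simp add: a_def b_def norm2_sq)
  also have "\<dots> = a * b" using ab by (simp add: power2_eq_square)
  finally show ?thesis by (simp add: a_def b_def)
qed

lemma norm2_add_sq:
  assumes f: "f \<in> sq_int M" and g: "g \<in> sq_int M"
  shows "(norm2 M (\<lambda>x. f x + g x))\<^sup>2 = (norm2 M f)\<^sup>2 + 2 * Re (ip2 M f g) + (norm2 M g)\<^sup>2"
proof -
  have "(cmod (f x + g x))\<^sup>2 = (cmod (f x))\<^sup>2 + 2 * Re (f x * cnj (g x)) + (cmod (g x))\<^sup>2" for x
    by (simp only: cmod_power2) (simp add: power2_eq_square algebra_simps)
  moreover have "integrable M (\<lambda>x. Re (f x * cnj (g x)))"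
    by (intro integrable_Re integrable_ip2 f g)
  moreover have "(LINT x|M. Re (f x * cnj (g x))) = Re (ip2 M f g)"
    unfolding ip2_def by (rule integral_Re[OF integrable_ip2[OF f g]])
  ultimately show ?thesis
    using sq_int_integrable[OF f] sq_int_integrable[OF g]
    unfolding norm2_sq by (simp del: times_complex.sel)
qed

lemma norm2_triangle:
  assumes f: "f \<in> sq_int M" and g: "g \<in> sq_int M"
  shows "norm2 M (\<lambda>x. f x + g x) \<le> norm2 M f + norm2 M g"
proof (rule power2_le_imp_le)
  have "Re (ip2 M f g) \<le> norm2 M f * norm2 M g"
    using complex_Re_le_cmod Cauchy_Schwarz_ip2[OF f g] by (rule order_trans)
  then show "(norm2 M (\<lambda>x. f x + g x))\<^sup>2 \<le> (norm2 M f + norm2 M g)\<^sup>2"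
    by (simp add: norm2_add_sq[OF f g] power2_sum)
qed simp

lemma norm2_triangle_diff:
  assumes f: "f \<in> sq_int M" and g: "g \<in> sq_int M" and h: "h \<in> sq_int M"
  shows "norm2 M (\<lambda>x. f x - h x) \<le> norm2 M (\<lambda>x. f x - g x) + norm2 M (\<lambda>x. g x - h x)"
  using norm2_triangle[OF sq_int_diff[OF f g] sq_int_diff[OF g h]] by simp

lemma norm2_reverse_triangle:
  assumes f: "f \<in> sq_int M" and g: "g \<in> sq_int M"
  shows "\<bar>norm2 M f - norm2 M g\<bar> \<le> norm2 M (\<lambda>x. f x - g x)"
  using norm2_triangle[OF sq_int_diff[OF f g] g] norm2_triangle[OF sq_int_diff[OF g f] f]
  by (simp add: norm2_minus_commute[of M g f])

lemma parallelogram_norm2: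
  assumes f: "f \<in> sq_int M" and g: "g \<in> sq_int M"
  shows "(norm2 M (\<lambda>x. f x - g x))\<^sup>2 + (norm2 M (\<lambda>x. f x + g x))\<^sup>2
    = 2 * (norm2 M f)\<^sup>2 + 2 * (norm2 M g)\<^sup>2"
proof -
  have "ip2 M f (\<lambda>x. - g x) = - ip2 M f g"
    using ip2_cmult_right[of M f "-1" g] by simp
  then show ?thesis
    using norm2_add_sq[OF f g] norm2_add_sq[OF f sq_int_uminus[OF g]] by (simp add: norm2_uminus)
qed

lemma nn_integral_norm2:
  assumes "f \<in> sq_int M"
  shows "(\<integral>\<^sup>+x. ennreal ((cmod (f x))\<^sup>2) \<partial>M) = ennreal ((norm2 M f)\<^sup>2)"
  unfolding norm2_sq by (rule nn_integral_eq_integral[OF sq_int_integrable[OF assms]]) simp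

lemma norm2_leI:
  assumes f: "f \<in> borel_measurable M" and C: "0 \<le> C"
    and le: "(\<integral>\<^sup>+x. ennreal ((cmod (f x))\<^sup>2) \<partial>M) \<le> ennreal (C\<^sup>2)"
  shows "f \<in> sq_int M" "norm2 M f \<le> C"
proof -
  show "f \<in> sq_int M"
  proof (rule sq_intI[OF f], rule integrableI_bounded)
    show "(\<integral>\<^sup>+x. ennreal (norm ((cmod (f x))\<^sup>2)) \<partial>M) < \<infinity>"
      using order_le_less_trans[OF le ennreal_less_top] by simp
  qed (use f in measurable)
  from nn_integral_norm2[OF this] le have "(norm2 M f)\<^sup>2 \<le> C\<^sup>2"
    by (simp add: ennreal_le_iff)
  then show "norm2 M f \<le> C" using C by (rule power2_le_imp_le)
qed

text \<open>The weights \<open>2 ^ n\<close> grow more slowly than the squared norms \<open>(1/4) ^ n\<close> decay, so the weighted squares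
  still have a finite integral when summed over \<open>n\<close>; the sum is then finite almost everywhere. A geometric
  rate in the norm thus gives a geometric rate at almost every point.\<close>
lemma AE_bounded_of_geometric_norm2:
  assumes d: "\<And>n. d n \<in> sq_int M" and le: "\<And>n. norm2 M (d n) \<le> C * (1/2) ^ n"
  shows "AE x in M. \<exists>K. \<forall>n. 2 ^ n * (cmod (d n x))\<^sup>2 \<le> K"
proof -
  note [measurable] = sq_int_meas[OF d]
  have C: "0 \<le> C" using order_trans[OF norm2_nonneg le[of 0]] by simp
  have "(\<integral>\<^sup>+x. (\<Sum>n. ennreal (2 ^ n * (cmod (d n x))\<^sup>2)) \<partial>M)
      = (\<Sum>n. \<integral>\<^sup>+x. ennreal (2 ^ n * (cmod (d n x))\<^sup>2) \<partial>M)"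
    by (rule nn_integral_suminf) measurable
  also have "\<dots> \<le> (\<Sum>n. ennreal (C\<^sup>2 * (1/2) ^ n))"
  proof (intro suminf_le summableI)
    fix n
    have "(\<integral>\<^sup>+x. ennreal (2 ^ n * (cmod (d n x))\<^sup>2) \<partial>M)
        = ennreal (2 ^ n) * (\<integral>\<^sup>+x. ennreal ((cmod (d n x))\<^sup>2) \<partial>M)"
      by (subst nn_integral_cmult[symmetric]) (auto simp: ennreal_mult')
    also have "\<dots> = ennreal (2 ^ n * (norm2 M (d n))\<^sup>2)"
      by (simp add: nn_integral_norm2[OF d] ennreal_mult)
    also have "\<dots> \<le> ennreal (2 ^ n * (C * (1/2) ^ n)\<^sup>2)"
      by (intro ennreal_leI mult_left_mono power_mono le) auto
    also have "2 ^ n * (C * (1/2) ^ n)\<^sup>2 = C\<^sup>2 * (1/2::real) ^ n"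
      by (simp add: power_mult_distrib power_divide power2_eq_square field_simps)
    finally show "(\<integral>\<^sup>+x. ennreal (2 ^ n * (cmod (d n x))\<^sup>2) \<partial>M) \<le> ennreal (C\<^sup>2 * (1/2) ^ n)" .
  qed
  also have "\<dots> = ennreal (\<Sum>n. C\<^sup>2 * (1/2) ^ n)"
    by (intro suminf_ennreal2 summable_mult summable_geometric) auto
  finally have "(\<integral>\<^sup>+x. (\<Sum>n. ennreal (2 ^ n * (cmod (d n x))\<^sup>2)) \<partial>M) \<noteq> \<infinity>"
    by (auto simp: top_unique)
  then have "AE x in M. (\<Sum>n. ennreal (2 ^ n * (cmod (d n x))\<^sup>2)) \<noteq> \<infinity>"
    by (intro nn_integral_PInf_AE) measurable
  then show ?thesis
  proof eventually_elim
    fix x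
    let ?S = "\<Sum>n. ennreal (2 ^ n * (cmod (d n x))\<^sup>2)"
    assume "?S \<noteq> \<infinity>"
    then have S: "?S = ennreal (enn2real ?S)" by (simp only: ennreal_enn2real_if infinity_ennreal_def if_False)
    have "2 ^ n * (cmod (d n x))\<^sup>2 \<le> enn2real ?S" for n
    proof -
      have "(\<Sum>n\<in>{n}. ennreal (2 ^ n * (cmod (d n x))\<^sup>2)) \<le> ?S"
        by (rule sum_le_suminf) (auto intro: summableI)
      then have "ennreal (2 ^ n * (cmod (d n x))\<^sup>2) \<le> ennreal (enn2real ?S)"
        by (subst S[symmetric]) simp
      then show ?thesis by (subst (asm) ennreal_le_iff) (rule enn2real_nonneg)
    qed
    then show "\<exists>K. \<forall>n. 2 ^ n * (cmod (d n x))\<^sup>2 \<le> K" by blast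
  qed
qed

lemma cmod_le_geometric:
  assumes "2 ^ n * (cmod z)\<^sup>2 \<le> K"
  shows "cmod z \<le> sqrt K * (sqrt (1/2)) ^ n"
proof -
  have "(cmod z)\<^sup>2 \<le> K * (1/2) ^ n"
    using assms by (simp add: field_simps power_divide)
  then have "sqrt ((cmod z)\<^sup>2) \<le> sqrt (K * (1/2) ^ n)" by (rule real_sqrt_le_mono)
  then show ?thesis by (simp add: real_sqrt_mult real_sqrt_power)
qed

lemma AE_tendsto_of_geometric_norm2:
  assumes u: "\<And>n. u n \<in> sq_int M" and f: "f \<in> sq_int M"
    and le: "\<And>n. norm2 M (\<lambda>x. u n x - f x) \<le> C * (1/2) ^ n"
  shows "AE x in M. (\<lambda>n. u n x) \<longlonglongrightarrow> f x"
  using AE_bounded_of_geometric_norm2[of "\<lambda>n x. u n x - f x", OF sq_int_diff[OF u f] le]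
proof eventually_elim
  fix x assume "\<exists>K. \<forall>n. 2 ^ n * (cmod (u n x - f x))\<^sup>2 \<le> K"
  then obtain K where K: "\<And>n. 2 ^ n * (cmod (u n x - f x))\<^sup>2 \<le> K" by auto
  have "(\<lambda>n. sqrt K * (sqrt (1/2)) ^ n) \<longlonglongrightarrow> sqrt K * 0"
    by (intro tendsto_mult tendsto_const LIMSEQ_power_zero) (simp add: real_sqrt_divide)
  then have "(\<lambda>n. sqrt K * (sqrt (1/2)) ^ n) \<longlonglongrightarrow> 0" by simp
  then show "(\<lambda>n. u n x) \<longlonglongrightarrow> f x"
    by (rule tendsto_of_norm_le[of "\<lambda>n. sqrt K * (sqrt (1/2)) ^ n"]) (use cmod_le_geometric[OF K] in simp_all)
qed

lemma norm2_le_geometric_Cauchy: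
  assumes u: "\<And>n. u n \<in> sq_int M"
    and le: "\<And>n. norm2 M (\<lambda>x. u (Suc n) x - u n x) \<le> C * (1/2) ^ n"
    and nm: "n \<le> m"
  shows "norm2 M (\<lambda>x. u m x - u n x) \<le> 2 * C * ((1/2) ^ n - (1/2) ^ m)"
  using nm
proof (induction m rule: dec_induct)
  case base
  then show ?case by (simp add: norm2_def)
next
  case (step m)
  have "norm2 M (\<lambda>x. u (Suc m) x - u n x)
      \<le> norm2 M (\<lambda>x. u (Suc m) x - u m x) + norm2 M (\<lambda>x. u m x - u n x)"
    by (intro norm2_triangle_diff u)
  also have "\<dots> \<le> C * (1/2) ^ m + 2 * C * ((1/2) ^ n - (1/2) ^ m)"
    by (intro add_mono le step)
  finally show ?case by (simp add: algebra_simps)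
qed

text \<open>The theorem of Riesz and Fischer for sequences with geometric rate: the increments are summable at
  almost every point, and Fatou's lemma transfers the Cauchy estimate to the pointwise limit. The limit is
  given as \<open>lim\<close> rather than asserted to exist, so that properties of all \<open>u n\<close>, such as periodicity,
  pass to it everywhere.\<close>
lemma sq_int_complete:
  assumes u: "\<And>n. u n \<in> sq_int M"
    and le: "\<And>n. norm2 M (\<lambda>x. u (Suc n) x - u n x) \<le> C * (1/2) ^ n"
  defines "f \<equiv> \<lambda>x. lim (\<lambda>n. u n x)"
  shows sq_int_lim: "f \<in> sq_int M"
    and norm2_lim_le: "norm2 M (\<lambda>x. u n x - f x) \<le> 2 * C * (1/2) ^ n"
    and AE_tendsto_lim: "AE x in M. (\<lambda>n. u n x) \<longlonglongrightarrow> f x"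
proof -
  note [measurable] = sq_int_meas[OF u]
  have C: "0 \<le> C" using order_trans[OF norm2_nonneg le[of 0]] by simp
  have f[measurable]: "f \<in> borel_measurable M"
    unfolding f_def by measurable
  show conv: "AE x in M. (\<lambda>n. u n x) \<longlonglongrightarrow> f x"
    using AE_bounded_of_geometric_norm2[of "\<lambda>n x. u (Suc n) x - u n x", OF sq_int_diff[OF u u] le]
  proof eventually_elim
    fix x assume "\<exists>K. \<forall>n. 2 ^ n * (cmod (u (Suc n) x - u n x))\<^sup>2 \<le> K"
    then obtain K where K: "\<And>n. 2 ^ n * (cmod (u (Suc n) x - u n x))\<^sup>2 \<le> K" by auto
    have "summable (\<lambda>n. u (Suc n) x - u n x)"
    proof (rule summable_comparison_test')
      show "summable (\<lambda>n. sqrt K * (sqrt (1/2)) ^ n)"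
        by (intro summable_mult summable_geometric) (simp add: real_sqrt_divide)
    qed (use cmod_le_geometric[OF K] in auto)
    then have "convergent (\<lambda>n. \<Sum>i<n. u (Suc i) x - u i x)"
      by (simp add: summable_iff_convergent)
    then have "convergent (\<lambda>n. u n x - u 0 x)"
      by (simp only: sum_lessThan_telescope[of "\<lambda>n. u n x"])
    then have "convergent (\<lambda>n. (u n x - u 0 x) + u 0 x)"
      by (intro convergent_add convergent_const)
    then show "(\<lambda>n. u n x) \<longlonglongrightarrow> f x"
      by (simp add: convergent_LIMSEQ_iff f_def)
  qed
  have lim: "(\<lambda>x. u n x - f x) \<in> sq_int M \<and> norm2 M (\<lambda>x. u n x - f x) \<le> 2 * C * (1/2) ^ n" for n
  proof -
    have "(\<integral>\<^sup>+x. ennreal ((cmod (u n x - f x))\<^sup>2) \<partial>M)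
        = (\<integral>\<^sup>+x. liminf (\<lambda>m. ennreal ((cmod (u n x - u m x))\<^sup>2)) \<partial>M)"
    proof (rule nn_integral_cong_AE, use conv in eventually_elim)
      fix x assume "(\<lambda>n. u n x) \<longlonglongrightarrow> f x"
      then have "(\<lambda>m. ennreal ((cmod (u n x - u m x))\<^sup>2)) \<longlonglongrightarrow> ennreal ((cmod (u n x - f x))\<^sup>2)"
        by (intro tendsto_intros)
      then show "ennreal ((cmod (u n x - f x))\<^sup>2) = liminf (\<lambda>m. ennreal ((cmod (u n x - u m x))\<^sup>2))"
        by (intro lim_imp_Liminf[symmetric] sequentially_bot)
    qed
    also have "\<dots> \<le> liminf (\<lambda>m. \<integral>\<^sup>+x. ennreal ((cmod (u n x - u m x))\<^sup>2) \<partial>M)"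
      by (rule nn_integral_liminf) measurable
    also have "\<dots> \<le> ennreal ((2 * C * (1/2) ^ n)\<^sup>2)"
    proof (rule Liminf_le)
      show "\<forall>\<^sub>F m in sequentially. (\<integral>\<^sup>+x. ennreal ((cmod (u n x - u m x))\<^sup>2) \<partial>M) \<le> ennreal ((2 * C * (1/2) ^ n)\<^sup>2)"
        using eventually_ge_at_top[of n]
      proof eventually_elim
        fix m assume nm: "n \<le> m"
        have "norm2 M (\<lambda>x. u n x - u m x) \<le> 2 * C * ((1/2) ^ n - (1/2) ^ m)"
          using norm2_le_geometric_Cauchy[OF u le nm] by (subst norm2_minus_commute)
        also have "\<dots> \<le> 2 * C * (1/2) ^ n" using C by (intro mult_left_mono) auto
        finally show "(\<integral>\<^sup>+x. ennreal ((cmod (u n x - u m x))\<^sup>2) \<partial>M) \<le> ennreal ((2 * C * (1/2) ^ n)\<^sup>2)"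
          by (subst nn_integral_norm2[OF sq_int_diff[OF u u]]) (intro ennreal_leI power_mono norm2_nonneg)
      qed
    qed simp
    finally show ?thesis using norm2_leI[of "\<lambda>x. u n x - f x" M "2 * C * (1/2) ^ n"] C by auto
  qed
  then show "norm2 M (\<lambda>x. u n x - f x) \<le> 2 * C * (1/2) ^ n" by simp
  have "(\<lambda>x. u 0 x - (u 0 x - f x)) \<in> sq_int M" by (rule sq_int_diff[OF u]) (use lim[of 0] in simp)
  then show "f \<in> sq_int M" by simp
qed

lemma norm2_dominated_convergence:
  assumes u: "\<And>n. u n \<in> borel_measurable M" and f: "f \<in> borel_measurable M" and w: "w \<in> sq_int M"
    and lim: "AE x in M. (\<lambda>n. u n x) \<longlonglongrightarrow> f x"
    and dom: "\<And>n. AE x in M. cmod (u n x) \<le> cmod (w x)"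
  shows "f \<in> sq_int M" "(\<lambda>n. norm2 M (\<lambda>x. u n x - f x)) \<longlonglongrightarrow> 0"
proof -
  note [measurable] = u f sq_int_meas[OF w]
  have all: "AE x in M. \<forall>n. cmod (u n x) \<le> cmod (w x)"
    using dom by (simp add: AE_all_countable)
  have fle: "AE x in M. cmod (f x) \<le> cmod (w x)"
    using all lim by eventually_elim (auto intro: LIMSEQ_le_const2 tendsto_norm)
  then show fs: "f \<in> sq_int M" using sq_int_bound[OF w f, of 1] by simp
  have "(\<lambda>n. LINT x|M. (cmod (u n x - f x))\<^sup>2) \<longlonglongrightarrow> (LINT x|M. 0)"
  proof (rule integral_dominated_convergence)
    show "integrable M (\<lambda>x. 4 * (cmod (w x))\<^sup>2)" using sq_int_integrable[OF w] by simp
    show "AE x in M. (\<lambda>n. (cmod (u n x - f x))\<^sup>2) \<longlonglongrightarrow> 0"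
      using lim
    proof eventually_elim
      fix x assume "(\<lambda>n. u n x) \<longlonglongrightarrow> f x"
      then have "(\<lambda>n. (cmod (u n x - f x))\<^sup>2) \<longlonglongrightarrow> (cmod (f x - f x))\<^sup>2" by (intro tendsto_intros)
      then show "(\<lambda>n. (cmod (u n x - f x))\<^sup>2) \<longlonglongrightarrow> 0" by simp
    qed
    show "AE x in M. norm ((cmod (u n x - f x))\<^sup>2) \<le> 4 * (cmod (w x))\<^sup>2" for n
      using all fle
    proof eventually_elim
      fix x assume "\<forall>n. cmod (u n x) \<le> cmod (w x)" "cmod (f x) \<le> cmod (w x)"
      then have "cmod (u n x - f x) \<le> 2 * cmod (w x)"
        by (smt (verit) norm_triangle_ineq4)
      then have "(cmod (u n x - f x))\<^sup>2 \<le> (2 * cmod (w x))\<^sup>2" by (intro power_mono) auto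
      then show "norm ((cmod (u n x - f x))\<^sup>2) \<le> 4 * (cmod (w x))\<^sup>2" by (simp add: power_mult_distrib)
    qed
  qed measurable
  then have "(\<lambda>n. sqrt (LINT x|M. (cmod (u n x - f x))\<^sup>2)) \<longlonglongrightarrow> sqrt 0"
    by (intro tendsto_real_sqrt) simp
  then show "(\<lambda>n. norm2 M (\<lambda>x. u n x - f x)) \<longlonglongrightarrow> 0" by (simp add: norm2_def)
qed

lemma tendsto_ip2_left:
  assumes u: "\<And>n. u n \<in> sq_int M" and f: "f \<in> sq_int M" and g: "g \<in> sq_int M"
    and lim: "(\<lambda>n. norm2 M (\<lambda>x. u n x - f x)) \<longlonglongrightarrow> 0"
  shows "(\<lambda>n. ip2 M (u n) g) \<longlonglongrightarrow> ip2 M f g"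
proof -
  have "(\<lambda>n. norm2 M (\<lambda>x. u n x - f x) * norm2 M g) \<longlonglongrightarrow> 0 * norm2 M g"
    by (intro tendsto_intros lim)
  then have "(\<lambda>n. norm2 M (\<lambda>x. u n x - f x) * norm2 M g) \<longlonglongrightarrow> 0" by simp
  then show ?thesis
    by (rule tendsto_of_norm_le[of "\<lambda>n. norm2 M (\<lambda>x. u n x - f x) * norm2 M g"])
      (use Cauchy_Schwarz_ip2[OF sq_int_diff[OF u f] g] in \<open>simp_all add: ip2_diff_left u f g\<close>)
qed

lemma tendsto_norm2:
  assumes u: "\<And>n. u n \<in> sq_int M" and f: "f \<in> sq_int M"
    and lim: "(\<lambda>n. norm2 M (\<lambda>x. u n x - f x)) \<longlonglongrightarrow> 0"
  shows "(\<lambda>n. norm2 M (u n)) \<longlonglongrightarrow> norm2 M f"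
proof -
  show ?thesis
    by (rule tendsto_of_norm_le[OF lim]) (use norm2_reverse_triangle[OF u f] in simp)
qed

section \<open>Affine changes of variables\<close>

lemma Basis_vec_real: "(Basis :: (real ^ 'd) set) = range (\<lambda>i. axis i 1)"
  by (auto simp: Basis_vec_def)

lemma inj_axis_1: "inj (\<lambda>i. axis i (1::real) :: real ^ 'd)"
  by (auto simp: inj_on_def axis_eq_axis)

lemma prod_Basis_vec: "(\<Prod>b\<in>(Basis :: (real ^ 'd) set). f b) = (\<Prod>i\<in>UNIV. f (axis i 1))"
  unfolding Basis_vec_real by (subst prod.reindex[OF inj_axis_1]) simp

lemma sum_Basis_vec: "(\<Sum>b\<in>(Basis :: (real ^ 'd) set). f b) = (\<Sum>i\<in>UNIV. f (axis i 1))"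
  unfolding Basis_vec_real by (subst sum.reindex[OF inj_axis_1]) simp

text \<open>By Fubini's theorem the coordinate along \<open>m\<close> may be integrated first. With the other coordinates fixed, the
  shear is a translation of that coordinate.\<close>
lemma nn_integral_lborel_shear:
  fixes m n :: "'a::euclidean_space"
  assumes m: "m \<in> Basis" and n: "n \<in> Basis" and mn: "m \<noteq> n"
    and f[measurable]: "f \<in> borel_measurable borel"
  shows "(\<integral>\<^sup>+x. f (x + (c * (x \<bullet> n)) *\<^sub>R m) \<partial>lborel) = (\<integral>\<^sup>+x. f x \<partial>lborel)"
proof -
  interpret product_sigma_finite "\<lambda>_::'a. lborel::real measure" by standard
  define I where "I = (Basis - {m} :: 'a set)"
  have I: "finite I" "m \<notin> I" "Basis = insert m I" "n \<in> I"
    using m n mn by (auto simp: I_def)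
  have split: "(\<integral>\<^sup>+x. g x \<partial>lborel)
      = (\<integral>\<^sup>+x. \<integral>\<^sup>+y. g ((\<Sum>b\<in>I. x b *\<^sub>R b) + y *\<^sub>R m) \<partial>lborel \<partial>Pi\<^sub>M I (\<lambda>_. lborel))"
    if [measurable]: "g \<in> borel_measurable borel" for g :: "'a \<Rightarrow> ennreal"
  proof -
    have "(\<integral>\<^sup>+x. g x \<partial>lborel) = (\<integral>\<^sup>+x. g (\<Sum>b\<in>Basis. x b *\<^sub>R b) \<partial>Pi\<^sub>M Basis (\<lambda>_. lborel))"
      by (subst lborel_eq) (simp add: nn_integral_distr)
    also have "\<dots> = (\<integral>\<^sup>+x. \<integral>\<^sup>+y. g (\<Sum>b\<in>Basis. (x(m := y)) b *\<^sub>R b) \<partial>lborel \<partial>Pi\<^sub>M I (\<lambda>_. lborel))"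
      unfolding I(3) using I(1,2) by (intro product_nn_integral_insert) measurable
    also have "(\<lambda>x y. g (\<Sum>b\<in>Basis. (x(m := y)) b *\<^sub>R b)) = (\<lambda>x y. g ((\<Sum>b\<in>I. x b *\<^sub>R b) + y *\<^sub>R m))"
    proof (intro ext arg_cong[where f=g])
      fix x and y :: real
      have "(\<Sum>b\<in>I. (x(m := y)) b *\<^sub>R b) = (\<Sum>b\<in>I. x b *\<^sub>R b)"
        using I(2) by (intro sum.cong) auto
      then show "(\<Sum>b\<in>Basis. (x(m := y)) b *\<^sub>R b) = (\<Sum>b\<in>I. x b *\<^sub>R b) + y *\<^sub>R m"
        using I(1,2) by (simp add: I(3) add.commute)
    qed
    finally show ?thesis .
  qed
  have "(\<integral>\<^sup>+x. f (x + (c * (x \<bullet> n)) *\<^sub>R m) \<partial>lborel)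
      = (\<integral>\<^sup>+x. \<integral>\<^sup>+y. f ((\<Sum>b\<in>I. x b *\<^sub>R b) + (c * x n + 1 * y) *\<^sub>R m) \<partial>lborel \<partial>Pi\<^sub>M I (\<lambda>_. lborel))"
  proof (subst split, measurable, intro nn_integral_cong arg_cong[where f=f])
    fix x :: "'a \<Rightarrow> real" and y
    have "((\<Sum>b\<in>I. x b *\<^sub>R b) + y *\<^sub>R m) \<bullet> n = (\<Sum>b\<in>I. x b * (b \<bullet> n))"
      using m n mn by (simp add: inner_add_left inner_sum_left inner_Basis)
    also have "\<dots> = (\<Sum>b\<in>I. if b = n then x b else 0)"
      using n by (intro sum.cong) (auto simp: inner_Basis I_def)
    also have "\<dots> = x n" using I by simp
    finally show "(\<Sum>b\<in>I. x b *\<^sub>R b) + y *\<^sub>R m + (c * (((\<Sum>b\<in>I. x b *\<^sub>R b) + y *\<^sub>R m) \<bullet> n)) *\<^sub>R m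
        = (\<Sum>b\<in>I. x b *\<^sub>R b) + (c * x n + 1 * y) *\<^sub>R m"
      by (simp add: algebra_simps)
  qed
  also have "\<dots> = (\<integral>\<^sup>+x. \<integral>\<^sup>+y. f ((\<Sum>b\<in>I. x b *\<^sub>R b) + y *\<^sub>R m) \<partial>lborel \<partial>Pi\<^sub>M I (\<lambda>_. lborel))"
  proof (rule nn_integral_cong)
    fix x :: "'a \<Rightarrow> real"
    show "(\<integral>\<^sup>+y. f ((\<Sum>b\<in>I. x b *\<^sub>R b) + (c * x n + 1 * y) *\<^sub>R m) \<partial>lborel)
        = (\<integral>\<^sup>+y. f ((\<Sum>b\<in>I. x b *\<^sub>R b) + y *\<^sub>R m) \<partial>lborel)"
      by (subst (2) nn_integral_real_affine[where c=1 and t="c * x n"]) simp_all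
  qed
  also have "\<dots> = (\<integral>\<^sup>+x. f x \<partial>lborel)" by (rule split[symmetric]) measurable
  finally show ?thesis .
qed

lemma lborel_distr_transpose:
  fixes m n :: "'d::finite"
  defines "T \<equiv> \<lambda>x::real ^ 'd. \<chi> i. x $ Transposition.transpose m n i"
  shows "distr lborel borel T = lborel"
proof (rule lborel_eqI[symmetric])
  have T[measurable]: "T \<in> borel \<rightarrow>\<^sub>M borel"
    unfolding T_def by (intro borel_measurable_continuous_onI continuous_intros)
  fix l u :: "real ^ 'd" assume le: "\<And>b. b \<in> Basis \<Longrightarrow> l \<bullet> b \<le> u \<bullet> b"
  have le': "l $ i \<le> u $ i" for i
    using le[of "axis i 1"] by (simp add: Basis_vec_real inner_axis)
  have vim: "T -` box l u = box (T l) (T u)"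
    by (auto simp: T_def mem_box_cart) (metis transpose_involutory)+
  have "emeasure (distr lborel borel T) (box l u) = emeasure lborel (box (T l) (T u))"
    by (simp add: emeasure_distr vim)
  also have "\<dots> = ennreal (\<Prod>b\<in>Basis. (T u - T l) \<bullet> b)"
    using le' by (subst emeasure_lborel_box) (auto simp: Basis_vec_real inner_axis T_def)
  also have "(\<Prod>b\<in>Basis. (T u - T l) \<bullet> b) = (\<Prod>i\<in>UNIV. (u - l) $ Transposition.transpose m n i)"
    by (simp add: prod_Basis_vec inner_axis T_def)
  also have "\<dots> = (\<Prod>i\<in>UNIV. (u - l) $ i)"
    by (rule prod.reindex_bij_betw) (simp add: bij_swap)
  also have "\<dots> = (\<Prod>b\<in>Basis. (u - l) \<bullet> b)"
    by (simp add: prod_Basis_vec inner_axis)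
  finally show "emeasure (distr lborel borel T) (box l u) = ennreal (\<Prod>b\<in>Basis. (u - l) \<bullet> b)" .
qed simp

lemma nn_integral_lborel_diagonal:
  fixes d :: "'d::finite \<Rightarrow> real"
  assumes d: "\<And>i. d i \<noteq> 0" and f[measurable]: "f \<in> borel_measurable borel"
  shows "(\<integral>\<^sup>+x. f x \<partial>lborel) = ennreal \<bar>\<Prod>i\<in>UNIV. d i\<bar> * (\<integral>\<^sup>+x. f (\<chi> i. d i * x $ i) \<partial>lborel)"
proof -
  define T where "T = (\<lambda>x::real ^ 'd. \<chi> i. d i * x $ i)"
  define c where "c = (\<lambda>b::real ^ 'd. b \<bullet> (\<chi> i. d i))"
  have c: "c (axis i 1) = d i" for i by (simp add: c_def inner_axis')
  have T: "T = (\<lambda>x. 0 + (\<Sum>j\<in>Basis. (c j * (x \<bullet> j)) *\<^sub>R j))"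
    by (simp add: fun_eq_iff T_def sum_Basis_vec c inner_axis vec_eq_iff)
      (simp add: axis_def if_distrib cong: if_cong)
  have [measurable]: "T \<in> borel \<rightarrow>\<^sub>M borel"
    unfolding T_def by (intro borel_measurable_continuous_onI continuous_intros)
  have "lborel = density (distr lborel borel T) (\<lambda>_. ennreal (\<Prod>j\<in>Basis. \<bar>c j\<bar>))"
    unfolding T by (rule lborel_affine_euclidean) (use c d in \<open>auto simp: Basis_vec_real\<close>)
  then have "(\<integral>\<^sup>+x. f x \<partial>lborel)
      = (\<integral>\<^sup>+x. f x \<partial>density (distr lborel borel T) (\<lambda>_. ennreal (\<Prod>j\<in>Basis. \<bar>c j\<bar>)))"
    by simp
  also have "\<dots> = ennreal (\<Prod>j\<in>Basis. \<bar>c j\<bar>) * (\<integral>\<^sup>+x. f (T x) \<partial>lborel)"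
    by (simp add: nn_integral_density nn_integral_distr nn_integral_cmult)
  also have "(\<Prod>j\<in>Basis. \<bar>c j\<bar>) = \<bar>\<Prod>i\<in>UNIV. d i\<bar>"
    by (simp add: prod_Basis_vec c abs_prod)
  finally show ?thesis by (simp add: T_def)
qed

lemma borel_measurable_matrix_vector_mult [measurable]:
  "((*v) A :: real ^ 'n \<Rightarrow> real ^ 'm) \<in> borel \<rightarrow>\<^sub>M borel"
  by (intro borel_measurable_continuous_onI linear_continuous_on linear_linear[THEN iffD2] matrix_vector_mul_linear)

text \<open>The determinant and the integral formula are both multiplicative in \<open>A\<close>, so it suffices to treat
  diagonal matrices, transpositions of coordinates and shears.\<close>
lemma nn_integral_lborel_linear:
  fixes A :: "real ^ 'd ^ 'd"
  assumes "det A \<noteq> 0" and "f \<in> borel_measurable borel"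
  shows "(\<integral>\<^sup>+x. f x \<partial>lborel) = ennreal \<bar>det A\<bar> * (\<integral>\<^sup>+x. f (A *v x) \<partial>lborel)"
proof -
  define P where "P = (\<lambda>A :: real ^ 'd ^ 'd. det A \<noteq> 0 \<longrightarrow> (\<forall>f \<in> borel_measurable borel.
      (\<integral>\<^sup>+x. f x \<partial>lborel) = ennreal \<bar>det A\<bar> * (\<integral>\<^sup>+x. f (A *v x) \<partial>lborel)))"
  have PD: "(\<integral>\<^sup>+x. f x \<partial>lborel) = ennreal \<bar>det A\<bar> * (\<integral>\<^sup>+x. f (A *v x) \<partial>lborel)"
    if "P A" "det A \<noteq> 0" "f \<in> borel_measurable borel" for A f
    using that unfolding P_def by blast
  have "P A"
  proof (rule induct_matrix_elementary[of P])
    fix A B :: "real ^ 'd ^ 'd" assume 1: "P A" "P B"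
    show "P (A ** B)"
      unfolding P_def
    proof (intro impI ballI)
      fix f :: "real ^ 'd \<Rightarrow> ennreal" assume [measurable]: "f \<in> borel_measurable borel" and "det (A ** B) \<noteq> 0"
      then have d: "det A \<noteq> 0" "det B \<noteq> 0" by (auto simp: det_mul)
      have "(\<integral>\<^sup>+x. f x \<partial>lborel) = ennreal \<bar>det A\<bar> * (\<integral>\<^sup>+x. f (A *v x) \<partial>lborel)"
        by (rule PD[OF 1(1) d(1)]) measurable
      also have "(\<integral>\<^sup>+x. f (A *v x) \<partial>lborel) = ennreal \<bar>det B\<bar> * (\<integral>\<^sup>+x. f (A *v (B *v x)) \<partial>lborel)"
        by (rule PD[OF 1(2) d(2)]) measurable
      finally show "(\<integral>\<^sup>+x. f x \<partial>lborel) = ennreal \<bar>det (A ** B)\<bar> * (\<integral>\<^sup>+x. f ((A ** B) *v x) \<partial>lborel)"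
        by (simp add: det_mul abs_mult ennreal_mult mult.assoc matrix_vector_mul_assoc)
    qed
  next
    fix A :: "real ^ 'd ^ 'd" and i assume "row i A = 0"
    then show "P A" by (simp add: P_def det_zero_row)
  next
    fix A :: "real ^ 'd ^ 'd" assume 3: "\<And>i j. i \<noteq> j \<Longrightarrow> A $ i $ j = 0"
    have "A *v x = (\<chi> i. A $ i $ i * x $ i)" for x
    proof -
      have "(\<Sum>j\<in>UNIV. A $ i $ j * x $ j) = (\<Sum>j\<in>UNIV. if j = i then A $ i $ i * x $ i else 0)" for i
        using 3 by (intro sum.cong) auto
      then show ?thesis by (simp add: vec_eq_iff matrix_vector_mult_def)
    qed
    moreover have "det A = (\<Prod>i\<in>UNIV. A $ i $ i)" using 3 by (rule det_diagonal)
    ultimately show "P A"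
      using nn_integral_lborel_diagonal[of "\<lambda>i. A $ i $ i"] unfolding P_def by auto
  next
    fix m n :: 'd assume "m \<noteq> n"
    let ?A = "\<chi> i j. (mat 1 :: real ^ 'd ^ 'd) $ i $ Transposition.transpose m n j"
    have "(\<Sum>j\<in>UNIV. (if i = Transposition.transpose m n j then 1 else 0) * x $ j)
        = (\<Sum>j\<in>UNIV. if j = Transposition.transpose m n i then x $ j else 0)" for i and x :: "real ^ 'd"
      by (intro sum.cong) auto
    then have mv: "?A *v x = (\<chi> i. x $ Transposition.transpose m n i)" for x
      by (simp add: vec_eq_iff matrix_vector_mult_def mat_def)
    have det: "\<bar>det ?A\<bar> = 1"
      by (subst det_permute_columns) (auto simp: permutes_swap_id sign_def)
    have [measurable]: "(\<lambda>x::real ^ 'd. \<chi> i. x $ Transposition.transpose m n i) \<in> borel \<rightarrow>\<^sub>M borel"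
      by (intro borel_measurable_continuous_onI continuous_intros)
    have "(\<integral>\<^sup>+x. f x \<partial>lborel) = (\<integral>\<^sup>+x. f (\<chi> i. x $ Transposition.transpose m n i) \<partial>lborel)"
      if [measurable]: "f \<in> borel_measurable borel" for f :: "real ^ 'd \<Rightarrow> ennreal"
      by (subst lborel_distr_transpose[of m n, symmetric]) (simp add: nn_integral_distr)
    then show "P ?A" unfolding P_def mv det ennreal_1 mult_1 by blast
  next
    fix m n :: 'd and c assume 5: "m \<noteq> n"
    let ?A = "(\<chi> i j. if i = m \<and> j = n then c else of_bool (i = j)) :: real ^ 'd ^ 'd"
    have mv: "?A *v x = x + (c * (x \<bullet> axis n 1)) *\<^sub>R axis m 1" for x
    proof (subst vec_eq_iff, intro allI)
      fix i
      have "(\<Sum>j\<in>UNIV. (if i = m \<and> j = n then c else of_bool (i = j)) * x $ j)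
          = (\<Sum>j\<in>UNIV. (if j = i then x $ j else 0) + (if j = n then (if i = m then c * x $ j else 0) else 0))"
        using 5 by (intro sum.cong) auto
      also have "\<dots> = x $ i + (if i = m then c * x $ n else 0)"
        by (simp add: sum.distrib)
      finally show "(?A *v x) $ i = (x + (c * (x \<bullet> axis n 1)) *\<^sub>R axis m 1) $ i"
        by (simp add: matrix_vector_mult_def inner_axis) (simp add: axis_def)
    qed
    have "?A = (\<chi> k. if k = m then row m (mat 1) + c *s row n (mat 1) else row k (mat 1))"
      using 5 by (auto simp: vec_eq_iff row_def mat_def)
    then have det: "det ?A = 1" using det_row_operation[OF 5, of "mat 1 :: real ^ 'd ^ 'd" c] by simp
    have ax: "axis m 1 \<in> (Basis :: (real ^ 'd) set)" "axis n 1 \<in> (Basis :: (real ^ 'd) set)"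
      "axis m 1 \<noteq> (axis n 1 :: real ^ 'd)"
      using 5 by (auto simp: Basis_vec_real axis_eq_axis)
    show "P ?A" unfolding P_def mv det by (auto simp: nn_integral_lborel_shear[OF ax])
  qed
  then show ?thesis using assms by (rule PD)
qed

text \<open>The change of variables formula \<open>\<integral> f = c \<integral> f \<circ> T\<close> as an equation between measures. In
  this form it survives completion. An affine map satisfies it with \<open>c\<close> the absolute value of the
  determinant of its linear part.\<close>
definition scales_lborel :: "('a::euclidean_space \<Rightarrow> 'a) \<Rightarrow> real \<Rightarrow> bool" where
  "scales_lborel T c \<longleftrightarrow> T \<in> borel \<rightarrow>\<^sub>M borel \<and> 0 < c \<and> lborel = density (distr lborel borel T) (\<lambda>_. ennreal c)"

lemma scales_lborelI:
  assumes T[measurable]: "T \<in> borel \<rightarrow>\<^sub>M borel" and c: "0 < c"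
    and nn: "\<And>f. f \<in> borel_measurable borel \<Longrightarrow> (\<integral>\<^sup>+x. f x \<partial>lborel) = ennreal c * (\<integral>\<^sup>+x. f (T x) \<partial>lborel)"
  shows "scales_lborel T c"
  unfolding scales_lborel_def
proof (intro conjI T c measure_eqI)
  fix S :: "'a set" assume "S \<in> sets lborel"
  then have [measurable]: "S \<in> sets borel" by simp
  have "emeasure lborel S = (\<integral>\<^sup>+x. indicator S x \<partial>lborel)" by simp
  also have "\<dots> = ennreal c * (\<integral>\<^sup>+x. indicator S (T x) \<partial>lborel)" by (rule nn) measurable
  also have "(\<integral>\<^sup>+x. indicator S (T x) \<partial>lborel) = emeasure (distr lborel borel T) S"
    by (subst nn_integral_distr[of T lborel borel, symmetric]) auto
  also have "ennreal c * emeasure (distr lborel borel T) S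
      = emeasure (density (distr lborel borel T) (\<lambda>_. ennreal c)) S"
    by (simp add: emeasure_density nn_integral_cmult)
  finally show "emeasure lborel S = emeasure (density (distr lborel borel T) (\<lambda>_. ennreal c)) S" .
qed simp

lemma scales_lborel_affine:
  fixes U :: "real ^ 'd ^ 'd"
  assumes "det U \<noteq> 0"
  shows "scales_lborel (\<lambda>x. U *v x - k) \<bar>det U\<bar>"
proof (rule scales_lborelI)
  fix f :: "real ^ 'd \<Rightarrow> ennreal" assume [measurable]: "f \<in> borel_measurable borel"
  have "(\<integral>\<^sup>+x. f x \<partial>lborel) = (\<integral>\<^sup>+x. f (- k + x) \<partial>lborel)"
    by (subst lborel_distr_plus[of "-k", symmetric]) (simp add: nn_integral_distr)
  also have "\<dots> = ennreal \<bar>det U\<bar> * (\<integral>\<^sup>+x. f (- k + U *v x) \<partial>lborel)"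
    by (rule nn_integral_lborel_linear[OF assms]) measurable
  finally show "(\<integral>\<^sup>+x. f x \<partial>lborel) = ennreal \<bar>det U\<bar> * (\<integral>\<^sup>+x. f (U *v x - k) \<partial>lborel)"
    by simp
qed (use assms in auto)

text \<open>The equation for Borel sets shows that preimages of null sets under \<open>T\<close> are null sets, and so it extends
  to the completions of both measures.\<close>
lemma
  assumes "scales_lborel T c"
  shows scales_lborel_measurable: "T \<in> lebesgue \<rightarrow>\<^sub>M lebesgue"
    and scales_lborel_lebesgue: "lebesgue = density (distr lebesgue lebesgue T) (\<lambda>_. ennreal c)"
proof -
  have [measurable]: "T \<in> borel \<rightarrow>\<^sub>M borel" and c: "0 < c"
    and eq: "lborel = density (distr lborel borel T) (\<lambda>_. ennreal c)"
    using assms by (auto simp: scales_lborel_def)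
  have "emeasure lborel S = 0 \<longleftrightarrow> emeasure (distr lebesgue lborel T) S = 0" if S: "S \<in> sets borel" for S
  proof -
    have "emeasure lborel S = emeasure (density (distr lborel borel T) (\<lambda>_. ennreal c)) S"
      using eq by simp
    also have "\<dots> = ennreal c * emeasure (distr lebesgue lborel T) S"
      using S by (simp add: distr_completion emeasure_density nn_integral_cmult cong: distr_cong)
    finally show ?thesis using c by simp
  qed
  then have null: "null_sets lborel = null_sets (distr lebesgue lborel T)"
    by (auto simp: null_sets_def)
  show "T \<in> lebesgue \<rightarrow>\<^sub>M lebesgue"
    by (simp add: completion.measurable_completion2 null measurable_completion)
  have "lebesgue = completion (density (distr lborel borel T) (\<lambda>_. ennreal c))"
    using eq by simp
  also have "\<dots> = density (completion (distr lebesgue lborel T)) (\<lambda>_. ennreal c)"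
    using c by (auto simp: distr_completion completion_density_eq cong: distr_cong)
  also have "\<dots> = density (distr lebesgue lebesgue T) (\<lambda>_. ennreal c)"
    by (subst completion.completion_distr_eq) (auto simp: null measurable_completion)
  finally show "lebesgue = density (distr lebesgue lebesgue T) (\<lambda>_. ennreal c)" .
qed

lemma scales_lborel_comp_measurable:
  assumes T: "scales_lborel T c" and f: "f \<in> lebesgue \<rightarrow>\<^sub>M N"
  shows "(\<lambda>x. f (T x)) \<in> lebesgue \<rightarrow>\<^sub>M N"
  using measurable_compose[OF scales_lborel_measurable[OF T] f] .

lemma scales_lborel_AE:
  assumes T: "scales_lborel T c" and P: "AE x in lebesgue. P x"
  shows "AE x in lebesgue. P (T x)"
proof -
  have c: "0 < c" using T by (simp add: scales_lborel_def)
  have "AE x in density (distr lebesgue lebesgue T) (\<lambda>_. ennreal c). P x"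
    using P by (subst (asm) scales_lborel_lebesgue[OF T])
  then have "AE x in distr lebesgue lebesgue T. P x"
    using c by (simp add: AE_density)
  then show ?thesis using AE_distrD scales_lborel_measurable[OF T] by blast
qed

lemma scales_lborel_integral:
  fixes f :: "_ \<Rightarrow> 'b::{banach, second_countable_topology}"
  assumes T: "scales_lborel T c" and f[measurable]: "f \<in> borel_measurable lebesgue"
  shows "integrable lebesgue (\<lambda>x. f (T x)) \<longleftrightarrow> integrable lebesgue f"
    and "(LINT x|lebesgue. f x) = c *\<^sub>R (LINT x|lebesgue. f (T x))"
proof -
  note [measurable] = scales_lborel_measurable[OF T]
  have c: "0 < c" using T by (simp add: scales_lborel_def)
  have "integrable lebesgue f \<longleftrightarrow> integrable (density (distr lebesgue lebesgue T) (\<lambda>_. ennreal c)) f"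
    using scales_lborel_lebesgue[OF T] by simp
  also have "\<dots> \<longleftrightarrow> integrable (distr lebesgue lebesgue T) (\<lambda>x. c *\<^sub>R f x)"
    using c by (subst integrable_density) auto
  also have "\<dots> \<longleftrightarrow> integrable lebesgue (\<lambda>x. c *\<^sub>R f (T x))"
    by (subst integrable_distr_eq) auto
  also have "\<dots> \<longleftrightarrow> integrable lebesgue (\<lambda>x. f (T x))"
  proof
    assume "integrable lebesgue (\<lambda>x. c *\<^sub>R f (T x))"
    then have "integrable lebesgue (\<lambda>x. (1 / c) *\<^sub>R c *\<^sub>R f (T x))" by (rule integrable_scaleR_right)
    then show "integrable lebesgue (\<lambda>x. f (T x))" using c by simp
  qed simp
  finally show "integrable lebesgue (\<lambda>x. f (T x)) \<longleftrightarrow> integrable lebesgue f" ..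
  have "(LINT x|lebesgue. f x) = (LINT x|density (distr lebesgue lebesgue T) (\<lambda>_. ennreal c). f x)"
    using scales_lborel_lebesgue[OF T] by simp
  also have "\<dots> = (LINT x|distr lebesgue lebesgue T. c *\<^sub>R f x)"
    using c by (subst integral_density) auto
  also have "\<dots> = c *\<^sub>R (LINT x|lebesgue. f (T x))"
    by (subst integral_distr) auto
  finally show "(LINT x|lebesgue. f x) = c *\<^sub>R (LINT x|lebesgue. f (T x))" .
qed

lemma sq_int_scales_lborel:
  assumes T: "scales_lborel T c" and f: "f \<in> sq_int lebesgue"
  shows "(\<lambda>x. f (T x)) \<in> sq_int lebesgue"
proof (rule sq_intI)
  show "(\<lambda>x. f (T x)) \<in> borel_measurable lebesgue"
    by (rule scales_lborel_comp_measurable[OF T sq_int_meas[OF f]])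
  show "integrable lebesgue (\<lambda>x. (cmod (f (T x)))\<^sup>2)"
    using scales_lborel_integral(1)[OF T, of "\<lambda>x. (cmod (f x))\<^sup>2"] sq_intD[OF f] by simp
qed

lemma ip2_scales_lborel:
  assumes T: "scales_lborel T c" and f: "f \<in> sq_int lebesgue" and g: "g \<in> sq_int lebesgue"
  shows "ip2 lebesgue (\<lambda>x. f (T x)) (\<lambda>x. g (T x)) = ip2 lebesgue f g / complex_of_real c"
proof -
  note [measurable] = sq_int_meas[OF f] sq_int_meas[OF g]
  have "ip2 lebesgue f g = c *\<^sub>R ip2 lebesgue (\<lambda>x. f (T x)) (\<lambda>x. g (T x))"
    unfolding ip2_def by (rule scales_lborel_integral(2)[OF T]) measurable
  moreover have "0 < c" using T by (simp add: scales_lborel_def)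
  ultimately show ?thesis by (simp add: scaleR_conv_of_real)
qed

lemma norm2_scales_lborel:
  assumes T: "scales_lborel T c" and f: "f \<in> borel_measurable lebesgue"
  shows "norm2 lebesgue (\<lambda>x. f (T x)) = norm2 lebesgue f / sqrt c"
proof -
  have c: "0 < c" using T by (simp add: scales_lborel_def)
  have "(LINT x|lebesgue. (cmod (f x))\<^sup>2) = c *\<^sub>R (LINT x|lebesgue. (cmod (f (T x)))\<^sup>2)"
    by (rule scales_lborel_integral(2)[OF T]) (use f in measurable)
  then show ?thesis using c by (simp add: norm2_def real_sqrt_mult)
qed

section \<open>Gaussian means and Plancherel's theorem\<close>

definition wave :: "real ^ 'd \<Rightarrow> real ^ 'd \<Rightarrow> complex" where
  "wave k \<xi> = exp (- (\<i> * complex_of_real (k \<bullet> \<xi>)))"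

lemma cmod_wave [simp]: "cmod (wave k \<xi>) = 1"
  by (simp add: wave_def)

lemma wave_0 [simp]: "wave 0 \<xi> = 1" "wave k 0 = 1"
  by (simp_all add: wave_def)

lemma wave_add: "wave (k + l) \<xi> = wave k \<xi> * wave l \<xi>"
  by (simp add: wave_def inner_add_left algebra_simps flip: exp_add)

lemma wave_commute: "wave k \<xi> = wave \<xi> k"
  by (simp add: wave_def inner_commute)

lemma cnj_wave: "cnj (wave k \<xi>) = wave (- k) \<xi>"
  by (simp add: wave_def exp_cnj)

lemma borel_measurable_wave [measurable (raw)]:
  assumes [measurable]: "f \<in> borel_measurable M" "g \<in> borel_measurable M"
  shows "(\<lambda>x. wave (f x) (g x)) \<in> borel_measurable M"
  unfolding wave_def by measurable

lemma wave_prod: "wave k \<xi> = (\<Prod>i\<in>UNIV. exp (- (\<i> * complex_of_real (k $ i * \<xi> $ i))))"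
  by (simp add: wave_def inner_vec_def sum_distrib_left sum_negf flip: exp_sum)

lemma lborel_integral_prod:
  fixes f :: "'d::finite \<Rightarrow> real \<Rightarrow> complex"
  assumes f: "\<And>i. integrable lborel (f i)"
  shows "integrable lborel (\<lambda>x::real ^ 'd. \<Prod>i\<in>UNIV. f i (x $ i))"
    and "(LINT x|lborel. (\<Prod>i\<in>UNIV. f i ((x::real ^ 'd) $ i))) = (\<Prod>i\<in>UNIV. LINT t|lborel. f i t)"
proof -
  interpret product_sigma_finite "\<lambda>_::real ^ 'd. lborel::real measure" by standard
  define g where "g = (\<lambda>b::real ^ 'd. f (inv (\<lambda>i. axis i 1) b))"
  have g: "g (axis i 1) = f i" for i
    by (simp add: g_def inv_f_f[OF inj_axis_1])
  have gi: "integrable lborel (g b)" for b by (simp add: g_def f)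
  define S where "S = (\<lambda>y::real ^ 'd \<Rightarrow> real. \<Sum>b\<in>Basis. y b *\<^sub>R b)"
  have S[measurable]: "S \<in> Pi\<^sub>M Basis (\<lambda>_. lborel) \<rightarrow>\<^sub>M borel"
    unfolding S_def by measurable
  have lb: "lborel = distr (Pi\<^sub>M Basis (\<lambda>_. lborel)) borel S"
    unfolding S_def by (rule lborel_eq)
  have [measurable]: "f i \<in> borel_measurable borel" for i
    using borel_measurable_integrable[OF f] by simp
  have m: "(\<lambda>x::real ^ 'd. \<Prod>i\<in>UNIV. f i (x $ i)) \<in> borel_measurable borel"
    by measurable
  have eq: "(\<Prod>i\<in>UNIV. f i (S y $ i)) = (\<Prod>b\<in>Basis. g b (y b))" for y
  proof -
    have "S y $ i = y (axis i 1)" for i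
      unfolding S_def by (simp add: sum_Basis_vec) (simp add: axis_def if_distrib cong: if_cong)
    then show ?thesis by (simp add: prod_Basis_vec g)
  qed
  show "integrable lborel (\<lambda>x::real ^ 'd. \<Prod>i\<in>UNIV. f i (x $ i))"
    by (subst lb, subst integrable_distr_eq[OF S m], unfold eq) (intro product_integrable_prod gi finite_Basis)
  have "(LINT x|lborel. (\<Prod>i\<in>UNIV. f i ((x::real ^ 'd) $ i)))
      = (LINT y|Pi\<^sub>M Basis (\<lambda>_. lborel). (\<Prod>b\<in>Basis. g b (y b)))"
    by (subst lb, subst integral_distr[OF S m], unfold eq) simp
  also have "\<dots> = (\<Prod>b\<in>Basis. LINT t|lborel. g b t)"
    by (intro product_integral_prod gi finite_Basis)
  finally show "(LINT x|lborel. (\<Prod>i\<in>UNIV. f i ((x::real ^ 'd) $ i))) = (\<Prod>i\<in>UNIV. LINT t|lborel. f i t)"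
    by (simp add: prod_Basis_vec g)
qed

text \<open>After rescaling, the integral is the characteristic function of the standard normal distribution.\<close>
lemma gaussian_fourier_1d:
  fixes \<sigma> s :: real
  assumes \<sigma>: "0 < \<sigma>"
  defines "f \<equiv> \<lambda>t. complex_of_real (exp (- (\<sigma>\<^sup>2 * t\<^sup>2 / 2))) * exp (- (\<i> * complex_of_real (s * t)))"
  shows "integrable lborel f"
    and "(LINT t|lborel. f t) = complex_of_real (sqrt (2 * pi) / \<sigma> * exp (- (s\<^sup>2 / \<sigma>\<^sup>2 / 2)))"
proof -
  \<comment> \<open>With this \<open>r\<close> and the substitution \<open>x = \<sigma> * t\<close>, \<open>f\<close> is a multiple of the integrand \<open>h\<close>.\<close>
  define r where "r = - s / \<sigma>"
  define h where "h = (\<lambda>x. std_normal_density x *\<^sub>R iexp (r * x))"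
  have int: "integrable lborel h"
  proof (rule Bochner_Integration.integrable_bound)
    show "integrable lborel std_normal_density" by simp
    show "h \<in> borel_measurable lborel" unfolding h_def by measurable
  qed (simp add: h_def)
  have "(LINT x|lborel. h x) = char std_normal_distribution r"
    unfolding char_def h_def by (subst integral_density) auto
  then have val: "(LINT x|lborel. h x) = complex_of_real (exp (- (r\<^sup>2 / 2)))"
    by (simp add: char_std_normal_distribution)
  have f: "f = (\<lambda>t. complex_of_real (sqrt (2 * pi)) * h (0 + \<sigma> * t))"
    using \<sigma> by (auto simp: fun_eq_iff f_def h_def r_def std_normal_density_def scaleR_conv_of_real
        power_mult_distrib exp_of_real[symmetric] field_simps)
  show "integrable lborel f"
    unfolding f by (intro integrable_mult_right lborel_integrable_real_affine int) (use \<sigma> in simp)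
  have "(LINT x|lborel. h x) = \<sigma> *\<^sub>R (LINT t|lborel. h (0 + \<sigma> * t))"
    using lborel_integral_real_affine[of \<sigma> h 0] \<sigma> by simp
  then have "(LINT t|lborel. h (0 + \<sigma> * t)) = complex_of_real (exp (- (r\<^sup>2 / 2)) / \<sigma>)"
    using \<sigma> by (simp add: val scaleR_conv_of_real field_simps)
  then show "(LINT t|lborel. f t) = complex_of_real (sqrt (2 * pi) / \<sigma> * exp (- (s\<^sup>2 / \<sigma>\<^sup>2 / 2)))"
    by (simp add: f r_def power_divide)
qed

definition gauss :: "real \<Rightarrow> real ^ 'd \<Rightarrow> real" where
  "gauss \<sigma> \<xi> = exp (- (\<sigma>\<^sup>2 * (norm \<xi>)\<^sup>2 / 2))"

lemma gauss_pos [simp]: "0 < gauss \<sigma> \<xi>" "0 \<le> gauss \<sigma> \<xi>"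
  by (simp_all add: gauss_def)

lemma gauss_le_1: "gauss \<sigma> \<xi> \<le> 1"
  by (simp add: gauss_def)

lemma borel_measurable_gauss [measurable]: "gauss \<sigma> \<in> borel_measurable borel"
  unfolding gauss_def by measurable

lemma gauss_prod: "gauss \<sigma> \<xi> = (\<Prod>i\<in>UNIV. exp (- (\<sigma>\<^sup>2 * (\<xi> $ i)\<^sup>2 / 2)))"
proof -
  have "(norm \<xi>)\<^sup>2 = (\<Sum>i\<in>UNIV. (\<xi> $ i)\<^sup>2)"
    unfolding power2_norm_eq_inner inner_vec_def by (simp add: power2_eq_square)
  then have "- (\<sigma>\<^sup>2 * (norm \<xi>)\<^sup>2 / 2) = (\<Sum>i\<in>UNIV. - (\<sigma>\<^sup>2 * (\<xi> $ i)\<^sup>2 / 2))"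
    by (simp add: sum_distrib_left sum_divide_distrib sum_negf)
  then show ?thesis by (simp only: gauss_def exp_sum[OF finite])
qed

text \<open>The Gaussian and the exponential both factor over the coordinates, which leaves \<open>CARD('d)\<close> integrals
  in one variable.\<close>
lemma gaussian_fourier:
  fixes t :: "real ^ 'd"
  assumes \<sigma>: "0 < \<sigma>"
  shows "integrable lborel (\<lambda>\<xi>. complex_of_real (gauss \<sigma> \<xi>) * wave t \<xi>)"
    and "(LINT \<xi>|lborel. complex_of_real (gauss \<sigma> \<xi>) * wave t \<xi>)
      = complex_of_real ((sqrt (2 * pi) / \<sigma>) ^ CARD('d) * gauss (1 / \<sigma>) t)"
proof -
  define f where "f = (\<lambda>i x. complex_of_real (exp (- (\<sigma>\<^sup>2 * x\<^sup>2 / 2))) * exp (- (\<i> * complex_of_real (t $ i * x))))"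
  have eq: "(\<lambda>\<xi>. complex_of_real (gauss \<sigma> \<xi>) * wave t \<xi>) = (\<lambda>\<xi>. \<Prod>i\<in>UNIV. f i (\<xi> $ i))"
    by (simp add: fun_eq_iff f_def gauss_prod wave_prod prod.distrib)
  have int: "integrable lborel (f i)" for i
    unfolding f_def by (rule gaussian_fourier_1d(1)[OF \<sigma>])
  show "integrable lborel (\<lambda>\<xi>. complex_of_real (gauss \<sigma> \<xi>) * wave t \<xi>)"
    unfolding eq by (rule lborel_integral_prod(1)[OF int])
  have "(LINT x|lborel. f i x) = complex_of_real (sqrt (2 * pi) / \<sigma> * exp (- ((1 / \<sigma>)\<^sup>2 * (t $ i)\<^sup>2 / 2)))" for i
    unfolding f_def using gaussian_fourier_1d(2)[OF \<sigma>, of "t $ i"] by (simp add: power_divide)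
  note val = this
  have "(LINT \<xi>|lborel. complex_of_real (gauss \<sigma> \<xi>) * wave t \<xi>) = (\<Prod>i\<in>UNIV. LINT x|lborel. f i x)"
    unfolding eq by (rule lborel_integral_prod(2)[OF int])
  also have "\<dots> = complex_of_real ((sqrt (2 * pi) / \<sigma>) ^ CARD('d) * gauss (1 / \<sigma>) t)"
    by (simp only: val gauss_prod of_real_prod[symmetric] prod.distrib prod_constant)
  finally show "(LINT \<xi>|lborel. complex_of_real (gauss \<sigma> \<xi>) * wave t \<xi>)
      = complex_of_real ((sqrt (2 * pi) / \<sigma>) ^ CARD('d) * gauss (1 / \<sigma>) t)" .
qed

lemma integrable_gauss: "0 < \<sigma> \<Longrightarrow> integrable lborel (gauss \<sigma> :: real ^ 'd \<Rightarrow> real)"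
  using integrable_Re[OF gaussian_fourier(1)[of \<sigma> 0]] by simp

lemma integral_gauss:
  assumes "0 < \<sigma>"
  shows "(LINT \<xi>|lborel. gauss \<sigma> (\<xi> :: real ^ 'd)) = (sqrt (2 * pi) / \<sigma>) ^ CARD('d)"
proof -
  have "complex_of_real (LINT \<xi>|lborel. gauss \<sigma> (\<xi> :: real ^ 'd)) = complex_of_real ((sqrt (2 * pi) / \<sigma>) ^ CARD('d))"
    using gaussian_fourier(2)[OF assms, of "0 :: real ^ 'd"] by (simp add: gauss_def)
  then show ?thesis by (simp only: of_real_eq_iff)
qed

text \<open>The Fourier transform for Borel functions, whose products in separate variables are product measurable, as
  Fubini's theorem requires; \<open>fourier_L1_representative\<close> links it to \<open>fourier_L1\<close>.\<close>
definition fourier_lborel :: "(real ^ 'd \<Rightarrow> complex) \<Rightarrow> real ^ 'd \<Rightarrow> complex" where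
  "fourier_lborel u \<xi> = (LINT x|lborel. u x * wave x \<xi>)"

lemma borel_measurable_fourier_lborel [measurable]:
  assumes [measurable]: "u \<in> borel_measurable borel"
  shows "fourier_lborel u \<in> borel_measurable borel"
  unfolding fourier_lborel_def by measurable

lemma cmod_fourier_lborel_le: "cmod (fourier_lborel u \<xi>) \<le> (LINT x|lborel. cmod (u x))"
proof -
  have "cmod (fourier_lborel u \<xi>) \<le> (LINT x|lborel. cmod (u x * wave x \<xi>))"
    unfolding fourier_lborel_def by (rule integral_norm_bound)
  then show ?thesis by (simp add: norm_mult)
qed

lemma integrable_bounded_mult:
  fixes f g :: "'a \<Rightarrow> complex"
  assumes g: "integrable M g" and f[measurable]: "f \<in> borel_measurable M" and B: "\<And>x. cmod (f x) \<le> B"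
  shows "integrable M (\<lambda>x. f x * g x)"
proof (rule Bochner_Integration.integrable_bound)
  show "integrable M (\<lambda>x. B * norm (g x))" using g by simp
  show "AE x in M. norm (f x * g x) \<le> norm (B * norm (g x))"
    using B norm_ge_zero order_trans by (intro AE_I2) (simp add: norm_mult mult_right_mono abs_mult order_trans[OF B abs_ge_self])
qed (use borel_measurable_integrable[OF g] in measurable)

text \<open>The kernel is symmetric in the two variables, so both sides are iterated integrals of one
  integrable function of two variables.\<close>
lemma fourier_multiplication_formula:
  assumes u: "integrable lborel u" and h: "integrable lborel h"
  shows "(LINT \<xi>|lborel. fourier_lborel u \<xi> * h \<xi>) = (LINT x|lborel. u x * fourier_lborel h x)"
proof -
  have um[measurable]: "u \<in> borel_measurable borel" using borel_measurable_integrable[OF u] by simp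
  have hm[measurable]: "h \<in> borel_measurable borel" using borel_measurable_integrable[OF h] by simp
  have "integrable (lborel \<Otimes>\<^sub>M lborel) (\<lambda>p. u (fst p) * wave (fst p) (snd p) * h (snd p))"
  proof (rule lborel_pair.Fubini_integrable)
    show "(\<lambda>p. u (fst p) * wave (fst p) (snd p) * h (snd p)) \<in> borel_measurable (lborel \<Otimes>\<^sub>M lborel)"
      by measurable
    have "(\<lambda>x. LINT y|lborel. norm (u (fst (x, y)) * wave (fst (x, y)) (snd (x, y)) * h (snd (x, y))))
        = (\<lambda>x. norm (u x) * (LINT y|lborel. norm (h y)))"
      by (simp add: norm_mult)
    then show "integrable lborel (\<lambda>x. LINT y|lborel. norm (u (fst (x, y)) * wave (fst (x, y)) (snd (x, y)) * h (snd (x, y))))"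
      using u by simp
    have "integrable lborel (\<lambda>y. u x * (wave x y * h y))" for x
      by (intro integrable_mult_right integrable_bounded_mult[OF h, where B=1]) auto
    then show "AE x in lborel. integrable lborel (\<lambda>y. u (fst (x, y)) * wave (fst (x, y)) (snd (x, y)) * h (snd (x, y)))"
      by (simp add: mult.assoc)
  qed
  then have "(LINT y|lborel. LINT x|lborel. u x * wave x y * h y) = (LINT x|lborel. LINT y|lborel. u x * wave x y * h y)"
    by (intro lborel_pair.Fubini_integral) (simp add: case_prod_unfold)
  also have "(\<lambda>y. LINT x|lborel. u x * wave x y * h y) = (\<lambda>y. fourier_lborel u y * h y)"
    by (simp add: fourier_lborel_def)
  also have "(\<lambda>x. LINT y|lborel. u x * wave x y * h y) = (\<lambda>x. u x * fourier_lborel h x)"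
  proof
    fix x
    have "(LINT y|lborel. u x * wave x y * h y) = (LINT y|lborel. u x * (h y * wave y x))"
      by (simp add: wave_commute[of x] mult_ac)
    also have "\<dots> = u x * fourier_lborel h x" unfolding fourier_lborel_def by (rule integral_mult_right_zero)
    finally show "(LINT y|lborel. u x * wave x y * h y) = u x * fourier_lborel h x" .
  qed
  finally show ?thesis .
qed

lemma lborel_integral_affine:
  fixes f :: "'a::euclidean_space \<Rightarrow> 'b::{banach, second_countable_topology}"
  assumes c: "c \<noteq> 0" and f[measurable]: "f \<in> borel_measurable borel"
  shows "(LINT x|lborel. f x) = \<bar>c\<bar> ^ DIM('a) *\<^sub>R (LINT x|lborel. f (t + c *\<^sub>R x))"
proof -
  have "(LINT x|lborel. f x) = (LINT x|density (distr lborel borel (\<lambda>x. t + c *\<^sub>R x)) (\<lambda>_. ennreal (\<bar>c\<bar> ^ DIM('a))). f x)"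
    using lborel_affine[OF c, of t] by (simp add: ennreal_power)
  also have "\<dots> = (LINT x|distr lborel borel (\<lambda>x. t + c *\<^sub>R x). (\<bar>c\<bar> ^ DIM('a)) *\<^sub>R f x)"
    by (subst integral_density) auto
  also have "\<dots> = \<bar>c\<bar> ^ DIM('a) *\<^sub>R (LINT x|lborel. f (t + c *\<^sub>R x))"
    by (subst integral_distr) auto
  finally show ?thesis .
qed

lemma sq_int_translate_lborel:
  fixes u :: "'a::euclidean_space \<Rightarrow> complex"
  assumes u: "u \<in> sq_int lborel"
  shows "(\<lambda>x. u (x - z)) \<in> sq_int lborel" and "norm2 lborel (\<lambda>x. u (x - z)) = norm2 lborel u"
proof -
  have um[measurable]: "u \<in> borel_measurable borel" using sq_int_meas[OF u] by simp
  have "integrable lborel (\<lambda>x. (cmod (u x))\<^sup>2) \<longleftrightarrow> integrable (distr lborel borel ((+) (- z))) (\<lambda>x. (cmod (u x))\<^sup>2)"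
    by (simp add: lborel_distr_plus)
  also have "\<dots> \<longleftrightarrow> integrable lborel (\<lambda>x. (cmod (u (- z + x)))\<^sup>2)"
    by (subst integrable_distr_eq) auto
  finally show "(\<lambda>x. u (x - z)) \<in> sq_int lborel"
    using sq_int_integrable[OF u] by (intro sq_intI) auto
  show "norm2 lborel (\<lambda>x. u (x - z)) = norm2 lborel u"
    unfolding norm2_def
    by (subst (2) lborel_integral_affine[of 1 _ "- z"]) auto
qed

definition autocorr :: "(real ^ 'd \<Rightarrow> complex) \<Rightarrow> real ^ 'd \<Rightarrow> complex" where
  "autocorr u z = ip2 lborel u (\<lambda>x. u (x - z))"

lemma cmod_autocorr_le:
  assumes "u \<in> sq_int lborel"
  shows "cmod (autocorr u z) \<le> (norm2 lborel u)\<^sup>2"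
  unfolding autocorr_def power2_eq_square
  using Cauchy_Schwarz_ip2[OF assms sq_int_translate_lborel(1)[OF assms]]
  by (simp add: sq_int_translate_lborel(2)[OF assms])

text \<open>Multiplying the conjugate transform by a Gaussian and transforming once more gives a Gaussian average of the
  conjugate of \<open>u\<close> around \<open>x\<close>. This replaces Fourier inversion: the multiplication formula moves the transform
  onto the Gaussian, whose transform is known.\<close>
lemma fourier_lborel_gaussian_mean:
  fixes u :: "real ^ 'd \<Rightarrow> complex"
  assumes u: "integrable lborel u" and \<sigma>: "0 < \<sigma>"
  shows "fourier_lborel (\<lambda>\<xi>. cnj (fourier_lborel u \<xi>) * complex_of_real (gauss \<sigma> \<xi>)) x
    = complex_of_real (sqrt (2 * pi) ^ CARD('d)) * (LINT w|lborel. cnj (u (x - \<sigma> *\<^sub>R w)) * complex_of_real (gauss 1 w))"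
proof -
  have um[measurable]: "u \<in> borel_measurable borel" using borel_measurable_integrable[OF u] by simp
  define K where "K = (sqrt (2 * pi) / \<sigma>) ^ CARD('d)"
  let ?G = "\<lambda>\<xi>. complex_of_real (gauss \<sigma> \<xi>) * wave (- x) \<xi>"
  have FG: "fourier_lborel ?G y = complex_of_real (K * gauss (1 / \<sigma>) (y - x))" for y
  proof -
    have "fourier_lborel ?G y = (LINT \<xi>|lborel. complex_of_real (gauss \<sigma> \<xi>) * wave (y - x) \<xi>)"
      unfolding fourier_lborel_def
      by (intro Bochner_Integration.integral_cong refl)
        (simp add: wave_commute[of _ y] mult.assoc flip: wave_add)
    then show ?thesis using gaussian_fourier(2)[OF \<sigma>] by (simp add: K_def)
  qed
  have "fourier_lborel (\<lambda>\<xi>. cnj (fourier_lborel u \<xi>) * complex_of_real (gauss \<sigma> \<xi>)) x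
      = (LINT \<xi>|lborel. cnj (fourier_lborel u \<xi> * ?G \<xi>))"
    unfolding fourier_lborel_def[of _ x]
    by (intro Bochner_Integration.integral_cong refl) (simp add: cnj_wave wave_commute[of x] mult.assoc)
  also have "\<dots> = cnj (LINT \<xi>|lborel. fourier_lborel u \<xi> * ?G \<xi>)" by (rule Bochner_Integration.integral_cnj)
  also have "(LINT \<xi>|lborel. fourier_lborel u \<xi> * ?G \<xi>) = (LINT y|lborel. u y * fourier_lborel ?G y)"
    by (rule fourier_multiplication_formula[OF u gaussian_fourier(1)[OF \<sigma>]])
  also have "cnj \<dots> = (LINT y|lborel. cnj (u y) * complex_of_real (K * gauss (1 / \<sigma>) (y - x)))"
    unfolding FG by (subst Bochner_Integration.integral_cnj[symmetric]) simp
  \<comment> \<open>The substitution \<open>y = x - \<sigma> *\<^sub>R w\<close> makes the Gaussian independent of \<open>x\<close> and \<open>\<sigma>\<close>.\<close>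
  also have "\<dots> = \<bar>- \<sigma>\<bar> ^ DIM(real ^ 'd) *\<^sub>R (LINT w|lborel. cnj (u (x + (- \<sigma>) *\<^sub>R w)) * complex_of_real (K * gauss (1 / \<sigma>) (x + (- \<sigma>) *\<^sub>R w - x)))"
    using \<sigma> by (intro lborel_integral_affine) auto
  also have "\<dots> = complex_of_real (\<sigma> ^ CARD('d)) * (LINT w|lborel. complex_of_real K * (cnj (u (x - \<sigma> *\<^sub>R w)) * complex_of_real (gauss 1 w)))"
  proof -
    have "gauss (1 / \<sigma>) (x + (- \<sigma>) *\<^sub>R w - x) = gauss 1 w" for w :: "real ^ 'd"
      using \<sigma> by (simp add: gauss_def power_mult_distrib power_divide)
    then show ?thesis using \<sigma> by (simp add: scaleR_conv_of_real mult_ac)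
  qed
  also have "\<dots> = complex_of_real (\<sigma> ^ CARD('d) * K) * (LINT w|lborel. cnj (u (x - \<sigma> *\<^sub>R w)) * complex_of_real (gauss 1 w))"
    by simp
  also have "\<sigma> ^ CARD('d) * K = sqrt (2 * pi) ^ CARD('d)"
    using \<sigma> by (simp add: K_def power_divide)
  finally show ?thesis .
qed

text \<open>The second use of the multiplication formula, now with the Gaussian-weighted conjugate transform as the
  second function. For \<open>\<sigma> \<rightarrow> 0\<close> the left side tends to the squared norm of the transform, and the right
  side concentrates at the autocorrelation at \<open>0\<close>, the squared norm of \<open>u\<close>.\<close>
lemma gaussian_plancherel:
  fixes u :: "real ^ 'd \<Rightarrow> complex"
  assumes u: "integrable lborel u" and u2: "u \<in> sq_int lborel" and \<sigma>: "0 < \<sigma>"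
  shows "complex_of_real (LINT \<xi>|lborel. (cmod (fourier_lborel u \<xi>))\<^sup>2 * gauss \<sigma> \<xi>)
    = complex_of_real (sqrt (2 * pi) ^ CARD('d)) * (LINT w|lborel. complex_of_real (gauss 1 w) * autocorr u (\<sigma> *\<^sub>R w))"
proof -
  have um[measurable]: "u \<in> borel_measurable borel" using borel_measurable_integrable[OF u] by simp
  define K where "K = complex_of_real (sqrt (2 * pi) ^ CARD('d))"
  let ?h = "\<lambda>\<xi>. cnj (fourier_lborel u \<xi>) * complex_of_real (gauss \<sigma> \<xi>)"
  have h: "integrable lborel ?h"
    by (rule integrable_bounded_mult[where B="LINT x|lborel. cmod (u x)"])
      (use integrable_gauss[OF \<sigma>] cmod_fourier_lborel_le in auto)
  have "complex_of_real (LINT \<xi>|lborel. (cmod (fourier_lborel u \<xi>))\<^sup>2 * gauss \<sigma> \<xi>) = (LINT \<xi>|lborel. fourier_lborel u \<xi> * ?h \<xi>)"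
    by (simp add: integral_complex_of_real[symmetric] complex_norm_square mult.assoc
        del: integral_complex_of_real of_real_power)
  also have "\<dots> = (LINT x|lborel. u x * fourier_lborel ?h x)"
    by (rule fourier_multiplication_formula[OF u h])
  also have "\<dots> = (LINT x|lborel. K * (LINT w|lborel. u x * cnj (u (x - \<sigma> *\<^sub>R w)) * complex_of_real (gauss 1 w)))"
    unfolding fourier_lborel_gaussian_mean[OF u \<sigma>] K_def[symmetric]
    by (intro Bochner_Integration.integral_cong refl)
      (simp only: mult.assoc integral_mult_right_zero mult.left_commute[of _ K])
  also have "\<dots> = K * (LINT x|lborel. LINT w|lborel. u x * cnj (u (x - \<sigma> *\<^sub>R w)) * complex_of_real (gauss 1 w))"
    by simp
  also have "(LINT x|lborel. LINT w|lborel. u x * cnj (u (x - \<sigma> *\<^sub>R w)) * complex_of_real (gauss 1 w))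
      = (LINT w|lborel. LINT x|lborel. u x * cnj (u (x - \<sigma> *\<^sub>R w)) * complex_of_real (gauss 1 w))"
  proof -
    let ?f = "\<lambda>p. u (snd p) * cnj (u (snd p - \<sigma> *\<^sub>R fst p)) * complex_of_real (gauss 1 (fst p))"
    have int: "integrable lborel (\<lambda>x. u x * cnj (u (x - z)))" for z
      by (rule integrable_ip2[OF u2 sq_int_translate_lborel(1)[OF u2]])
    have abs: "(\<lambda>x. complex_of_real (cmod (u x))) \<in> sq_int lborel"
      using sq_int_integrable[OF u2] by (intro sq_intI) auto
    have bound: "(LINT x|lborel. cmod (u x * cnj (u (x - z)))) \<le> (norm2 lborel u)\<^sup>2" for z
    proof -
      have "complex_of_real (LINT x|lborel. cmod (u x * cnj (u (x - z)))) = autocorr (\<lambda>x. complex_of_real (cmod (u x))) z"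
        by (simp add: autocorr_def ip2_def norm_mult integral_complex_of_real[symmetric] del: integral_complex_of_real)
      then have "\<bar>LINT x|lborel. cmod (u x * cnj (u (x - z)))\<bar> \<le> (norm2 lborel (\<lambda>x. complex_of_real (cmod (u x))))\<^sup>2"
        using cmod_autocorr_le[OF abs, of z] by (metis norm_of_real)
      then show ?thesis by (simp add: norm2_def)
    qed
    have "integrable (lborel \<Otimes>\<^sub>M lborel) ?f"
    proof (rule lborel_pair.Fubini_integrable)
      show "?f \<in> borel_measurable (lborel \<Otimes>\<^sub>M lborel)" by measurable
      show "AE w in lborel. integrable lborel (\<lambda>x. ?f (w, x))"
        using int by simp
      show "integrable lborel (\<lambda>w. LINT x|lborel. norm (?f (w, x)))"
      proof (rule Bochner_Integration.integrable_bound)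
        show "integrable lborel (\<lambda>w::real ^ 'd. (norm2 lborel u)\<^sup>2 * gauss 1 w)"
          by (intro integrable_mult_right integrable_gauss) simp
        show "(\<lambda>w. LINT x|lborel. norm (?f (w, x))) \<in> borel_measurable lborel" by measurable
        show "AE w in lborel. norm (LINT x|lborel. norm (?f (w, x))) \<le> norm ((norm2 lborel u)\<^sup>2 * gauss 1 w)"
        proof (intro AE_I2)
          fix w :: "real ^ 'd"
          have "(LINT x|lborel. norm (?f (w, x))) = (LINT x|lborel. cmod (u x * cnj (u (x - \<sigma> *\<^sub>R w)))) * gauss 1 w"
            by (simp add: norm_mult)
          also have "\<dots> \<le> (norm2 lborel u)\<^sup>2 * gauss 1 w"
            by (intro mult_right_mono bound) simp
          finally show "norm (LINT x|lborel. norm (?f (w, x))) \<le> norm ((norm2 lborel u)\<^sup>2 * gauss 1 w)"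
            by (simp add: integral_nonneg)
        qed
      qed
    qed
    then show ?thesis
      by (intro lborel_pair.Fubini_integral) (simp add: case_prod_unfold)
  qed
  also have "(\<lambda>w. LINT x|lborel. u x * cnj (u (x - \<sigma> *\<^sub>R w)) * complex_of_real (gauss 1 w))
      = (\<lambda>w. complex_of_real (gauss 1 w) * autocorr u (\<sigma> *\<^sub>R w))"
    unfolding autocorr_def ip2_def integral_mult_left_zero by (rule ext, rule mult.commute)
  finally show ?thesis by (simp add: K_def)
qed

lemma gaussian_plancherel_le:
  fixes u :: "real ^ 'd \<Rightarrow> complex"
  assumes u: "integrable lborel u" and u2: "u \<in> sq_int lborel" and \<sigma>: "0 < \<sigma>"
  shows "(LINT \<xi>|lborel. (cmod (fourier_lborel u \<xi>))\<^sup>2 * gauss \<sigma> \<xi>) \<le> (2 * pi) ^ CARD('d) * (norm2 lborel u)\<^sup>2"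
proof -
  have um[measurable]: "u \<in> borel_measurable borel" using borel_measurable_integrable[OF u] by simp
  let ?K = "sqrt (2 * pi) ^ CARD('d)"
  have "(LINT \<xi>|lborel. (cmod (fourier_lborel u \<xi>))\<^sup>2 * gauss \<sigma> \<xi>)
      \<le> cmod (complex_of_real (LINT \<xi>|lborel. (cmod (fourier_lborel u \<xi>))\<^sup>2 * gauss \<sigma> \<xi>))"
    by simp
  also have "\<dots> = ?K * cmod (LINT w|lborel. complex_of_real (gauss 1 w) * autocorr u (\<sigma> *\<^sub>R w))"
    unfolding gaussian_plancherel[OF u u2 \<sigma>] by (simp add: norm_mult norm_power)
  also have "\<dots> \<le> ?K * (LINT w|lborel. gauss 1 (w::real ^ 'd) * (norm2 lborel u)\<^sup>2)"
  proof (intro mult_left_mono integral_norm_bound[THEN order_trans])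
    show "(LINT w|lborel. cmod (complex_of_real (gauss 1 w) * autocorr u (\<sigma> *\<^sub>R w)))
        \<le> (LINT w|lborel. gauss 1 (w::real ^ 'd) * (norm2 lborel u)\<^sup>2)"
    proof (rule Bochner_Integration.integral_mono')
      show "integrable lborel (\<lambda>w::real ^ 'd. gauss 1 w * (norm2 lborel u)\<^sup>2)"
        by (intro integrable_mult_left integrable_gauss) simp
    qed (auto simp: norm_mult intro!: mult_left_mono cmod_autocorr_le[OF u2])
  qed simp
  also have "\<dots> = ?K * ?K * (norm2 lborel u)\<^sup>2"
    by (simp add: integral_gauss)
  also have "?K * ?K = (sqrt (2 * pi) * sqrt (2 * pi)) ^ CARD('d)"
    by (simp only: power_mult_distrib)
  also have "sqrt (2 * pi) * sqrt (2 * pi) = 2 * pi" by simp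
  finally show ?thesis .
qed

lemma tendsto_gauss: "(\<lambda>n. gauss (inverse (real (Suc n))) \<xi>) \<longlonglongrightarrow> 1"
proof -
  have "(\<lambda>n. exp (- ((inverse (real (Suc n)))\<^sup>2 * (norm \<xi>)\<^sup>2 / 2))) \<longlonglongrightarrow> exp (- (0\<^sup>2 * (norm \<xi>)\<^sup>2 / 2))"
    by (intro tendsto_intros LIMSEQ_inverse_real_of_nat) auto
  then show ?thesis by (simp add: gauss_def)
qed

text \<open>Bounding the autocorrelation by Cauchy--Schwarz gives the inequality with Gaussian weight, uniformly in
  \<open>\<sigma>\<close>; Fatou's lemma for \<open>\<sigma> \<rightarrow> 0\<close> removes the weight.\<close>
lemma plancherel_le_lborel:
  fixes u :: "real ^ 'd \<Rightarrow> complex"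
  assumes u: "integrable lborel u" and u2: "u \<in> sq_int lborel"
  shows "fourier_lborel u \<in> sq_int lborel" and "norm2 lborel (fourier_lborel u) \<le> sqrt ((2 * pi) ^ CARD('d)) * norm2 lborel u"
proof -
  have um[measurable]: "u \<in> borel_measurable borel" using borel_measurable_integrable[OF u] by simp
  let ?C = "sqrt ((2 * pi) ^ CARD('d)) * norm2 lborel u"
  let ?g = "\<lambda>n \<xi>. (cmod (fourier_lborel u \<xi>))\<^sup>2 * gauss (inverse (real (Suc n))) \<xi>"
  have int: "integrable lborel (?g n)" for n
  proof (rule Bochner_Integration.integrable_bound)
    show "integrable lborel (\<lambda>\<xi>. (LINT x|lborel. cmod (u x))\<^sup>2 * gauss (inverse (real (Suc n))) (\<xi> :: real ^ 'd))"
      by (intro integrable_mult_right integrable_gauss) simp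
  qed (auto simp: abs_mult intro!: mult_right_mono power_mono cmod_fourier_lborel_le)
  have "(\<integral>\<^sup>+\<xi>. ennreal ((cmod (fourier_lborel u \<xi>))\<^sup>2) \<partial>lborel) = (\<integral>\<^sup>+\<xi>. liminf (\<lambda>n. ennreal (?g n \<xi>)) \<partial>lborel)"
  proof (rule nn_integral_cong)
    fix \<xi> :: "real ^ 'd"
    have "(\<lambda>n. ennreal (?g n \<xi>)) \<longlonglongrightarrow> ennreal ((cmod (fourier_lborel u \<xi>))\<^sup>2 * 1)"
      by (intro tendsto_intros tendsto_gauss)
    then show "ennreal ((cmod (fourier_lborel u \<xi>))\<^sup>2) = liminf (\<lambda>n. ennreal (?g n \<xi>))"
      by (subst mult_1_right[symmetric]) (intro lim_imp_Liminf[symmetric] sequentially_bot)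
  qed
  also have "\<dots> \<le> liminf (\<lambda>n. \<integral>\<^sup>+\<xi>. ennreal (?g n \<xi>) \<partial>lborel)"
    by (rule nn_integral_liminf) measurable
  also have "\<dots> \<le> ennreal (?C\<^sup>2)"
  proof (rule Liminf_le)
    show "\<forall>\<^sub>F n in sequentially. (\<integral>\<^sup>+\<xi>. ennreal (?g n \<xi>) \<partial>lborel) \<le> ennreal (?C\<^sup>2)"
    proof (intro always_eventually allI)
      fix n
      have "(\<integral>\<^sup>+\<xi>. ennreal (?g n \<xi>) \<partial>lborel) = ennreal (LINT \<xi>|lborel. ?g n \<xi>)"
        by (rule nn_integral_eq_integral[OF int]) simp
      also have "\<dots> \<le> ennreal ((2 * pi) ^ CARD('d) * (norm2 lborel u)\<^sup>2)"
        by (intro ennreal_leI gaussian_plancherel_le[OF u u2]) simp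
      finally show "(\<integral>\<^sup>+\<xi>. ennreal (?g n \<xi>) \<partial>lborel) \<le> ennreal (?C\<^sup>2)"
        by (simp add: power_mult_distrib)
    qed
  qed simp
  finally have *: "(\<integral>\<^sup>+\<xi>. ennreal ((cmod (fourier_lborel u \<xi>))\<^sup>2) \<partial>lborel) \<le> ennreal (?C\<^sup>2)" .
  show "fourier_lborel u \<in> sq_int lborel" by (rule norm2_leI(1)[OF _ _ *]) auto
  show "norm2 lborel (fourier_lborel u) \<le> ?C" by (rule norm2_leI(2)[OF _ _ *]) auto
qed

lemma continuous_compact_support_bounded:
  fixes u :: "'a::euclidean_space \<Rightarrow> complex"
  assumes cont: "continuous_on UNIV u" and supp: "\<And>x. R < norm x \<Longrightarrow> u x = 0"
  obtains B where "\<And>x. cmod (u x) \<le> B"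
proof -
  have "bounded (u ` cball 0 R)"
    by (intro compact_imp_bounded compact_continuous_image continuous_on_subset[OF cont]) auto
  then obtain B where B: "\<And>x. x \<in> cball 0 R \<Longrightarrow> cmod (u x) \<le> B" unfolding bounded_iff by blast
  have "cmod (u x) \<le> max B 0" for x
    using B[of x] supp[of x] by (cases "norm x \<le> R") (auto simp: max.coboundedI1)
  then show thesis by (rule that)
qed

lemma continuous_compact_support_integrable:
  fixes u :: "'a::euclidean_space \<Rightarrow> complex"
  assumes cont: "continuous_on UNIV u" and supp: "\<And>x. R < norm x \<Longrightarrow> u x = 0"
  shows "integrable lborel u" and "u \<in> sq_int lborel"
proof -
  have m[measurable]: "u \<in> borel_measurable borel" using cont by (rule borel_measurable_continuous_onI)
  obtain B where B: "\<And>x. cmod (u x) \<le> B"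
    using continuous_compact_support_bounded[of u R] assms by blast
  have B0: "0 \<le> B" using norm_ge_zero B by (rule order_trans)
  have ind: "integrable lborel (\<lambda>x::'a. C * indicator (cball 0 R) x)" for C :: real
    using emeasure_bounded_finite[OF bounded_cball, of "0::'a" R]
    by (intro integrable_mult_right integrable_real_indicator) auto
  have le: "cmod (u x) \<le> B * indicator (cball 0 R) x" for x
    using B[of x] supp[of x] by (auto split: split_indicator)
  show "integrable lborel u"
    by (rule Bochner_Integration.integrable_bound[OF ind[of B]])
      (use le B0 in \<open>auto simp: abs_mult\<close>)
  show "u \<in> sq_int lborel"
  proof (rule sq_intI)
    show "integrable lborel (\<lambda>x. (cmod (u x))\<^sup>2)"
    proof (rule Bochner_Integration.integrable_bound[OF ind[of "B\<^sup>2"]])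
      show "AE x in lborel. norm ((cmod (u x))\<^sup>2) \<le> norm (B\<^sup>2 * indicator (cball 0 R) x)"
      proof (intro AE_I2)
        fix x :: 'a
        have "(cmod (u x))\<^sup>2 \<le> (B * indicator (cball 0 R) x)\<^sup>2" by (intro power_mono le) simp
        then show "norm ((cmod (u x))\<^sup>2) \<le> norm (B\<^sup>2 * indicator (cball 0 R) x)"
          by (cases "x \<in> cball 0 R") auto
      qed
    qed measurable
  qed simp
qed

text \<open>For continuous functions with compact support the autocorrelation is continuous at \<open>0\<close>, so both sides of
  the Gaussian identity converge and the inequality becomes an equation.\<close>
lemma plancherel_continuous:
  fixes u :: "real ^ 'd \<Rightarrow> complex"
  assumes cont: "continuous_on UNIV u" and supp: "\<And>x. R < norm x \<Longrightarrow> u x = 0"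
  shows "norm2 lborel (fourier_lborel u) = sqrt ((2 * pi) ^ CARD('d)) * norm2 lborel u"
proof -
  have u: "integrable lborel u" and u2: "u \<in> sq_int lborel"
    using continuous_compact_support_integrable[OF cont, of R] supp by blast+
  have um[measurable]: "u \<in> borel_measurable borel" using borel_measurable_integrable[OF u] by simp
  note F2 = plancherel_le_lborel(1)[OF u u2]
  obtain B where B: "\<And>x. cmod (u x) \<le> B"
    using continuous_compact_support_bounded[of u R] assms by blast
  let ?s = "\<lambda>n. inverse (real (Suc n))"
  let ?K = "sqrt (2 * pi) ^ CARD('d)"
  have s0: "?s \<longlonglongrightarrow> 0" by (rule LIMSEQ_inverse_real_of_nat)
  have autocorr_m[measurable]: "autocorr u \<in> borel_measurable borel"
    unfolding autocorr_def ip2_def by measurable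
  have A: "(\<lambda>n. autocorr u (?s n *\<^sub>R w)) \<longlonglongrightarrow> complex_of_real ((norm2 lborel u)\<^sup>2)" for w
  proof -
    have "(\<lambda>n. autocorr u (?s n *\<^sub>R w)) \<longlonglongrightarrow> (LINT x|lborel. u x * cnj (u x))"
      unfolding autocorr_def ip2_def
    proof (rule integral_dominated_convergence)
      show "integrable lborel (\<lambda>x. cmod (u x) * B)" using u by simp
      show "AE x in lborel. (\<lambda>n. u x * cnj (u (x - ?s n *\<^sub>R w))) \<longlonglongrightarrow> u x * cnj (u x)"
      proof (intro AE_I2)
        fix x
        have "(\<lambda>n. x - ?s n *\<^sub>R w) \<longlonglongrightarrow> x - 0 *\<^sub>R w" by (intro tendsto_intros s0)
        then have "(\<lambda>n. u (x - ?s n *\<^sub>R w)) \<longlonglongrightarrow> u (x - 0 *\<^sub>R w)"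
          using cont by (intro continuous_on_tendsto_compose[OF cont]) auto
        then show "(\<lambda>n. u x * cnj (u (x - ?s n *\<^sub>R w))) \<longlonglongrightarrow> u x * cnj (u x)"
          by (intro tendsto_intros) simp
      qed
      show "AE x in lborel. norm (u x * cnj (u (x - ?s n *\<^sub>R w))) \<le> cmod (u x) * B" for n
        using B by (auto simp: norm_mult intro!: mult_left_mono)
    qed measurable
    then show ?thesis using ip2_self[of lborel u] by (simp add: ip2_def)
  qed
  have lhs: "(\<lambda>n. LINT \<xi>|lborel. (cmod (fourier_lborel u \<xi>))\<^sup>2 * gauss (?s n) \<xi>) \<longlonglongrightarrow> (LINT \<xi>|lborel. (cmod (fourier_lborel u \<xi>))\<^sup>2)"
  proof (rule integral_dominated_convergence)
    show "integrable lborel (\<lambda>\<xi>. (cmod (fourier_lborel u \<xi>))\<^sup>2)" by (rule sq_int_integrable[OF F2])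
    show "AE \<xi> in lborel. (\<lambda>n. (cmod (fourier_lborel u \<xi>))\<^sup>2 * gauss (?s n) \<xi>) \<longlonglongrightarrow> (cmod (fourier_lborel u \<xi>))\<^sup>2"
      by (intro AE_I2 tendsto_mult[OF tendsto_const tendsto_gauss, THEN tendsto_eq_rhs]) simp
    show "AE \<xi> in lborel. norm ((cmod (fourier_lborel u \<xi>))\<^sup>2 * gauss (?s n) \<xi>) \<le> (cmod (fourier_lborel u \<xi>))\<^sup>2" for n
      by (intro AE_I2) (simp add: abs_mult mult_left_le gauss_le_1)
  qed measurable
  have rhs: "(\<lambda>n. LINT w|lborel. complex_of_real (gauss 1 w) * autocorr u (?s n *\<^sub>R w))
      \<longlonglongrightarrow> (LINT w|lborel. complex_of_real (gauss 1 (w :: real ^ 'd)) * complex_of_real ((norm2 lborel u)\<^sup>2))"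
  proof (rule integral_dominated_convergence)
    show "integrable lborel (\<lambda>w::real ^ 'd. gauss 1 w * (norm2 lborel u)\<^sup>2)"
      by (intro integrable_mult_left integrable_gauss) simp
    show "AE w in lborel. (\<lambda>n. complex_of_real (gauss 1 w) * autocorr u (?s n *\<^sub>R w))
        \<longlonglongrightarrow> complex_of_real (gauss 1 w) * complex_of_real ((norm2 lborel u)\<^sup>2)"
      by (intro AE_I2 tendsto_mult tendsto_const A)
    show "AE w in lborel. norm (complex_of_real (gauss 1 w) * autocorr u (?s n *\<^sub>R w)) \<le> gauss 1 w * (norm2 lborel u)\<^sup>2" for n
      by (auto simp: norm_mult intro!: mult_left_mono cmod_autocorr_le[OF u2])
  qed measurable
  have "(\<lambda>n. complex_of_real (LINT \<xi>|lborel. (cmod (fourier_lborel u \<xi>))\<^sup>2 * gauss (?s n) \<xi>))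
      \<longlonglongrightarrow> complex_of_real ?K * (LINT w|lborel. complex_of_real (gauss 1 (w :: real ^ 'd)) * complex_of_real ((norm2 lborel u)\<^sup>2))"
  proof -
    have "complex_of_real (LINT \<xi>|lborel. (cmod (fourier_lborel u \<xi>))\<^sup>2 * gauss (?s n) \<xi>)
        = complex_of_real ?K * (LINT w|lborel. complex_of_real (gauss 1 w) * autocorr u (?s n *\<^sub>R w))" for n
      by (rule gaussian_plancherel[OF u u2]) simp
    then show ?thesis using tendsto_mult[OF tendsto_const rhs] by (simp only:)
  qed
  moreover have "(\<lambda>n. complex_of_real (LINT \<xi>|lborel. (cmod (fourier_lborel u \<xi>))\<^sup>2 * gauss (?s n) \<xi>))
      \<longlonglongrightarrow> complex_of_real (LINT \<xi>|lborel. (cmod (fourier_lborel u \<xi>))\<^sup>2)"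
    by (rule tendsto_of_real[OF lhs])
  ultimately have "complex_of_real (LINT \<xi>|lborel. (cmod (fourier_lborel u \<xi>))\<^sup>2)
      = complex_of_real ?K * (LINT w|lborel. complex_of_real (gauss 1 (w :: real ^ 'd)) * complex_of_real ((norm2 lborel u)\<^sup>2))"
    by (rule LIMSEQ_unique[OF _ _, rotated])
  also have "(LINT w|lborel. complex_of_real (gauss 1 (w :: real ^ 'd)) * complex_of_real ((norm2 lborel u)\<^sup>2))
      = complex_of_real (?K * (norm2 lborel u)\<^sup>2)"
    by (subst integral_mult_left_zero, subst integral_complex_of_real) (simp add: integral_gauss)
  also have "complex_of_real ?K * complex_of_real (?K * (norm2 lborel u)\<^sup>2)
      = complex_of_real ((2 * pi) ^ CARD('d) * (norm2 lborel u)\<^sup>2)"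
  proof -
    have "?K * (?K * (norm2 lborel u)\<^sup>2) = (sqrt (2 * pi) * sqrt (2 * pi)) ^ CARD('d) * (norm2 lborel u)\<^sup>2"
      by (simp only: power_mult_distrib mult.assoc)
    also have "sqrt (2 * pi) * sqrt (2 * pi) = 2 * pi" by simp
    finally have "?K * (?K * (norm2 lborel u)\<^sup>2) = (2 * pi) ^ CARD('d) * (norm2 lborel u)\<^sup>2" .
    then show ?thesis by (metis of_real_mult)
  qed
  finally have "(norm2 lborel (fourier_lborel u))\<^sup>2 = (2 * pi) ^ CARD('d) * (norm2 lborel u)\<^sup>2"
    by (simp only: norm2_sq of_real_eq_iff)
  then show ?thesis
    by (metis norm2_nonneg real_sqrt_mult real_sqrt_unique)
qed

section \<open>The Fourier transform on square-integrable functions\<close>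

lemma borel_representative:
  fixes f :: "'a::euclidean_space \<Rightarrow> complex"
  assumes f: "f \<in> borel_measurable lebesgue"
  obtains g where "g \<in> borel_measurable borel" "AE x in lebesgue. f x = g x"
proof -
  obtain a where a: "a \<in> borel_measurable lborel" "AE x in lborel. Re (f x) = a x"
    using completion_ex_borel_measurable_real[of "\<lambda>x. Re (f x)" lborel] f by auto
  obtain b where b: "b \<in> borel_measurable lborel" "AE x in lborel. Im (f x) = b x"
    using completion_ex_borel_measurable_real[of "\<lambda>x. Im (f x)" lborel] f by auto
  have [measurable]: "a \<in> borel_measurable borel" "b \<in> borel_measurable borel" using a b by auto
  show thesis
  proof
    show "(\<lambda>x. complex_of_real (a x) + \<i> * complex_of_real (b x)) \<in> borel_measurable borel" by measurable
    have "AE x in lborel. f x = complex_of_real (a x) + \<i> * complex_of_real (b x)"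
      using a(2) b(2) by eventually_elim (simp add: complex_eq_iff)
    then show "AE x in lebesgue. f x = complex_of_real (a x) + \<i> * complex_of_real (b x)"
      by (rule AE_completion)
  qed
qed

lemma sq_int_lborel_iff:
  assumes "g \<in> borel_measurable borel"
  shows "g \<in> sq_int lebesgue \<longleftrightarrow> g \<in> sq_int lborel"
  using assms integrable_completion[of "\<lambda>x. (cmod (g x))\<^sup>2" lborel]
  by (auto simp: sq_int_def measurable_completion)

lemma norm2_lborel:
  assumes "g \<in> borel_measurable borel"
  shows "norm2 lebesgue g = norm2 lborel g"
  using assms integral_completion[of "\<lambda>x. (cmod (g x))\<^sup>2" lborel] by (simp add: norm2_def)

lemma fourier_L1_wave: "fourier_L1 f \<xi> = (LINT x|lebesgue. f x * wave x \<xi>)"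
  by (simp add: fourier_L1_def wave_def)

lemma borel_measurable_lebesgue_wave [measurable]: "(\<lambda>x. wave x \<xi>) \<in> borel_measurable lebesgue"
  by (rule measurable_completion) measurable

lemma integrable_lebesgue_mult_wave:
  assumes u: "integrable lebesgue u"
  shows "integrable lebesgue (\<lambda>x. u x * wave x \<xi>)"
  using borel_measurable_integrable[OF u]
  by (intro Bochner_Integration.integrable_bound[OF u]) (auto simp: norm_mult)

lemma fourier_L1_representative:
  assumes u: "u \<in> borel_measurable lebesgue" "integrable lebesgue u" "u \<in> sq_int lebesgue"
  obtains v where "integrable lborel v" "v \<in> sq_int lborel" "fourier_L1 u = fourier_lborel v"
    "norm2 lebesgue u = norm2 lborel v"
proof -
  note [measurable] = u(1)
  obtain v where v: "v \<in> borel_measurable borel" and ae: "AE x in lebesgue. u x = v x"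
    using borel_representative[OF u(1)] by blast
  have vm[measurable]: "v \<in> borel_measurable lebesgue" using v by (simp add: measurable_completion)
  show thesis
  proof
    have "integrable lebesgue v" using u(2) ae by (subst integrable_cong_AE[of v _ u]) auto
    then show "integrable lborel v" using integrable_completion[of v lborel] v by simp
    have "v \<in> sq_int lebesgue" by (rule sq_int_cong_AE[OF u(3) vm ae])
    then show "v \<in> sq_int lborel" using sq_int_lborel_iff[OF v] by simp
    show "norm2 lebesgue u = norm2 lborel v"
      using norm2_cong_AE[OF u(1) vm ae] norm2_lborel[OF v] by simp
    show "fourier_L1 u = fourier_lborel v"
    proof
      fix \<xi>
      have "fourier_L1 u \<xi> = (LINT x|lebesgue. v x * wave x \<xi>)"
        unfolding fourier_L1_wave by (rule integral_cong_AE) (use ae in auto)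
      also have "\<dots> = fourier_lborel v \<xi>"
        unfolding fourier_lborel_def by (rule integral_completion) (use v in measurable)
      finally show "fourier_L1 u \<xi> = fourier_lborel v \<xi>" .
    qed
  qed
qed

lemma plancherel_le:
  fixes u :: "real ^ 'd \<Rightarrow> complex"
  assumes u: "integrable lebesgue u" "u \<in> sq_int lebesgue"
  shows "fourier_L1 u \<in> sq_int lebesgue"
    and "norm2 lebesgue (fourier_L1 u) \<le> sqrt ((2 * pi) ^ CARD('d)) * norm2 lebesgue u"
proof -
  obtain v where v: "integrable lborel v" "v \<in> sq_int lborel" "fourier_L1 u = fourier_lborel v"
    "norm2 lebesgue u = norm2 lborel v"
    using fourier_L1_representative[OF borel_measurable_integrable[OF u(1)] u] by blast
  have [measurable]: "v \<in> borel_measurable borel" using borel_measurable_integrable[OF v(1)] by simp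
  have F: "fourier_lborel v \<in> borel_measurable borel" by measurable
  show "fourier_L1 u \<in> sq_int lebesgue"
    unfolding v(3) using plancherel_le_lborel(1)[OF v(1,2)] sq_int_lborel_iff[OF F] by simp
  show "norm2 lebesgue (fourier_L1 u) \<le> sqrt ((2 * pi) ^ CARD('d)) * norm2 lebesgue u"
    unfolding v(3,4) norm2_lborel[OF F] by (rule plancherel_le_lborel(2)[OF v(1,2)])
qed

definition Cc :: "('a::euclidean_space \<Rightarrow> complex) set" where
  "Cc = {u. continuous_on UNIV u \<and> (\<exists>R. \<forall>x. R < norm x \<longrightarrow> u x = 0)}"

lemma Cc_integrable:
  assumes "u \<in> Cc"
  shows "integrable lebesgue u" "u \<in> sq_int lebesgue"
proof -
  obtain R where c: "continuous_on UNIV u" and R: "\<And>x. R < norm x \<Longrightarrow> u x = 0"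
    using assms by (auto simp: Cc_def)
  have m: "u \<in> borel_measurable borel" using c by (rule borel_measurable_continuous_onI)
  show "integrable lebesgue u"
    using continuous_compact_support_integrable(1)[OF c R] integrable_completion[of u lborel] m by simp
  show "u \<in> sq_int lebesgue"
    using continuous_compact_support_integrable(2)[OF c R] sq_int_lborel_iff[OF m] by simp
qed

lemma plancherel_Cc:
  fixes u :: "real ^ 'd \<Rightarrow> complex"
  assumes "u \<in> Cc"
  shows "norm2 lebesgue (fourier_L1 u) = sqrt ((2 * pi) ^ CARD('d)) * norm2 lebesgue u"
proof -
  obtain R where c: "continuous_on UNIV u" and R: "\<And>x. R < norm x \<Longrightarrow> u x = 0"
    using assms by (auto simp: Cc_def)
  have m[measurable]: "u \<in> borel_measurable borel" using c by (rule borel_measurable_continuous_onI)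
  have "fourier_L1 u = fourier_lborel u"
    by (rule ext, unfold fourier_L1_wave fourier_lborel_def, rule integral_completion) measurable
  then show ?thesis
    using plancherel_continuous[OF c R] by (simp add: norm2_lborel)
qed

lemma tendsto_zero_small:
  assumes "(\<lambda>n. a n) \<longlonglongrightarrow> (0::real)" "0 < e"
  obtains n where "a n < e"
proof -
  have "\<forall>\<^sub>F n in sequentially. a n < e" by (rule order_tendstoD(2)[OF assms])
  then show thesis using that by (auto simp: eventually_sequentially)
qed

text \<open>Truncation: \<open>f\<close> is replaced by \<open>0\<close> where its argument or its value is large.\<close>
lemma bounded_approx_sq_int:
  fixes f :: "'a::euclidean_space \<Rightarrow> complex"
  assumes f: "f \<in> sq_int lebesgue" and e: "0 < e"
  obtains g N where "0 < N" "g \<in> borel_measurable lebesgue" "\<And>x. cmod (g x) \<le> N" "\<And>x. N < norm x \<Longrightarrow> g x = 0"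
    "g \<in> sq_int lebesgue" "norm2 lebesgue (\<lambda>x. g x - f x) < e"
proof -
  note fm[measurable] = sq_int_meas[OF f]
  define g where "g = (\<lambda>n x. if norm x \<le> real n + 1 \<and> cmod (f x) \<le> real n + 1 then f x else 0)"
  have [measurable]: "(\<lambda>x::'a. norm x) \<in> borel_measurable lebesgue"
    by (rule measurable_completion) measurable
  have gm[measurable]: "g n \<in> borel_measurable lebesgue" for n
    unfolding g_def by measurable
  have lim: "(\<lambda>n. g n x) \<longlonglongrightarrow> f x" for x
  proof (rule tendsto_eventually)
    obtain K where K: "norm x \<le> real K" using real_arch_simple by blast
    obtain L where L: "cmod (f x) \<le> real L" using real_arch_simple by blast
    show "\<forall>\<^sub>F n in sequentially. g n x = f x"
      using eventually_ge_at_top[of "max K L"]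
    proof eventually_elim
      fix n assume "max K L \<le> n"
      then have "real K \<le> real n" "real L \<le> real n" by auto
      then show "g n x = f x" using K L by (auto simp: g_def)
    qed
  qed
  have "(\<lambda>n. norm2 lebesgue (\<lambda>x. g n x - f x)) \<longlonglongrightarrow> 0"
    by (rule norm2_dominated_convergence(2)[OF gm fm f]) (use lim in \<open>auto simp: g_def\<close>)
  then obtain n where n: "norm2 lebesgue (\<lambda>x. g n x - f x) < e" using e by (rule tendsto_zero_small)
  show thesis
  proof (rule that[of "real n + 1" "g n"])
    show "g n \<in> sq_int lebesgue"
      by (rule sq_int_bound[OF f gm, of n 1]) (auto simp: g_def)
  qed (use n in \<open>auto simp: g_def\<close>)
qed

text \<open>A measurable function is almost everywhere a limit of continuous ones. Composing these with the
  retraction onto the disc of radius \<open>N\<close> keeps them within the bound of \<open>g\<close>.\<close>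
lemma continuous_approx_bounded:
  fixes g :: "'a::euclidean_space \<Rightarrow> complex"
  assumes g: "g \<in> borel_measurable lebesgue" and N: "0 < N" and gN: "\<And>x. cmod (g x) \<le> N"
  obtains h N0 where "negligible N0" "\<And>n. continuous_on UNIV (h n)" "\<And>n x. cmod (h n x) \<le> N"
    "\<And>x. x \<notin> N0 \<Longrightarrow> (\<lambda>n. h n x) \<longlonglongrightarrow> g x"
proof -
  have "g measurable_on UNIV"
    using g by (intro lebesgue_measurable_imp_measurable_on) auto
  then obtain N0 k where N0: "negligible N0" and k: "\<And>n. continuous_on UNIV (k n)"
    and lim: "\<And>x. x \<notin> N0 \<Longrightarrow> (\<lambda>n. k n x) \<longlonglongrightarrow> g x"
    unfolding measurable_on_def by auto
  define clip where "clip = (\<lambda>z::complex. complex_of_real (N / max N (cmod z)) * z)"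
  have clip_le: "cmod (clip z) \<le> N" for z
  proof -
    have "cmod (clip z) = N * (cmod z / max N (cmod z))"
      using N by (simp add: clip_def norm_mult norm_divide)
    also have "\<dots> \<le> N * 1"
      using N by (intro mult_left_mono) auto
    finally show ?thesis by simp
  qed
  have clip_id: "clip z = z" if "cmod z \<le> N" for z
    using that N by (simp add: clip_def max_def)
  have clip_cont: "continuous_on UNIV clip"
    unfolding clip_def using N by (intro continuous_intros) auto
  show thesis
  proof (rule that[OF N0, of "\<lambda>n x. clip (k n x)"])
    show "continuous_on UNIV (\<lambda>x. clip (k n x))" for n
      by (rule continuous_on_compose2[OF clip_cont k]) auto
    show "(\<lambda>n. clip (k n x)) \<longlonglongrightarrow> g x" if "x \<notin> N0" for x
    proof -
      have "(\<lambda>n. clip (k n x)) \<longlonglongrightarrow> clip (g x)"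
        using lim[OF that] by (intro continuous_on_tendsto_compose[OF clip_cont]) auto
      then show ?thesis by (simp add: clip_id gN)
    qed
  qed (rule clip_le)
qed

lemma AE_not_negligible: "negligible N0 \<Longrightarrow> AE x in lebesgue. x \<notin> N0"
  unfolding negligible_iff_null_sets by (rule AE_not_in)

text \<open>After truncation, the bounded continuous approximants are multiplied by a cutoff function, and dominated
  convergence applies.\<close>
lemma Cc_dense:
  fixes f :: "'a::euclidean_space \<Rightarrow> complex"
  assumes f: "f \<in> sq_int lebesgue" and e: "0 < e"
  obtains v where "v \<in> Cc" "norm2 lebesgue (\<lambda>x. v x - f x) < e"
proof -
  have e2: "0 < e / 2" using e by simp
  obtain g N where N: "0 < N" and gm: "g \<in> borel_measurable lebesgue" and gN: "\<And>x. cmod (g x) \<le> N"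
    and g0: "\<And>x. N < norm x \<Longrightarrow> g x = 0" and g2: "g \<in> sq_int lebesgue"
    and ge: "norm2 lebesgue (\<lambda>x. g x - f x) < e / 2"
    using bounded_approx_sq_int[OF f e2] by metis
  obtain h N0 where N0: "negligible N0" and h: "\<And>n. continuous_on UNIV (h n)" "\<And>n x. cmod (h n x) \<le> N"
    "\<And>x. x \<notin> N0 \<Longrightarrow> (\<lambda>n. h n x) \<longlonglongrightarrow> g x"
    using continuous_approx_bounded[OF gm N gN] by metis
  \<comment> \<open>The cutoff equals \<open>1\<close> on the ball outside which \<open>g\<close> vanishes.\<close>
  define ct where "ct = (\<lambda>x::'a. max 0 (min 1 (N + 1 - norm x)))"
  have ct1: "ct x = 1" if "norm x \<le> N" for x using that by (simp add: ct_def)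
  have ct0: "ct x = 0" if "N + 1 < norm x" for x using that by (simp add: ct_def)
  have ctb: "0 \<le> ct x" "ct x \<le> 1" for x by (auto simp: ct_def)
  define v where "v = (\<lambda>n x. complex_of_real (ct x) * h n x)"
  have v: "v n \<in> Cc" for n
  proof -
    have "continuous_on UNIV (v n)"
      unfolding v_def ct_def using h(1)[of n] by (intro continuous_intros)
    then show ?thesis using ct0 by (auto simp: Cc_def v_def intro!: exI[of _ "N + 1"])
  qed
  define w where "w = (\<lambda>x::'a. complex_of_real (N * ct x))"
  have w: "w \<in> sq_int lebesgue"
  proof (rule Cc_integrable(2))
    have "continuous_on UNIV w" unfolding w_def ct_def by (intro continuous_intros)
    then show "w \<in> Cc" using ct0 by (auto simp: Cc_def w_def intro!: exI[of _ "N + 1"])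
  qed
  have "(\<lambda>n. norm2 lebesgue (\<lambda>x. v n x - g x)) \<longlonglongrightarrow> 0"
  proof (rule norm2_dominated_convergence(2)[OF sq_int_meas[OF Cc_integrable(2)[OF v]] gm w])
    show "AE x in lebesgue. (\<lambda>n. v n x) \<longlonglongrightarrow> g x"
      using AE_not_negligible[OF N0]
    proof eventually_elim
      fix x assume "x \<notin> N0"
      then have "(\<lambda>n. v n x) \<longlonglongrightarrow> complex_of_real (ct x) * g x"
        unfolding v_def by (intro tendsto_intros h(3))
      then show "(\<lambda>n. v n x) \<longlonglongrightarrow> g x"
        using ct1[of x] g0[of x] by (cases "norm x \<le> N") auto
    qed
    show "AE x in lebesgue. cmod (v n x) \<le> cmod (w x)" for n
    proof (intro AE_I2)
      fix x
      have "cmod (v n x) \<le> ct x * N"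
        using h(2) ctb by (auto simp: v_def norm_mult intro!: mult_left_mono)
      also have "\<dots> = cmod (w x)" using N ctb(1) by (simp add: w_def norm_mult)
      finally show "cmod (v n x) \<le> cmod (w x)" .
    qed
  qed
  then obtain n where n: "norm2 lebesgue (\<lambda>x. v n x - g x) < e / 2" using e2 by (rule tendsto_zero_small)
  have "norm2 lebesgue (\<lambda>x. v n x - f x) \<le> norm2 lebesgue (\<lambda>x. v n x - g x) + norm2 lebesgue (\<lambda>x. g x - f x)"
    by (intro norm2_triangle_diff Cc_integrable v g2 f)
  also have "\<dots> < e" using n ge by simp
  finally show thesis using that v by blast
qed

lemma fourier_L1_diff:
  assumes "integrable lebesgue u" "integrable lebesgue v"
  shows "fourier_L1 (\<lambda>x. u x - v x) = (\<lambda>\<xi>. fourier_L1 u \<xi> - fourier_L1 v \<xi>)"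
  by (rule ext, unfold fourier_L1_wave left_diff_distrib)
    (intro Bochner_Integration.integral_diff integrable_lebesgue_mult_wave assms)

lemma fourier_L1_add:
  assumes "integrable lebesgue u" "integrable lebesgue v"
  shows "fourier_L1 (\<lambda>x. u x + v x) = (\<lambda>\<xi>. fourier_L1 u \<xi> + fourier_L1 v \<xi>)"
  by (rule ext, unfold fourier_L1_wave distrib_right)
    (intro Bochner_Integration.integral_add integrable_lebesgue_mult_wave assms)

lemma fourier_L1_cmult: "fourier_L1 (\<lambda>x. c * u x) = (\<lambda>\<xi>. c * fourier_L1 u \<xi>)"
  by (rule ext) (simp add: fourier_L1_wave mult.assoc)

lemma real_eq_of_close:
  fixes a b C :: real
  assumes "\<And>e. 0 < e \<Longrightarrow> \<bar>a - b\<bar> \<le> C * e"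
  shows "a = b"
proof -
  have "(\<lambda>n. C * inverse (real (Suc n))) \<longlonglongrightarrow> 0"
    by (rule tendsto_mult_right_zero[OF LIMSEQ_inverse_real_of_nat])
  then have "\<bar>a - b\<bar> \<le> 0"
    by (rule LIMSEQ_le_const) (use assms in auto)
  then show ?thesis by simp
qed

text \<open>Both sides depend continuously on \<open>u\<close> in the square norm, by the inequality already known, and they agree on
  the dense set of continuous functions with compact support.\<close>
lemma plancherel_L1_L2:
  fixes u :: "real ^ 'd \<Rightarrow> complex"
  assumes u: "integrable lebesgue u" "u \<in> sq_int lebesgue"
  shows "norm2 lebesgue (fourier_L1 u) = sqrt ((2 * pi) ^ CARD('d)) * norm2 lebesgue u"
proof (rule real_eq_of_close)
  let ?C = "sqrt ((2 * pi) ^ CARD('d))"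
  have C0: "0 \<le> ?C" by simp
  fix e :: real assume e: "0 < e"
  obtain v where v: "v \<in> Cc" and vu: "norm2 lebesgue (\<lambda>x. v x - u x) < e"
    using Cc_dense[OF u(2) e] by blast
  note v' = Cc_integrable[OF v]
  have "\<bar>norm2 lebesgue (fourier_L1 u) - norm2 lebesgue (fourier_L1 v)\<bar>
      \<le> norm2 lebesgue (\<lambda>\<xi>. fourier_L1 u \<xi> - fourier_L1 v \<xi>)"
    by (intro norm2_reverse_triangle plancherel_le u v')
  also have "\<dots> = norm2 lebesgue (fourier_L1 (\<lambda>x. u x - v x))"
    by (simp add: fourier_L1_diff u v')
  also have "\<dots> \<le> ?C * norm2 lebesgue (\<lambda>x. u x - v x)"
    by (intro plancherel_le sq_int_diff Bochner_Integration.integrable_diff u v')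
  also have "\<dots> \<le> ?C * e"
    using vu by (intro mult_left_mono C0) (simp add: norm2_minus_commute[of _ v u])
  finally have 1: "\<bar>norm2 lebesgue (fourier_L1 u) - ?C * norm2 lebesgue v\<bar> \<le> ?C * e"
    by (simp only: plancherel_Cc[OF v])
  have "\<bar>?C * norm2 lebesgue v - ?C * norm2 lebesgue u\<bar> = ?C * \<bar>norm2 lebesgue v - norm2 lebesgue u\<bar>"
    by (simp only: right_diff_distrib[symmetric] abs_mult abs_of_nonneg[OF C0])
  also have "\<dots> \<le> ?C * e"
    using norm2_reverse_triangle[OF v'(2) u(2)] vu by (intro mult_left_mono C0) simp
  finally show "\<bar>norm2 lebesgue (fourier_L1 u) - ?C * norm2 lebesgue u\<bar> \<le> (2 * ?C) * e"
    using 1 by linarith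
qed

lemma is_fourier_L2I:
  assumes "f \<in> sq_int lebesgue" "g \<in> sq_int lebesgue"
    "\<And>n. integrable lebesgue (u n)" "\<And>n. u n \<in> sq_int lebesgue"
    "(\<lambda>n. norm2 lebesgue (\<lambda>x. u n x - f x)) \<longlonglongrightarrow> 0"
    "(\<lambda>n. norm2 lebesgue (\<lambda>\<xi>. fourier_L1 (u n) \<xi> - g \<xi>)) \<longlonglongrightarrow> 0"
  shows "is_fourier_L2 f g"
  unfolding is_fourier_L2_def L2_eq L2_norm_eq
  using assms plancherel_le(1)[OF assms(3,4)] by (intro conjI exI[of _ u]) auto

lemma is_fourier_L2E:
  assumes "is_fourier_L2 f g"
  obtains u where "f \<in> sq_int lebesgue" "g \<in> sq_int lebesgue"
    "\<And>n. integrable lebesgue (u n)" "\<And>n. u n \<in> sq_int lebesgue"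
    "(\<lambda>n. norm2 lebesgue (\<lambda>x. u n x - f x)) \<longlonglongrightarrow> 0"
    "(\<lambda>n. norm2 lebesgue (\<lambda>\<xi>. fourier_L1 (u n) \<xi> - g \<xi>)) \<longlonglongrightarrow> 0"
  using assms unfolding is_fourier_L2_def L2_eq L2_norm_eq by blast

lemma is_fourier_L2_sq_int:
  assumes "is_fourier_L2 f g"
  shows "f \<in> sq_int lebesgue" "g \<in> sq_int lebesgue"
  using assms by (auto simp: is_fourier_L2_def L2_eq)

lemma is_fourier_L2_norm:
  fixes f :: "real ^ 'd \<Rightarrow> complex"
  assumes "is_fourier_L2 f g"
  shows "norm2 lebesgue g = sqrt ((2 * pi) ^ CARD('d)) * norm2 lebesgue f"
proof -
  obtain u where u: "f \<in> sq_int lebesgue" "g \<in> sq_int lebesgue"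
    "\<And>n. integrable lebesgue (u n)" "\<And>n. u n \<in> sq_int lebesgue"
    "(\<lambda>n. norm2 lebesgue (\<lambda>x. u n x - f x)) \<longlonglongrightarrow> 0"
    "(\<lambda>n. norm2 lebesgue (\<lambda>\<xi>. fourier_L1 (u n) \<xi> - g \<xi>)) \<longlonglongrightarrow> 0"
    using assms by (rule is_fourier_L2E) blast
  have "(\<lambda>n. norm2 lebesgue (fourier_L1 (u n))) \<longlonglongrightarrow> norm2 lebesgue g"
    by (rule tendsto_norm2[OF plancherel_le(1)[OF u(3,4)] u(2,6)])
  moreover have "(\<lambda>n. norm2 lebesgue (fourier_L1 (u n))) \<longlonglongrightarrow> sqrt ((2 * pi) ^ CARD('d)) * norm2 lebesgue f"
    unfolding plancherel_L1_L2[OF u(3,4)]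
    by (rule tendsto_mult[OF tendsto_const tendsto_norm2[OF u(4,1,5)]])
  ultimately show ?thesis by (rule LIMSEQ_unique)
qed

lemma is_fourier_L2_add:
  assumes "is_fourier_L2 f g" "is_fourier_L2 f' g'"
  shows "is_fourier_L2 (\<lambda>x. f x + f' x) (\<lambda>\<xi>. g \<xi> + g' \<xi>)"
proof -
  obtain u where u: "f \<in> sq_int lebesgue" "g \<in> sq_int lebesgue"
    "\<And>n. integrable lebesgue (u n)" "\<And>n. u n \<in> sq_int lebesgue"
    "(\<lambda>n. norm2 lebesgue (\<lambda>x. u n x - f x)) \<longlonglongrightarrow> 0"
    "(\<lambda>n. norm2 lebesgue (\<lambda>\<xi>. fourier_L1 (u n) \<xi> - g \<xi>)) \<longlonglongrightarrow> 0"
    using assms(1) by (rule is_fourier_L2E) blast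
  obtain v where v: "f' \<in> sq_int lebesgue" "g' \<in> sq_int lebesgue"
    "\<And>n. integrable lebesgue (v n)" "\<And>n. v n \<in> sq_int lebesgue"
    "(\<lambda>n. norm2 lebesgue (\<lambda>x. v n x - f' x)) \<longlonglongrightarrow> 0"
    "(\<lambda>n. norm2 lebesgue (\<lambda>\<xi>. fourier_L1 (v n) \<xi> - g' \<xi>)) \<longlonglongrightarrow> 0"
    using assms(2) by (rule is_fourier_L2E) blast
  note F = plancherel_le(1)[OF u(3,4)] plancherel_le(1)[OF v(3,4)]
  have le: "norm2 lebesgue (\<lambda>x. (a x + b x) - (c x + d x))
      \<le> norm2 lebesgue (\<lambda>x. a x - c x) + norm2 lebesgue (\<lambda>x. b x - d x)"
    if "a \<in> sq_int lebesgue" "b \<in> sq_int lebesgue" "c \<in> sq_int lebesgue" "d \<in> sq_int lebesgue"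
    for a b c d :: "real ^ 'a \<Rightarrow> complex"
    using norm2_triangle[OF sq_int_diff[OF that(1,3)] sq_int_diff[OF that(2,4)]] by (simp add: algebra_simps)
  show ?thesis
  proof (rule is_fourier_L2I[where u="\<lambda>n x. u n x + v n x"])
    show "(\<lambda>n. norm2 lebesgue (\<lambda>x. u n x + v n x - (f x + f' x))) \<longlonglongrightarrow> 0"
      by (rule tendsto_of_norm_le[OF tendsto_add_zero[OF u(5) v(5)]]) (use le[OF u(4) v(4) u(1) v(1)] in simp)
    show "(\<lambda>n. norm2 lebesgue (\<lambda>\<xi>. fourier_L1 (\<lambda>x. u n x + v n x) \<xi> - (g \<xi> + g' \<xi>))) \<longlonglongrightarrow> 0"
      by (rule tendsto_of_norm_le[OF tendsto_add_zero[OF u(6) v(6)]])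
        (use le[OF F u(2) v(2)] in \<open>simp add: fourier_L1_add u(3) v(3)\<close>)
  qed (intro sq_int_add Bochner_Integration.integrable_add u v)+
qed

lemma is_fourier_L2_cmult:
  assumes "is_fourier_L2 f g"
  shows "is_fourier_L2 (\<lambda>x. c * f x) (\<lambda>\<xi>. c * g \<xi>)"
proof -
  obtain u where u: "f \<in> sq_int lebesgue" "g \<in> sq_int lebesgue"
    "\<And>n. integrable lebesgue (u n)" "\<And>n. u n \<in> sq_int lebesgue"
    "(\<lambda>n. norm2 lebesgue (\<lambda>x. u n x - f x)) \<longlonglongrightarrow> 0"
    "(\<lambda>n. norm2 lebesgue (\<lambda>\<xi>. fourier_L1 (u n) \<xi> - g \<xi>)) \<longlonglongrightarrow> 0"
    using assms(1) by (rule is_fourier_L2E) blast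
  show ?thesis
  proof (rule is_fourier_L2I[where u="\<lambda>n x. c * u n x"])
    show "(\<lambda>n. norm2 lebesgue (\<lambda>x. c * u n x - c * f x)) \<longlonglongrightarrow> 0"
      unfolding right_diff_distrib[symmetric] norm2_cmult by (rule tendsto_mult_right_zero[OF u(5)])
    show "(\<lambda>n. norm2 lebesgue (\<lambda>\<xi>. fourier_L1 (\<lambda>x. c * u n x) \<xi> - c * g \<xi>)) \<longlonglongrightarrow> 0"
      unfolding fourier_L1_cmult right_diff_distrib[symmetric] norm2_cmult by (rule tendsto_mult_right_zero[OF u(6)])
  qed (intro sq_int_cmult integrable_mult_right u)+
qed

lemma is_fourier_L2_diff:
  assumes "is_fourier_L2 f g" "is_fourier_L2 f' g'"
  shows "is_fourier_L2 (\<lambda>x. f x - f' x) (\<lambda>\<xi>. g \<xi> - g' \<xi>)"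
  using is_fourier_L2_add[OF assms(1) is_fourier_L2_cmult[OF assms(2), of "-1"]] by simp

lemma is_fourier_L2_0: "is_fourier_L2 (\<lambda>x. 0) (\<lambda>\<xi>. 0)"
  by (rule is_fourier_L2I[where u="\<lambda>n x. 0"]) (auto simp: fourier_L1_def norm2_def)

lemma is_fourier_L2_lincomb:
  assumes "\<And>i. i \<in> F \<Longrightarrow> is_fourier_L2 (h i) (g i)"
  shows "is_fourier_L2 (\<lambda>x. \<Sum>i\<in>F. c i * h i x) (\<lambda>\<xi>. \<Sum>i\<in>F. c i * g i \<xi>)"
  using assms
proof (induction F rule: infinite_finite_induct)
  case (insert i F)
  have "is_fourier_L2 (\<lambda>x. c i * h i x + (\<Sum>i\<in>F. c i * h i x)) (\<lambda>\<xi>. c i * g i \<xi> + (\<Sum>i\<in>F. c i * g i \<xi>))"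
    by (intro is_fourier_L2_add is_fourier_L2_cmult insert.IH insert.prems) auto
  then show ?case using insert.hyps by simp
qed (simp_all add: is_fourier_L2_0)

text \<open>The relation is an isometry up to a constant, so one difference is null exactly when the other is. This
  is both the well-definedness and the injectivity of the Fourier transform.\<close>
lemma is_fourier_L2_AE_iff:
  assumes "is_fourier_L2 f g" "is_fourier_L2 f' g'"
  shows "(AE x in lebesgue. f x = f' x) \<longleftrightarrow> (AE \<xi> in lebesgue. g \<xi> = g' \<xi>)"
proof -
  note d = is_fourier_L2_diff[OF assms]
  have "norm2 lebesgue (\<lambda>x. f x - f' x) = 0 \<longleftrightarrow> norm2 lebesgue (\<lambda>\<xi>. g \<xi> - g' \<xi>) = 0"
    using is_fourier_L2_norm[OF d] by simp
  then show ?thesis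
    unfolding norm2_eq_0_iff[OF is_fourier_L2_sq_int(1)[OF d]] norm2_eq_0_iff[OF is_fourier_L2_sq_int(2)[OF d]]
    by simp
qed

text \<open>The transforms of approximants with geometric rate form a Cauchy sequence of the same kind, by
  Plancherel's inequality.\<close>
lemma is_fourier_L2_exists:
  fixes f :: "real ^ 'd \<Rightarrow> complex"
  assumes f: "f \<in> sq_int lebesgue"
  shows "\<exists>g. is_fourier_L2 f g"
proof -
  have "\<forall>n. \<exists>v. v \<in> Cc \<and> norm2 lebesgue (\<lambda>x. v x - f x) < (1/2) ^ n"
  proof
    fix n
    have "0 < (1/2::real) ^ n" by simp
    from Cc_dense[OF f this] show "\<exists>v. v \<in> Cc \<and> norm2 lebesgue (\<lambda>x. v x - f x) < (1/2) ^ n" by blast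
  qed
  then obtain v where v: "\<And>n. v n \<in> Cc" and vf: "\<And>n. norm2 lebesgue (\<lambda>x. v n x - f x) < (1/2) ^ n"
    by metis
  note v1 = Cc_integrable(1)[OF v] and v2 = Cc_integrable(2)[OF v]
  let ?C = "sqrt ((2 * pi) ^ CARD('d))"
  have F: "fourier_L1 (v n) \<in> sq_int lebesgue" for n by (rule plancherel_le(1)[OF v1 v2])
  have step: "norm2 lebesgue (\<lambda>\<xi>. fourier_L1 (v (Suc n)) \<xi> - fourier_L1 (v n) \<xi>) \<le> (?C * 2) * (1/2) ^ n" for n
  proof -
    have "norm2 lebesgue (\<lambda>\<xi>. fourier_L1 (v (Suc n)) \<xi> - fourier_L1 (v n) \<xi>)
        = norm2 lebesgue (fourier_L1 (\<lambda>x. v (Suc n) x - v n x))"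
      by (simp add: fourier_L1_diff v1)
    also have "\<dots> \<le> ?C * norm2 lebesgue (\<lambda>x. v (Suc n) x - v n x)"
      by (intro plancherel_le sq_int_diff Bochner_Integration.integrable_diff v1 v2)
    also have "\<dots> \<le> ?C * (norm2 lebesgue (\<lambda>x. v (Suc n) x - f x) + norm2 lebesgue (\<lambda>x. f x - v n x))"
      by (intro mult_left_mono norm2_triangle_diff v2 f) simp
    also have "\<dots> \<le> ?C * ((1/2) ^ Suc n + (1/2) ^ n)"
      using vf[of n] vf[of "Suc n"] by (intro mult_left_mono add_mono) (auto simp: norm2_minus_commute[of _ f])
    also have "\<dots> \<le> ?C * (2 * (1/2) ^ n)" by (intro mult_left_mono) auto
    finally show ?thesis by simp
  qed
  define g where "g = (\<lambda>\<xi>. lim (\<lambda>n. fourier_L1 (v n) \<xi>))"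
  have g: "g \<in> sq_int lebesgue"
    "\<And>n. norm2 lebesgue (\<lambda>\<xi>. fourier_L1 (v n) \<xi> - g \<xi>) \<le> 2 * (?C * 2) * (1/2) ^ n"
    unfolding g_def by (rule sq_int_complete[OF F step])+
  have half: "(\<lambda>n. C * (1/2::real) ^ n) \<longlonglongrightarrow> 0" for C
    by (intro tendsto_mult_right_zero LIMSEQ_power_zero) simp
  have "is_fourier_L2 f g"
  proof (rule is_fourier_L2I[OF f g(1) v1 v2])
    show "(\<lambda>n. norm2 lebesgue (\<lambda>x. v n x - f x)) \<longlonglongrightarrow> 0"
      by (rule tendsto_of_norm_le[OF half[of 1]]) (use vf less_imp_le in auto)
    show "(\<lambda>n. norm2 lebesgue (\<lambda>\<xi>. fourier_L1 (v n) \<xi> - g \<xi>)) \<longlonglongrightarrow> 0"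
      by (rule tendsto_of_norm_le[OF half[of "2 * (?C * 2)"]]) (simp only: diff_0_right real_norm_def abs_of_nonneg[OF norm2_nonneg] g(2))
  qed
  then show ?thesis by blast
qed

lemma fourier_L2_is_fourier:
  assumes "f \<in> sq_int lebesgue"
  shows "is_fourier_L2 f (fourier_L2 f)"
  unfolding fourier_L2_def by (rule someI_ex[OF is_fourier_L2_exists[OF assms]])

lemma scales_lborel_translate: "scales_lborel (\<lambda>x::real ^ 'd. x - k) 1"
  using scales_lborel_affine[of "mat 1" k] by simp

lemma wave_measurable_lebesgue [measurable]: "wave k \<in> borel_measurable lebesgue"
  by (rule measurable_completion) measurable

lemma sq_int_wave_mult: "g \<in> sq_int lebesgue \<Longrightarrow> (\<lambda>\<xi>. wave k \<xi> * g \<xi>) \<in> sq_int lebesgue"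
  by (rule sq_int_bound[of g _ _ 1]) (use sq_int_meas[of g] in \<open>auto simp: norm_mult\<close>)

lemma norm2_wave_mult: "norm2 lebesgue (\<lambda>\<xi>. wave k \<xi> * g \<xi>) = norm2 lebesgue g"
  by (simp add: norm2_def norm_mult)

lemma is_fourier_L2_translate:
  fixes f :: "real ^ 'd \<Rightarrow> complex"
  assumes "is_fourier_L2 f g"
  shows "is_fourier_L2 (\<lambda>x. f (x - k)) (\<lambda>\<xi>. wave k \<xi> * g \<xi>)"
proof -
  obtain u where u: "f \<in> sq_int lebesgue" "g \<in> sq_int lebesgue"
    "\<And>n. integrable lebesgue (u n)" "\<And>n. u n \<in> sq_int lebesgue"
    "(\<lambda>n. norm2 lebesgue (\<lambda>x. u n x - f x)) \<longlonglongrightarrow> 0"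
    "(\<lambda>n. norm2 lebesgue (\<lambda>\<xi>. fourier_L1 (u n) \<xi> - g \<xi>)) \<longlonglongrightarrow> 0"
    using assms(1) by (rule is_fourier_L2E) blast
  note T = scales_lborel_translate[of k]
  have F: "fourier_L1 (\<lambda>x. v (x - k)) = (\<lambda>\<xi>. wave k \<xi> * fourier_L1 v \<xi>)"
    if "v \<in> borel_measurable lebesgue" for v :: "real ^ 'd \<Rightarrow> complex"
  proof
    fix \<xi>
    have "fourier_L1 (\<lambda>x. v (x - k)) \<xi> = (LINT x|lebesgue. v (x - k) * wave ((x - k) + k) \<xi>)"
      by (simp add: fourier_L1_wave)
    also have "\<dots> = (LINT x|lebesgue. v x * wave (x + k) \<xi>)"
      using scales_lborel_integral(2)[OF T, of "\<lambda>x. v x * wave (x + k) \<xi>"] that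
      by (simp add: wave_add)
    also have "\<dots> = wave k \<xi> * fourier_L1 v \<xi>"
      by (simp add: fourier_L1_wave wave_add mult_ac flip: integral_mult_right_zero)
    finally show "fourier_L1 (\<lambda>x. v (x - k)) \<xi> = wave k \<xi> * fourier_L1 v \<xi>" .
  qed
  show ?thesis
  proof (rule is_fourier_L2I[where u="\<lambda>n x. u n (x - k)"])
    show "integrable lebesgue (\<lambda>x. u n (x - k))" for n
      using scales_lborel_integral(1)[OF T borel_measurable_integrable[OF u(3)]] u(3) by simp
    show "(\<lambda>n. norm2 lebesgue (\<lambda>x. u n (x - k) - f (x - k))) \<longlonglongrightarrow> 0"
      using u(5) norm2_scales_lborel[OF T sq_int_meas[OF sq_int_diff[OF u(4,1)]]] by simp
    show "(\<lambda>n. norm2 lebesgue (\<lambda>\<xi>. fourier_L1 (\<lambda>x. u n (x - k)) \<xi> - wave k \<xi> * g \<xi>)) \<longlonglongrightarrow> 0"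
      using u(6) F[OF sq_int_meas[OF u(4)]] by (simp only: right_diff_distrib[symmetric] norm2_wave_mult)
  qed (intro sq_int_scales_lborel[OF T] sq_int_wave_mult u)+
qed

lemma scales_lborel_matrix:
  fixes A :: "real ^ 'd ^ 'd"
  assumes "invertible A"
  shows "scales_lborel ((*v) A) \<bar>det A\<bar>"
  using scales_lborel_affine[of A 0] assms by (simp add: invertible_det_nz)

lemma matrix_inv_cancel:
  fixes A :: "real ^ 'd ^ 'd"
  assumes "invertible A"
  shows "A ** matrix_inv A = mat 1" "matrix_inv A ** A = mat 1"
  using someI_ex[OF assms[unfolded invertible_def]] by (simp_all add: matrix_inv_def)

lemma wave_matrix: "wave (A *v x) \<xi> = wave x (transpose A *v \<xi>)"
proof -
  have "x \<bullet> (transpose A *v \<xi>) = (\<xi> v* A) \<bullet> x"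
    by (simp only: transpose_matrix_vector inner_commute[of x])
  also have "\<dots> = (A *v x) \<bullet> \<xi>"
    by (simp only: dot_lmul_matrix inner_commute[of \<xi>])
  finally show ?thesis by (simp only: wave_def)
qed

lemma is_fourier_L2_dilate:
  fixes f :: "real ^ 'd \<Rightarrow> complex"
  assumes A: "invertible A" and f: "is_fourier_L2 f g"
  shows "is_fourier_L2 (\<lambda>x. f (matrix_inv A *v x)) (\<lambda>\<xi>. complex_of_real \<bar>det A\<bar> * g (transpose A *v \<xi>))"
proof -
  obtain u where u: "f \<in> sq_int lebesgue" "g \<in> sq_int lebesgue"
    "\<And>n. integrable lebesgue (u n)" "\<And>n. u n \<in> sq_int lebesgue"
    "(\<lambda>n. norm2 lebesgue (\<lambda>x. u n x - f x)) \<longlonglongrightarrow> 0"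
    "(\<lambda>n. norm2 lebesgue (\<lambda>\<xi>. fourier_L1 (u n) \<xi> - g \<xi>)) \<longlonglongrightarrow> 0"
    using f by (rule is_fourier_L2E) blast
  define B where "B = matrix_inv A"
  have AB: "A ** B = mat 1" "B ** A = mat 1"
    unfolding B_def by (rule matrix_inv_cancel[OF A])+
  have Bi: "invertible B" using AB by (auto simp: invertible_def)
  have BA: "B *v (A *v x) = x" for x by (simp add: matrix_vector_mul_assoc AB)
  have Ai: "invertible (transpose A)"
    using A unfolding invertible_det_nz det_transpose .
  note TA = scales_lborel_matrix[OF A] and TB = scales_lborel_matrix[OF Bi] and TT = scales_lborel_matrix[OF Ai]
  have F: "fourier_L1 (\<lambda>x. v (B *v x)) = (\<lambda>\<xi>. complex_of_real \<bar>det A\<bar> * fourier_L1 v (transpose A *v \<xi>))"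
    if v: "v \<in> borel_measurable lebesgue" for v :: "real ^ 'd \<Rightarrow> complex"
  proof
    fix \<xi>
    have [measurable]: "(\<lambda>x. v (B *v x)) \<in> borel_measurable lebesgue"
      using scales_lborel_comp_measurable[OF TB v] .
    have "(\<lambda>x. v (B *v x) * wave x \<xi>) \<in> borel_measurable lebesgue" by measurable
    from scales_lborel_integral(2)[OF TA this]
    have "fourier_L1 (\<lambda>x. v (B *v x)) \<xi> = \<bar>det A\<bar> *\<^sub>R (LINT x|lebesgue. v (B *v (A *v x)) * wave (A *v x) \<xi>)"
      unfolding fourier_L1_wave .
    then show "fourier_L1 (\<lambda>x. v (B *v x)) \<xi> = complex_of_real \<bar>det A\<bar> * fourier_L1 v (transpose A *v \<xi>)"
      by (simp add: BA wave_matrix fourier_L1_wave scaleR_conv_of_real)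
  qed
  have tends: "(\<lambda>n. norm2 lebesgue (\<lambda>x. a n (T x) - b (T x))) \<longlonglongrightarrow> 0"
    if "\<And>n. a n \<in> sq_int lebesgue" "b \<in> sq_int lebesgue" "(\<lambda>n. norm2 lebesgue (\<lambda>x. a n x - b x)) \<longlonglongrightarrow> 0"
      "scales_lborel T c" for a b T and c :: real
    using norm2_scales_lborel[OF that(4) sq_int_meas[OF sq_int_diff[OF that(1,2)]]]
      tendsto_divide_zero[OF that(3)] by simp
  have "is_fourier_L2 (\<lambda>x. f (B *v x)) (\<lambda>\<xi>. complex_of_real \<bar>det A\<bar> * g (transpose A *v \<xi>))"
  proof (rule is_fourier_L2I[where u="\<lambda>n x. u n (B *v x)"])
    show "integrable lebesgue (\<lambda>x. u n (B *v x))" for n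
      using scales_lborel_integral(1)[OF TB borel_measurable_integrable[OF u(3)]] u(3) by simp
    show "(\<lambda>n. norm2 lebesgue (\<lambda>x. u n (B *v x) - f (B *v x))) \<longlonglongrightarrow> 0"
      by (rule tends[OF u(4,1,5) TB])
    show "(\<lambda>n. norm2 lebesgue (\<lambda>\<xi>. fourier_L1 (\<lambda>x. u n (B *v x)) \<xi> - complex_of_real \<bar>det A\<bar> * g (transpose A *v \<xi>))) \<longlonglongrightarrow> 0"
      unfolding F[OF sq_int_meas[OF u(4)]] right_diff_distrib[symmetric] norm2_cmult
      by (intro tendsto_mult_right_zero tends[OF plancherel_le(1)[OF u(3,4)] u(2,6) TT])
    show "(\<lambda>x. f (B *v x)) \<in> sq_int lebesgue" "(\<lambda>x. u n (B *v x)) \<in> sq_int lebesgue" for n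
      by (rule sq_int_scales_lborel[OF TB] u)+
    show "(\<lambda>\<xi>. complex_of_real \<bar>det A\<bar> * g (transpose A *v \<xi>)) \<in> sq_int lebesgue"
      by (intro sq_int_cmult sq_int_scales_lborel[OF TT] u)
  qed
  then show ?thesis by (simp add: B_def)
qed

section \<open>Projections, Riesz bases and biorthogonal systems\<close>

definition lincombs :: "'i set \<Rightarrow> ('i \<Rightarrow> 'a \<Rightarrow> complex) \<Rightarrow> ('a \<Rightarrow> complex) set" where
  "lincombs I h = {g. \<exists>F c. finite F \<and> F \<subseteq> I \<and> g = (\<lambda>x. \<Sum>i\<in>F. c i * h i x)}"

lemma lincombsI: "finite F \<Longrightarrow> F \<subseteq> I \<Longrightarrow> (\<lambda>x. \<Sum>i\<in>F. c i * h i x) \<in> lincombs I h"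
  unfolding lincombs_def by blast

lemma lincombsE:
  assumes "g \<in> lincombs I h"
  obtains F c where "finite F" "F \<subseteq> I" "g = (\<lambda>x. \<Sum>i\<in>F. c i * h i x)"
  using assms unfolding lincombs_def by blast

lemma lincombs_base: "i \<in> I \<Longrightarrow> h i \<in> lincombs I h"
  using lincombsI[of "{i}" I "\<lambda>_. 1" h] by simp

lemma lincombs_cmult:
  assumes "g \<in> lincombs I h"
  shows "(\<lambda>x. a * g x) \<in> lincombs I h"
proof -
  obtain F c where F: "finite F" "F \<subseteq> I" "g = (\<lambda>x. \<Sum>i\<in>F. c i * h i x)"
    using assms by (rule lincombsE)
  have "(\<lambda>x. a * g x) = (\<lambda>x. \<Sum>i\<in>F. (a * c i) * h i x)"
    by (simp add: F(3) sum_distrib_left mult.assoc)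
  then show ?thesis using lincombsI[OF F(1,2)] by simp
qed

lemma sum_extend_zero:
  fixes h :: "'i \<Rightarrow> 'b::semiring_0"
  assumes "finite G" "F \<subseteq> G"
  shows "(\<Sum>i\<in>F. c i * h i) = (\<Sum>i\<in>G. (if i \<in> F then c i else 0) * h i)"
  using assms by (intro sum.mono_neutral_cong_left) auto

lemma lincombs_add:
  assumes "g \<in> lincombs I h" "g' \<in> lincombs I h"
  shows "(\<lambda>x. g x + g' x) \<in> lincombs I h"
proof -
  obtain F c where F: "finite F" "F \<subseteq> I" "g = (\<lambda>x. \<Sum>i\<in>F. c i * h i x)"
    using assms(1) by (rule lincombsE)
  obtain F' c' where F': "finite F'" "F' \<subseteq> I" "g' = (\<lambda>x. \<Sum>i\<in>F'. c' i * h i x)"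
    using assms(2) by (rule lincombsE)
  let ?G = "F \<union> F'"
  have "(\<lambda>x. g x + g' x) = (\<lambda>x. \<Sum>i\<in>?G. ((if i \<in> F then c i else 0) + (if i \<in> F' then c' i else 0)) * h i x)"
    unfolding F(3) F'(3) distrib_right sum.distrib
    using F(1) F'(1) by (subst (1 2) sum_extend_zero[of ?G]) auto
  then show ?thesis using lincombsI[of ?G I _ h] F F' by simp
qed

lemma lincombs_0: "(\<lambda>x. 0) \<in> lincombs I h"
  using lincombsI[of "{}" I] by simp

lemma lincombs_sum:
  "(\<And>i. i \<in> F \<Longrightarrow> f i \<in> lincombs I h) \<Longrightarrow> (\<lambda>x. \<Sum>i\<in>F. f i x) \<in> lincombs I h"
  by (induction F rule: infinite_finite_induct) (auto intro: lincombs_add lincombs_0)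

lemma lincombs_sq_int:
  assumes "\<And>i. i \<in> I \<Longrightarrow> h i \<in> sq_int M" "g \<in> lincombs I h"
  shows "g \<in> sq_int M"
  using assms(2) by (rule lincombsE) (use assms(1) in \<open>auto intro: sq_int_lincomb\<close>)

lemma tendsto_half_geometric: "(\<lambda>n. C * (1/2::real) ^ n) \<longlonglongrightarrow> 0"
  by (intro tendsto_mult_right_zero LIMSEQ_power_zero) simp

lemma tendsto_of_geometric:
  assumes "\<And>n. norm2 M (\<lambda>x. u n x - f x) \<le> C * (1/2) ^ n"
  shows "(\<lambda>n. norm2 M (\<lambda>x. u n x - f x)) \<longlonglongrightarrow> 0"
  by (rule tendsto_of_norm_le[OF tendsto_half_geometric[of C]])
    (simp only: diff_0_right real_norm_def abs_of_nonneg[OF norm2_nonneg] assms)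

text \<open>If the inner product \<open>p\<close> did not vanish, moving \<open>v\<close> by a small multiple of \<open>- p s\<close> would decrease the norm to
  first order.\<close>
lemma ip2_eq_0_of_minimal:
  assumes v: "v \<in> sq_int M" and s: "s \<in> sq_int M"
    and min: "\<And>t. norm2 M v \<le> norm2 M (\<lambda>x. v x + t * s x)"
  shows "ip2 M v s = 0"
proof (rule ccontr)
  define p where "p = ip2 M v s"
  \<comment> \<open>Any \<open>e > 0\<close> with \<open>e * (norm2 M s)\<^sup>2 < 2\<close> would do; the summand \<open>1\<close> covers \<open>s = 0\<close>.\<close>
  define e where "e = 1 / ((norm2 M s)\<^sup>2 + 1)"
  define t where "t = - (complex_of_real e * p)"
  assume "ip2 M v s \<noteq> 0"
  then have p: "0 < (cmod p)\<^sup>2" by (simp add: p_def)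
  have q: "0 < (norm2 M s)\<^sup>2 + 1" by (simp add: add_nonneg_pos)
  have e: "0 < e" "e * (norm2 M s)\<^sup>2 < 1"
    using q by (auto simp: e_def field_simps)
  have "(norm2 M v)\<^sup>2 \<le> (norm2 M (\<lambda>x. v x + t * s x))\<^sup>2"
    by (intro power_mono min norm2_nonneg)
  also have "\<dots> = (norm2 M v)\<^sup>2 + 2 * Re (cnj t * p) + (cmod t * norm2 M s)\<^sup>2"
    unfolding norm2_add_sq[OF v sq_int_cmult[OF s]] ip2_cmult_right norm2_cmult p_def ..
  also have "Re (cnj t * p) = - (e * (cmod p)\<^sup>2)"
  proof -
    have "cnj t * p = - (complex_of_real e * (p * cnj p))" by (simp add: t_def)
    also have "\<dots> = complex_of_real (- (e * (cmod p)\<^sup>2))"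
      by (simp only: complex_norm_square[symmetric] of_real_minus of_real_mult)
    finally show ?thesis by (simp only: Re_complex_of_real)
  qed
  also have "(cmod t * norm2 M s)\<^sup>2 = e * (cmod p)\<^sup>2 * (e * (norm2 M s)\<^sup>2)"
    using e(1) by (simp add: t_def norm_mult power_mult_distrib power2_eq_square)
  finally have "2 * (e * (cmod p)\<^sup>2) \<le> e * (cmod p)\<^sup>2 * (e * (norm2 M s)\<^sup>2)" by simp
  also have "\<dots> < e * (cmod p)\<^sup>2 * 2"
    using e p by (intro mult_strict_left_mono mult_pos_pos) auto
  finally show False by simp
qed

text \<open>A separating functional for the subspace \<open>S\<close>. A sequence in \<open>f - S\<close> with norms tending to the distance is
  Cauchy by the parallelogram law, its limit \<open>v\<close> is orthogonal to \<open>S\<close> by minimality, and \<open>f\<close> has inner product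
  with \<open>v\<close> equal to the squared distance, which is positive and can be normalised to \<open>1\<close>.\<close>
lemma orthogonal_complement_vector:
  assumes S: "\<And>s. s \<in> S \<Longrightarrow> s \<in> sq_int M" and S0: "(\<lambda>x. 0) \<in> S"
    and add: "\<And>s s'. s \<in> S \<Longrightarrow> s' \<in> S \<Longrightarrow> (\<lambda>x. s x + s' x) \<in> S"
    and cmult: "\<And>s a. s \<in> S \<Longrightarrow> (\<lambda>x. a * s x) \<in> S"
    and f: "f \<in> sq_int M" and \<delta>: "0 < \<delta>" and dist: "\<And>s. s \<in> S \<Longrightarrow> \<delta> \<le> norm2 M (\<lambda>x. f x - s x)"
  obtains v where "v \<in> sq_int M" "\<And>s. s \<in> S \<Longrightarrow> ip2 M s v = 0" "ip2 M f v = 1"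
proof -
  define D where "D = (\<lambda>s. (norm2 M (\<lambda>x. f x - s x))\<^sup>2) ` S"
  define d where "d = Inf D"
  have D: "D \<noteq> {}" "bdd_below D" using S0 by (auto simp: D_def intro!: bdd_belowI[of _ 0])
  have dle: "d \<le> (norm2 M (\<lambda>x. f x - s x))\<^sup>2" if "s \<in> S" for s
    unfolding d_def by (rule cInf_lower[OF _ D(2)]) (use that in \<open>auto simp: D_def\<close>)
  have d0: "\<delta>\<^sup>2 \<le> d"
    unfolding d_def by (rule cInf_greatest[OF D(1)]) (use dist \<delta> in \<open>auto simp: D_def intro!: power_mono\<close>)
  \<comment> \<open>An excess of \<open>(1/4) ^ n\<close> in the squared norm puts consecutive terms within \<open>2 * (1/2) ^ n\<close>.\<close>
  have "\<forall>n. \<exists>s. s \<in> S \<and> (norm2 M (\<lambda>x. f x - s x))\<^sup>2 < d + (1/4) ^ n"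
  proof
    fix n
    have "Inf D < d + (1/4) ^ n" by (simp add: d_def)
    then show "\<exists>s. s \<in> S \<and> (norm2 M (\<lambda>x. f x - s x))\<^sup>2 < d + (1/4) ^ n"
      using cInf_lessD[OF D(1)] by (auto simp: D_def)
  qed
  then obtain s where s: "\<And>n. s n \<in> S" and sd: "\<And>n. (norm2 M (\<lambda>x. f x - s n x))\<^sup>2 < d + (1/4) ^ n"
    by metis
  define u where "u = (\<lambda>n x. f x - s n x)"
  have u: "u n \<in> sq_int M" for n unfolding u_def by (intro sq_int_diff f S s)
  have step: "norm2 M (\<lambda>x. u (Suc n) x - u n x) \<le> 2 * (1/2) ^ n" for n
  proof (rule power2_le_imp_le)
    have "(norm2 M (\<lambda>x. u (Suc n) x + u n x))\<^sup>2 = 4 * (norm2 M (\<lambda>x. f x - (1/2) * (s (Suc n) x + s n x)))\<^sup>2"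
    proof -
      have "(\<lambda>x. u (Suc n) x + u n x) = (\<lambda>x. 2 * (f x - (1/2) * (s (Suc n) x + s n x)))"
        by (simp add: u_def fun_eq_iff algebra_simps)
      then show ?thesis by (simp only: norm2_cmult power_mult_distrib) simp
    qed
    also have "\<dots> \<ge> 4 * d"
      by (intro mult_left_mono dle cmult add s) simp
    finally have "(norm2 M (\<lambda>x. u (Suc n) x - u n x))\<^sup>2
        \<le> 2 * (norm2 M (u (Suc n)))\<^sup>2 + 2 * (norm2 M (u n))\<^sup>2 - 4 * d"
      using parallelogram_norm2[OF u[of "Suc n"] u[of n]] by linarith
    also have "\<dots> \<le> 2 * (1/4) ^ Suc n + 2 * (1/4) ^ n"
      using sd[of n] sd[of "Suc n"] unfolding u_def by linarith
    also have "\<dots> \<le> 4 * (1/4) ^ n" by simp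
    also have "\<dots> = (2 * (1/2) ^ n)\<^sup>2"
      by (simp add: power_mult_distrib power_even_eq[symmetric] power_mult[symmetric] mult.commute power2_eq_square power_divide flip: power_mult)
        (simp add: power_mult power2_eq_square mult.commute flip: power_mult_distrib)
    finally show "(norm2 M (\<lambda>x. u (Suc n) x - u n x))\<^sup>2 \<le> (2 * (1/2) ^ n)\<^sup>2" .
  qed simp
  define v where "v = (\<lambda>x. lim (\<lambda>n. u n x))"
  have v: "v \<in> sq_int M" unfolding v_def by (rule sq_int_lim[OF u step])
  have "norm2 M (\<lambda>x. u n x - v x) \<le> (2 * 2) * (1/2) ^ n" for n
    unfolding v_def by (rule norm2_lim_le[OF u step])
  then have uv: "(\<lambda>n. norm2 M (\<lambda>x. u n x - v x)) \<longlonglongrightarrow> 0" by (rule tendsto_of_geometric)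
  have lim_norm: "(\<lambda>n. norm2 M (u n)) \<longlonglongrightarrow> norm2 M v" by (rule tendsto_norm2[OF u v uv])
  have "(norm2 M v)\<^sup>2 \<le> d"
  proof (rule LIMSEQ_le)
    show "(\<lambda>n. (norm2 M (u n))\<^sup>2) \<longlonglongrightarrow> (norm2 M v)\<^sup>2" by (intro tendsto_power lim_norm)
    have "(\<lambda>n. d + (1/4) ^ n) \<longlonglongrightarrow> d + 0"
      by (intro tendsto_add tendsto_const LIMSEQ_power_zero) simp
    then show "(\<lambda>n. d + (1/4) ^ n) \<longlonglongrightarrow> d" by simp
    show "\<exists>N. \<forall>n\<ge>N. (norm2 M (u n))\<^sup>2 \<le> d + (1/4) ^ n"
      using sd less_imp_le unfolding u_def by blast
  qed
  moreover have "d \<le> (norm2 M (\<lambda>x. v x + t * g x))\<^sup>2" if g: "g \<in> S" for g t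
  proof (rule LIMSEQ_le_const)
    have "(\<lambda>n. norm2 M (\<lambda>x. (u n x + t * g x) - (v x + t * g x))) \<longlonglongrightarrow> 0" using uv by simp
    then show "(\<lambda>n. (norm2 M (\<lambda>x. u n x + t * g x))\<^sup>2) \<longlonglongrightarrow> (norm2 M (\<lambda>x. v x + t * g x))\<^sup>2"
      by (intro tendsto_power tendsto_norm2 sq_int_add u v sq_int_cmult S g)
    have "d \<le> (norm2 M (\<lambda>x. u n x + t * g x))\<^sup>2" for n
    proof -
      have "(\<lambda>x. s n x + (- t) * g x) \<in> S" by (intro add cmult s g)
      from dle[OF this] show ?thesis by (simp add: u_def algebra_simps)
    qed
    then show "\<exists>N. \<forall>n\<ge>N. d \<le> (norm2 M (\<lambda>x. u n x + t * g x))\<^sup>2" by blast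
  qed
  ultimately have "norm2 M v \<le> norm2 M (\<lambda>x. v x + t * g x)" if "g \<in> S" for g t
    using that by (meson norm2_nonneg order_trans power2_le_imp_le)
  then have orth: "ip2 M v g = 0" if "g \<in> S" for g
    using that by (intro ip2_eq_0_of_minimal[OF v S]) auto
  then have orth': "ip2 M g v = 0" if "g \<in> S" for g
    using that ip2_cnj[of M g v] by simp
  have "(\<lambda>n. ip2 M (u n) v) \<longlonglongrightarrow> ip2 M v v" by (rule tendsto_ip2_left[OF u v v uv])
  moreover have "ip2 M (u n) v = ip2 M f v" for n
    unfolding u_def by (subst ip2_diff_left[OF f S[OF s] v]) (simp add: orth'[OF s])
  ultimately have "ip2 M f v = ip2 M v v" using LIMSEQ_const_iff by auto
  then have fv: "ip2 M f v = complex_of_real ((norm2 M v)\<^sup>2)" by (simp only: ip2_self)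
  have "d \<le> (norm2 M v)\<^sup>2"
    by (rule LIMSEQ_le_const[OF tendsto_power[OF lim_norm]]) (use dle[OF s] in \<open>auto simp: u_def\<close>)
  then have pos: "0 < (norm2 M v)\<^sup>2" using d0 \<delta> by (smt (verit) zero_less_power)
  show thesis
  proof
    show "(\<lambda>x. complex_of_real (1 / (norm2 M v)\<^sup>2) * v x) \<in> sq_int M" by (rule sq_int_cmult[OF v])
    show "ip2 M f (\<lambda>x. complex_of_real (1 / (norm2 M v)\<^sup>2) * v x) = 1"
      unfolding ip2_cmult_right fv using pos by (simp flip: of_real_mult)
    show "ip2 M s (\<lambda>x. complex_of_real (1 / (norm2 M v)\<^sup>2) * v x) = 0" if "s \<in> S" for s
      unfolding ip2_cmult_right orth'[OF that] by simp
  qed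
qed

lemma riesz_basisE:
  fixes h :: "'i \<Rightarrow> real ^ 'd \<Rightarrow> complex"
  assumes "riesz_basis I h"
  obtains C3 C4 where "\<And>i. i \<in> I \<Longrightarrow> h i \<in> sq_int lebesgue"
    "\<And>f e. f \<in> sq_int lebesgue \<Longrightarrow> 0 < e \<Longrightarrow> \<exists>g\<in>lincombs I h. norm2 lebesgue (\<lambda>x. f x - g x) < e"
    "0 < C3" "0 < C4"
    "\<And>F c. finite F \<Longrightarrow> F \<subseteq> I \<Longrightarrow> C3 * (\<Sum>i\<in>F. (cmod (c i))\<^sup>2) \<le> (norm2 lebesgue (\<lambda>x. \<Sum>i\<in>F. c i * h i x))\<^sup>2"
    "\<And>F c. finite F \<Longrightarrow> F \<subseteq> I \<Longrightarrow> (norm2 lebesgue (\<lambda>x. \<Sum>i\<in>F. c i * h i x))\<^sup>2 \<le> C4 * (\<Sum>i\<in>F. (cmod (c i))\<^sup>2)"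
proof -
  note A = assms[unfolded riesz_basis_def L2_eq L2_norm_eq]
  note 1 = A[THEN conjunct1] and 2 = A[THEN conjunct2, THEN conjunct1] and 3 = A[THEN conjunct2, THEN conjunct2]
  from 3 obtain C3 C4 where C: "0 < C3" "0 < C4"
    "\<forall>F c. finite F \<longrightarrow> F \<subseteq> I \<longrightarrow>
        C3 * (\<Sum>i\<in>F. (cmod (c i))\<^sup>2) \<le> (norm2 lebesgue (\<lambda>x. \<Sum>i\<in>F. c i * h i x))\<^sup>2
      \<and> (norm2 lebesgue (\<lambda>x. \<Sum>i\<in>F. c i * h i x))\<^sup>2 \<le> C4 * (\<Sum>i\<in>F. (cmod (c i))\<^sup>2)"
    by (elim exE conjE) (rule that)
  show thesis
  proof (rule that[OF _ _ C(1,2)])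
    show "h i \<in> sq_int lebesgue" if "i \<in> I" for i using 1 that by (rule bspec)
    show "\<exists>g\<in>lincombs I h. norm2 lebesgue (\<lambda>x. f x - g x) < e" if fe: "f \<in> sq_int lebesgue" "0 < e" for f and e :: real
    proof -
      from 2[rule_format, OF fe] obtain F c where "finite F" "F \<subseteq> I" "norm2 lebesgue (\<lambda>x. f x - (\<Sum>i\<in>F. c i * h i x)) < e"
        by (elim exE conjE) (rule that)
      then show ?thesis by (intro bexI[OF _ lincombsI])
    qed
    show "C3 * (\<Sum>i\<in>F. (cmod (c i))\<^sup>2) \<le> (norm2 lebesgue (\<lambda>x. \<Sum>i\<in>F. c i * h i x))\<^sup>2"
      "(norm2 lebesgue (\<lambda>x. \<Sum>i\<in>F. c i * h i x))\<^sup>2 \<le> C4 * (\<Sum>i\<in>F. (cmod (c i))\<^sup>2)"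
      if "finite F" "F \<subseteq> I" for F c
      using C(3)[rule_format, OF that, of c] by (rule conjunct1, rule conjunct2)
  qed
qed

lemma riesz_basisI:
  fixes h :: "'i \<Rightarrow> real ^ 'd \<Rightarrow> complex"
  assumes "\<And>i. i \<in> I \<Longrightarrow> h i \<in> sq_int lebesgue"
    "\<And>f e. f \<in> sq_int lebesgue \<Longrightarrow> 0 < e \<Longrightarrow> \<exists>g\<in>lincombs I h. norm2 lebesgue (\<lambda>x. f x - g x) < e"
    "0 < C3" "0 < C4"
    "\<And>F c. finite F \<Longrightarrow> F \<subseteq> I \<Longrightarrow> C3 * (\<Sum>i\<in>F. (cmod (c i))\<^sup>2) \<le> (norm2 lebesgue (\<lambda>x. \<Sum>i\<in>F. c i * h i x))\<^sup>2"
    "\<And>F c. finite F \<Longrightarrow> F \<subseteq> I \<Longrightarrow> (norm2 lebesgue (\<lambda>x. \<Sum>i\<in>F. c i * h i x))\<^sup>2 \<le> C4 * (\<Sum>i\<in>F. (cmod (c i))\<^sup>2)"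
  shows "riesz_basis I h"
  unfolding riesz_basis_def L2_norm_eq L2_eq
proof (intro conjI ballI allI impI)
  fix f :: "real ^ 'd \<Rightarrow> complex" and e :: real assume "f \<in> sq_int lebesgue" "0 < e"
  then obtain g where g: "g \<in> lincombs I h" "norm2 lebesgue (\<lambda>x. f x - g x) < e" using assms(2) by blast
  from g(1) obtain F c where F: "finite F" "F \<subseteq> I" "g = (\<lambda>x. \<Sum>i\<in>F. c i * h i x)" by (rule lincombsE)
  show "\<exists>F c. finite F \<and> F \<subseteq> I \<and> norm2 lebesgue (\<lambda>x. f x - (\<Sum>i\<in>F. c i * h i x)) < e"
    using F(1,2) g(2)[unfolded F(3)] by (intro exI conjI)
next
  show "\<exists>C3>0. \<exists>C4>0. \<forall>F c. finite F \<longrightarrow> F \<subseteq> I \<longrightarrow>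
        C3 * (\<Sum>i\<in>F. (cmod (c i))\<^sup>2) \<le> (norm2 lebesgue (\<lambda>x. \<Sum>i\<in>F. c i * h i x))\<^sup>2
      \<and> (norm2 lebesgue (\<lambda>x. \<Sum>i\<in>F. c i * h i x))\<^sup>2 \<le> C4 * (\<Sum>i\<in>F. (cmod (c i))\<^sup>2)"
    by (intro exI[of _ C3] exI[of _ C4] conjI allI impI assms(3-6))
qed (rule assms(1))

text \<open>The upper Riesz bound applied to the combination of the \<open>h i\<close> whose coefficients are the inner products
  themselves, together with Cauchy--Schwarz.\<close>
lemma bessel_inequality:
  fixes c :: "'i \<Rightarrow> complex"
  assumes h: "\<And>i. i \<in> F \<Longrightarrow> h i \<in> sq_int M" and f: "f \<in> sq_int M"
    and C: "0 \<le> C" and upper: "\<And>c. (norm2 M (\<lambda>x. \<Sum>i\<in>F. c i * h i x))\<^sup>2 \<le> C * (\<Sum>i\<in>F. (cmod (c i))\<^sup>2)"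
  shows "(\<Sum>i\<in>F. (cmod (ip2 M f (h i)))\<^sup>2) \<le> C * (norm2 M f)\<^sup>2"
proof -
  define c where "c = (\<lambda>i. ip2 M f (h i))"
  define S where "S = (\<Sum>i\<in>F. (cmod (c i))\<^sup>2)"
  have S0: "0 \<le> S" by (simp add: S_def sum_nonneg)
  have "complex_of_real S = ip2 M f (\<lambda>x. \<Sum>i\<in>F. c i * h i x)"
    by (subst ip2_sum_right[OF h f]) (simp_all add: S_def c_def complex_norm_square mult.commute del: of_real_power)
  then have "S \<le> norm2 M f * norm2 M (\<lambda>x. \<Sum>i\<in>F. c i * h i x)"
    using Cauchy_Schwarz_ip2[OF f sq_int_lincomb[of F h M c, OF h]] S0 by (metis abs_of_nonneg norm_of_real)
  then have "S\<^sup>2 \<le> (norm2 M f * norm2 M (\<lambda>x. \<Sum>i\<in>F. c i * h i x))\<^sup>2"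
    using S0 by (intro power_mono)
  also have "\<dots> \<le> (norm2 M f)\<^sup>2 * (C * S)"
    unfolding power_mult_distrib S_def by (intro mult_left_mono upper) simp
  finally have "S * S \<le> (C * (norm2 M f)\<^sup>2) * S" by (simp add: power2_eq_square mult_ac)
  then have "S \<le> C * (norm2 M f)\<^sup>2"
    using S0 C by (cases "S = 0") (auto simp: mult_le_cancel_right)
  then show ?thesis by (simp add: S_def c_def)
qed

lemma sum_mult_le_sqrt:
  fixes a b :: "'i \<Rightarrow> complex"
  shows "cmod (\<Sum>i\<in>F. a i * b i) \<le> sqrt (\<Sum>i\<in>F. (cmod (a i))\<^sup>2) * sqrt (\<Sum>i\<in>F. (cmod (b i))\<^sup>2)"
proof -
  have "cmod (\<Sum>i\<in>F. a i * b i) \<le> (\<Sum>i\<in>F. cmod (a i * b i))" by (rule norm_sum)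
  also have "\<dots> \<le> L2_set (\<lambda>i. cmod (a i)) F * L2_set (\<lambda>i. cmod (b i)) F"
    using L2_set_mult_ineq[of "\<lambda>i. cmod (a i)" "\<lambda>i. cmod (b i)" F] by (simp add: norm_mult)
  finally show ?thesis by (simp add: L2_set_def)
qed

text \<open>In \<open>h i\<close> minus a combination of the other vectors the coefficient of \<open>h i\<close> is \<open>1\<close>, so the lower Riesz bound
  keeps \<open>h i\<close> at distance at least \<open>sqrt C3\<close> from their span.\<close>
lemma dual_vector_exists:
  fixes h :: "'i \<Rightarrow> real ^ 'd \<Rightarrow> complex"
  assumes R: "riesz_basis I h" and i: "i \<in> I"
  obtains v where "v \<in> sq_int lebesgue" "\<And>j. j \<in> I \<Longrightarrow> ip2 lebesgue (h j) v = of_bool (j = i)"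
proof -
  obtain C3 C4 where h: "\<And>i. i \<in> I \<Longrightarrow> h i \<in> sq_int lebesgue" and C3: "0 < C3"
    and lower: "\<And>F c. finite F \<Longrightarrow> F \<subseteq> I \<Longrightarrow> C3 * (\<Sum>i\<in>F. (cmod (c i))\<^sup>2) \<le> (norm2 lebesgue (\<lambda>x. \<Sum>i\<in>F. c i * h i x))\<^sup>2"
    using R by (rule riesz_basisE) blast
  have dist: "sqrt C3 \<le> norm2 lebesgue (\<lambda>x. h i x - s x)" if s: "s \<in> lincombs (I - {i}) h" for s
  proof -
    obtain F c where F: "finite F" "F \<subseteq> I - {i}" "s = (\<lambda>x. \<Sum>j\<in>F. c j * h j x)"
      using s by (rule lincombsE)
    define c' where "c' = (\<lambda>j. if j = i then 1 else - c j)"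
    have iF: "i \<notin> F" using F(2) by blast
    have eq: "(\<lambda>x. \<Sum>j\<in>insert i F. c' j * h j x) = (\<lambda>x. h i x - s x)"
    proof
      fix x
      have "(\<Sum>j\<in>F. c' j * h j x) = (\<Sum>j\<in>F. - (c j * h j x))"
        using iF by (intro sum.cong) (auto simp: c'_def)
      then show "(\<Sum>j\<in>insert i F. c' j * h j x) = h i x - s x"
        using F(1) iF by (simp add: F(3) sum_negf) (simp add: c'_def)
    qed
    have "C3 * 1 \<le> C3 * (\<Sum>j\<in>insert i F. (cmod (c' j))\<^sup>2)"
      using C3 F(1) iF by (intro mult_left_mono) (auto simp: c'_def sum_nonneg)
    also have "\<dots> \<le> (norm2 lebesgue (\<lambda>x. h i x - s x))\<^sup>2"
      using lower[of "insert i F" c'] F i unfolding eq by auto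
    finally show ?thesis by (simp add: real_le_lsqrt)
  qed
  obtain v where v: "v \<in> sq_int lebesgue" "\<And>s. s \<in> lincombs (I - {i}) h \<Longrightarrow> ip2 lebesgue s v = 0"
    "ip2 lebesgue (h i) v = 1"
  proof (rule orthogonal_complement_vector[of "lincombs (I - {i}) h" lebesgue "h i" "sqrt C3"])
    show "s \<in> sq_int lebesgue" if "s \<in> lincombs (I - {i}) h" for s
      by (rule lincombs_sq_int[OF _ that]) (use h in auto)
  qed (use i C3 dist in \<open>auto intro: lincombs_0 lincombs_add lincombs_cmult h\<close>)
  show thesis
  proof (rule that[OF v(1)])
    fix j assume j: "j \<in> I"
    show "ip2 lebesgue (h j) v = of_bool (j = i)"
    proof (cases "j = i")
      case False
      then have "h j \<in> lincombs (I - {i}) h" using j by (intro lincombs_base) auto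
      then show ?thesis using v(2) False by simp
    qed (use v(3) in simp)
  qed
qed

text \<open>The norm of \<open>w\<close> is determined by its inner products with the combinations of the \<open>h i\<close>, since these are
  dense; the lower Riesz bound controls the coefficients by the norm of the combination.\<close>
lemma norm2_le_of_coefficients:
  fixes h :: "'i \<Rightarrow> real ^ 'd \<Rightarrow> complex"
  assumes h: "\<And>i. i \<in> I \<Longrightarrow> h i \<in> sq_int lebesgue"
    and dense: "\<And>f e. f \<in> sq_int lebesgue \<Longrightarrow> 0 < e \<Longrightarrow> \<exists>g\<in>lincombs I h. norm2 lebesgue (\<lambda>x. f x - g x) < e"
    and C3: "0 < C3"
    and lower: "\<And>F c. finite F \<Longrightarrow> F \<subseteq> I \<Longrightarrow> C3 * (\<Sum>i\<in>F. (cmod (c i))\<^sup>2) \<le> (norm2 lebesgue (\<lambda>x. \<Sum>i\<in>F. c i * h i x))\<^sup>2"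
    and w: "w \<in> sq_int lebesgue" and B: "0 \<le> B"
    and le: "\<And>F c. finite F \<Longrightarrow> F \<subseteq> I \<Longrightarrow> cmod (ip2 lebesgue (\<lambda>x. \<Sum>i\<in>F. c i * h i x) w) \<le> B * sqrt (\<Sum>i\<in>F. (cmod (c i))\<^sup>2)"
  shows "norm2 lebesgue w \<le> B / sqrt C3"
proof -
  have bound: "cmod (ip2 lebesgue g w) \<le> (B / sqrt C3) * norm2 lebesgue g" if g: "g \<in> lincombs I h" for g
  proof -
    obtain F c where F: "finite F" "F \<subseteq> I" "g = (\<lambda>x. \<Sum>i\<in>F. c i * h i x)"
      using g by (rule lincombsE)
    have "sqrt (C3 * (\<Sum>i\<in>F. (cmod (c i))\<^sup>2)) \<le> sqrt ((norm2 lebesgue g)\<^sup>2)"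
      unfolding F(3) by (intro real_sqrt_le_mono lower F)
    then have "sqrt (\<Sum>i\<in>F. (cmod (c i))\<^sup>2) \<le> norm2 lebesgue g / sqrt C3"
      using C3 by (simp add: real_sqrt_mult field_simps)
    then have "B * sqrt (\<Sum>i\<in>F. (cmod (c i))\<^sup>2) \<le> B * (norm2 lebesgue g / sqrt C3)"
      using B by (rule mult_left_mono)
    moreover have "cmod (ip2 lebesgue g w) \<le> B * sqrt (\<Sum>i\<in>F. (cmod (c i))\<^sup>2)"
      unfolding F(3) by (rule le[OF F(1,2)])
    ultimately show ?thesis by simp
  qed
  have "\<forall>n. \<exists>g. g \<in> lincombs I h \<and> norm2 lebesgue (\<lambda>x. w x - g x) < inverse (real (Suc n))"
  proof
    fix n
    have "0 < inverse (real (Suc n))" by simp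
    from dense[OF w this] show "\<exists>g. g \<in> lincombs I h \<and> norm2 lebesgue (\<lambda>x. w x - g x) < inverse (real (Suc n))" by blast
  qed
  then obtain g where g: "\<And>n. g n \<in> lincombs I h"
    and gw: "\<And>n. norm2 lebesgue (\<lambda>x. w x - g n x) < inverse (real (Suc n))"
    by metis
  have gs: "g n \<in> sq_int lebesgue" for n by (rule lincombs_sq_int[OF h g])
  have lim: "(\<lambda>n. norm2 lebesgue (\<lambda>x. g n x - w x)) \<longlonglongrightarrow> 0"
  proof (rule tendsto_of_norm_le[OF LIMSEQ_inverse_real_of_nat])
    fix n show "norm (norm2 lebesgue (\<lambda>x. g n x - w x) - 0) \<le> inverse (real (Suc n))"
      using gw[of n] by (simp add: norm2_minus_commute[of _ w])
  qed
  have "cmod (ip2 lebesgue w w) \<le> (B / sqrt C3) * norm2 lebesgue w"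
  proof (rule LIMSEQ_le)
    show "(\<lambda>n. cmod (ip2 lebesgue (g n) w)) \<longlonglongrightarrow> cmod (ip2 lebesgue w w)"
      by (intro tendsto_norm tendsto_ip2_left gs w lim)
    show "(\<lambda>n. (B / sqrt C3) * norm2 lebesgue (g n)) \<longlonglongrightarrow> (B / sqrt C3) * norm2 lebesgue w"
      by (rule tendsto_mult[OF tendsto_const tendsto_norm2[OF gs w lim]])
  qed (use bound[OF g] in blast)
  then have "norm2 lebesgue w * norm2 lebesgue w \<le> (B / sqrt C3) * norm2 lebesgue w"
    by (simp add: ip2_self norm_power power2_eq_square norm_mult)
  then show ?thesis
  proof (cases "norm2 lebesgue w = 0")
    case False
    then have "0 < norm2 lebesgue w" using norm2_nonneg[of lebesgue w] by linarith
    then show ?thesis using \<open>norm2 lebesgue w * norm2 lebesgue w \<le> (B / sqrt C3) * norm2 lebesgue w\<close>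
      by (rule mult_right_le_imp_le[rotated])
  qed (use B C3 in simp)
qed

lemma sum_of_bool_collapse:
  fixes c :: "'i \<Rightarrow> complex"
  assumes "finite F" "finite G"
  shows "(\<Sum>i\<in>F. c i * (\<Sum>j\<in>G. a j * of_bool (i = j))) = (\<Sum>i\<in>F \<inter> G. c i * a i)"
proof -
  have col: "(\<Sum>j\<in>G. a j * of_bool (i = j)) = (if i \<in> G then a i else 0)" for i
  proof -
    have "(\<Sum>j\<in>G. a j * of_bool (i = j)) = (\<Sum>j\<in>G. if j = i then a j else 0)"
      by (intro sum.cong) auto
    then show ?thesis using assms(2) by simp
  qed
  have "(\<Sum>i\<in>F. c i * (\<Sum>j\<in>G. a j * of_bool (i = j))) = (\<Sum>i\<in>F. if i \<in> G then c i * a i else 0)"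
    unfolding col by (intro sum.cong) auto
  also have "\<dots> = (\<Sum>i\<in>F \<inter> G. c i * a i)" using assms(1) by (simp add: sum.inter_restrict)
  finally show ?thesis .
qed

text \<open>A finite sum within \<open>e\<close> of the supremum of all finite sums can be enlarged by at most \<open>e\<close>.\<close>
lemma bounded_sums_tail:
  fixes a :: "'i \<Rightarrow> real"
  assumes nn: "\<And>i. 0 \<le> a i" and bound: "\<And>F. finite F \<Longrightarrow> F \<subseteq> I \<Longrightarrow> sum a F \<le> K" and e: "0 < e"
  obtains F where "finite F" "F \<subseteq> I" "\<And>G. finite G \<Longrightarrow> G \<subseteq> I \<Longrightarrow> sum a (G - F) \<le> e"
proof -
  define S where "S = sum a ` {F. finite F \<and> F \<subseteq> I}"
  have S: "S \<noteq> {}" "bdd_above S" using bound by (auto simp: S_def intro!: bdd_aboveI[of _ K])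
  have "Sup S - e < Sup S" using e by simp
  then obtain y where y: "y \<in> S" "Sup S - e < y" using less_cSupD[OF S(1)] by blast
  from y(1) obtain F where F': "finite F" "F \<subseteq> I" "y = sum a F" unfolding S_def by blast
  note F = F'(1,2) y(2)[unfolded F'(3)]
  show thesis
  proof (rule that[OF F(1,2)])
    fix G assume G: "finite G" "G \<subseteq> I"
    have "sum a (F \<union> (G - F)) = sum a F + sum a (G - F)"
      using F G by (intro sum.union_disjoint) auto
    moreover have "sum a (F \<union> (G - F)) \<le> Sup S"
      using F G by (intro cSup_upper[OF _ S(2)]) (auto simp: S_def)
    ultimately show "sum a (G - F) \<le> e" using F(3) by linarith
  qed
qed

text \<open>Pairing a combination of the \<open>g i\<close> with combinations of the \<open>h i\<close> gives inner products of coefficient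
  sequences; by duality the Riesz bounds of \<open>h\<close> become their reciprocals for \<open>g\<close>. For density, \<open>f\<close> is approximated
  by the partial sum with coefficients \<open>d j\<close>, the inner products of \<open>f\<close> with \<open>h j\<close>. They are square-summable by
  Bessel's inequality, and the same duality estimates the remainder by the tail of the sum.\<close>
lemma biorthogonal_riesz_basis:
  fixes h g :: "'i \<Rightarrow> real ^ 'd \<Rightarrow> complex"
  assumes R: "riesz_basis I h" and g: "\<And>i. i \<in> I \<Longrightarrow> g i \<in> sq_int lebesgue"
    and bi: "\<And>i j. i \<in> I \<Longrightarrow> j \<in> I \<Longrightarrow> ip2 lebesgue (h i) (g j) = of_bool (i = j)"
  shows "riesz_basis I g"
proof -
  obtain C3 C4 where h: "\<And>i. i \<in> I \<Longrightarrow> h i \<in> sq_int lebesgue"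
    and dense: "\<And>f e. f \<in> sq_int lebesgue \<Longrightarrow> 0 < e \<Longrightarrow> \<exists>g\<in>lincombs I h. norm2 lebesgue (\<lambda>x. f x - g x) < e"
    and C3: "0 < C3" and C4: "0 < C4"
    and lower: "\<And>F c. finite F \<Longrightarrow> F \<subseteq> I \<Longrightarrow> C3 * (\<Sum>i\<in>F. (cmod (c i))\<^sup>2) \<le> (norm2 lebesgue (\<lambda>x. \<Sum>i\<in>F. c i * h i x))\<^sup>2"
    and upper: "\<And>F c. finite F \<Longrightarrow> F \<subseteq> I \<Longrightarrow> (norm2 lebesgue (\<lambda>x. \<Sum>i\<in>F. c i * h i x))\<^sup>2 \<le> C4 * (\<Sum>i\<in>F. (cmod (c i))\<^sup>2)"
    using R by (rule riesz_basisE) blast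
  have coeff_bound: "norm2 lebesgue w \<le> B / sqrt C3"
    if "w \<in> sq_int lebesgue" "0 \<le> B"
      "\<And>F c. finite F \<Longrightarrow> F \<subseteq> I \<Longrightarrow> cmod (ip2 lebesgue (\<lambda>x. \<Sum>i\<in>F. c i * h i x) w) \<le> B * sqrt (\<Sum>i\<in>F. (cmod (c i))\<^sup>2)"
    for w B
    by (rule norm2_le_of_coefficients[of I h C3]) (fact h dense C3 lower that)+
  have ip: "ip2 lebesgue (\<lambda>x. \<Sum>i\<in>F. c i * h i x) (\<lambda>x. \<Sum>j\<in>G. a j * g j x) = (\<Sum>i\<in>F \<inter> G. c i * cnj (a i))"
    if F: "finite F" "F \<subseteq> I" and G: "finite G" "G \<subseteq> I" for F G c a
  proof -
    have "ip2 lebesgue (\<lambda>x. \<Sum>i\<in>F. c i * h i x) (\<lambda>x. \<Sum>j\<in>G. a j * g j x)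
        = (\<Sum>i\<in>F. c i * ip2 lebesgue (h i) (\<lambda>x. \<Sum>j\<in>G. a j * g j x))"
      using F G h g by (intro ip2_sum_left sq_int_lincomb) auto
    also have "\<dots> = (\<Sum>i\<in>F. c i * (\<Sum>j\<in>G. cnj (a j) * ip2 lebesgue (h i) (g j)))"
    proof (intro sum.cong refl arg_cong2[where f="(*)"])
      fix i assume "i \<in> F"
      then show "ip2 lebesgue (h i) (\<lambda>x. \<Sum>j\<in>G. a j * g j x) = (\<Sum>j\<in>G. cnj (a j) * ip2 lebesgue (h i) (g j))"
        using F G h g by (intro ip2_sum_right) auto
    qed
    also have "\<dots> = (\<Sum>i\<in>F. c i * (\<Sum>j\<in>G. cnj (a j) * of_bool (i = j)))"
    proof (intro sum.cong refl arg_cong2[where f="(*)"])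
      fix i j assume "i \<in> F" "j \<in> G"
      then show "ip2 lebesgue (h i) (g j) = of_bool (i = j)" using F G by (intro bi) auto
    qed
    also have "\<dots> = (\<Sum>i\<in>F \<inter> G. c i * cnj (a i))"
      using F G by (intro sum_of_bool_collapse)
    finally show ?thesis .
  qed
  show ?thesis
  proof (rule riesz_basisI[where ?C3.0="1 / C4" and ?C4.0="1 / C3"])
    fix G and a :: "'i \<Rightarrow> complex" assume G: "finite G" "G \<subseteq> I"
    let ?w = "\<lambda>x. \<Sum>j\<in>G. a j * g j x" and ?S = "\<Sum>i\<in>G. (cmod (a i))\<^sup>2"
    have w: "?w \<in> sq_int lebesgue" using G g by (intro sq_int_lincomb) auto
    have S0: "0 \<le> ?S" by (simp add: sum_nonneg)
    have "norm2 lebesgue ?w \<le> sqrt ?S / sqrt C3"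
    proof (rule coeff_bound[OF w])
      fix F and c :: "'i \<Rightarrow> complex" assume F: "finite F" "F \<subseteq> I"
      have "cmod (\<Sum>i\<in>F \<inter> G. c i * cnj (a i))
          \<le> sqrt (\<Sum>i\<in>F \<inter> G. (cmod (c i))\<^sup>2) * sqrt (\<Sum>i\<in>F \<inter> G. (cmod (a i))\<^sup>2)"
        using sum_mult_le_sqrt[of c "\<lambda>i. cnj (a i)" "F \<inter> G"] by simp
      also have "\<dots> \<le> sqrt (\<Sum>i\<in>F. (cmod (c i))\<^sup>2) * sqrt ?S"
        using F G by (intro mult_mono real_sqrt_le_mono sum_mono2) (auto simp: sum_nonneg)
      finally show "cmod (ip2 lebesgue (\<lambda>x. \<Sum>i\<in>F. c i * h i x) ?w) \<le> sqrt ?S * sqrt (\<Sum>i\<in>F. (cmod (c i))\<^sup>2)"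
        unfolding ip[OF F G] by (simp add: mult.commute)
    qed (use S0 in auto)
    then have "(norm2 lebesgue ?w)\<^sup>2 \<le> (sqrt ?S / sqrt C3)\<^sup>2" by (intro power_mono norm2_nonneg)
    then show "(norm2 lebesgue ?w)\<^sup>2 \<le> 1 / C3 * ?S"
      using S0 C3 by (simp add: power_divide)
    have "ip2 lebesgue (\<lambda>x. \<Sum>i\<in>G. a i * h i x) ?w = complex_of_real ?S"
      unfolding ip[OF G G] by (simp add: complex_norm_square del: of_real_power)
    then have "?S \<le> norm2 lebesgue (\<lambda>x. \<Sum>i\<in>G. a i * h i x) * norm2 lebesgue ?w"
      using Cauchy_Schwarz_ip2[OF sq_int_lincomb[of G h lebesgue a] w] h G S0
      by (metis (no_types, lifting) abs_of_nonneg norm_of_real subsetD)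
    then have "?S\<^sup>2 \<le> (norm2 lebesgue (\<lambda>x. \<Sum>i\<in>G. a i * h i x) * norm2 lebesgue ?w)\<^sup>2"
      using S0 by (intro power_mono)
    also have "\<dots> \<le> (C4 * ?S) * (norm2 lebesgue ?w)\<^sup>2"
      unfolding power_mult_distrib by (intro mult_right_mono upper G) simp
    finally have "?S * ?S \<le> (C4 * (norm2 lebesgue ?w)\<^sup>2) * ?S" by (simp add: power2_eq_square mult_ac)
    then have "?S \<le> C4 * (norm2 lebesgue ?w)\<^sup>2"
      using S0 C4 by (cases "?S = 0") (auto simp: mult_le_cancel_right)
    then show "1 / C4 * ?S \<le> (norm2 lebesgue ?w)\<^sup>2"
      using C4 by (simp add: field_simps)
  next
    fix f :: "real ^ 'd \<Rightarrow> complex" and e :: real assume f: "f \<in> sq_int lebesgue" and e: "0 < e"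
    define d where "d = (\<lambda>j. ip2 lebesgue f (h j))"
    \<comment> \<open>Squared coefficients with sum \<open>\<eta>\<close> in the tail give a remainder of norm \<open>sqrt \<eta> / sqrt C3 = e / 2\<close>.\<close>
    define \<eta> where "\<eta> = C3 * (e / 2)\<^sup>2"
    have \<eta>: "0 < \<eta>" using C3 e by (simp add: \<eta>_def)
    have "(\<Sum>j\<in>F. (cmod (d j))\<^sup>2) \<le> C4 * (norm2 lebesgue f)\<^sup>2" if "finite F" "F \<subseteq> I" for F
      unfolding d_def using that h C4 by (intro bessel_inequality f upper) auto
    then obtain F where F: "finite F" "F \<subseteq> I"
      and tail: "\<And>G. finite G \<Longrightarrow> G \<subseteq> I \<Longrightarrow> (\<Sum>j\<in>G - F. (cmod (d j))\<^sup>2) \<le> \<eta>"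
      using bounded_sums_tail[of "\<lambda>j. (cmod (d j))\<^sup>2" I "C4 * (norm2 lebesgue f)\<^sup>2" \<eta>] \<eta> by auto
    define p where "p = (\<lambda>x. \<Sum>j\<in>F. d j * g j x)"
    have ps: "p \<in> sq_int lebesgue" unfolding p_def using F g by (intro sq_int_lincomb) auto
    have w: "(\<lambda>x. f x - p x) \<in> sq_int lebesgue" by (rule sq_int_diff[OF f ps])
    have "norm2 lebesgue (\<lambda>x. f x - p x) \<le> sqrt \<eta> / sqrt C3"
    proof (rule coeff_bound[OF w])
      fix G and c :: "'i \<Rightarrow> complex" assume G: "finite G" "G \<subseteq> I"
      have hG: "(\<lambda>x. \<Sum>i\<in>G. c i * h i x) \<in> sq_int lebesgue" using G h by (intro sq_int_lincomb) auto
      have "ip2 lebesgue (\<lambda>x. \<Sum>i\<in>G. c i * h i x) f = (\<Sum>i\<in>G. c i * cnj (d i))"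
        unfolding d_def ip2_cnj[symmetric] using G h f by (intro ip2_sum_left) auto
      moreover have "ip2 lebesgue (\<lambda>x. \<Sum>i\<in>G. c i * h i x) p = (\<Sum>i\<in>G \<inter> F. c i * cnj (d i))"
        unfolding p_def by (rule ip[OF G F])
      moreover have "(\<Sum>i\<in>G. c i * cnj (d i)) = (\<Sum>i\<in>G \<inter> F. c i * cnj (d i)) + (\<Sum>i\<in>G - F. c i * cnj (d i))"
        using G(1) by (subst sum.union_disjoint[symmetric]) (auto intro!: sum.cong)
      ultimately have "ip2 lebesgue (\<lambda>x. \<Sum>i\<in>G. c i * h i x) (\<lambda>x. f x - p x) = (\<Sum>i\<in>G - F. c i * cnj (d i))"
        by (subst ip2_diff_right[OF f ps hG]) simp
      also have "cmod \<dots> \<le> sqrt (\<Sum>i\<in>G - F. (cmod (c i))\<^sup>2) * sqrt (\<Sum>i\<in>G - F. (cmod (d i))\<^sup>2)"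
        using sum_mult_le_sqrt[of c "\<lambda>i. cnj (d i)" "G - F"] by simp
      also have "\<dots> \<le> sqrt (\<Sum>i\<in>G. (cmod (c i))\<^sup>2) * sqrt \<eta>"
        using G tail[OF G] by (intro mult_mono real_sqrt_le_mono sum_mono2) (auto simp: sum_nonneg)
      finally show "cmod (ip2 lebesgue (\<lambda>x. \<Sum>i\<in>G. c i * h i x) (\<lambda>x. f x - p x)) \<le> sqrt \<eta> * sqrt (\<Sum>i\<in>G. (cmod (c i))\<^sup>2)"
        by (simp add: mult.commute)
    qed (use \<eta> in auto)
    also have "\<dots> = e / 2" using C3 e by (simp add: \<eta>_def real_sqrt_mult)
    also have "\<dots> < e" using e by simp
    finally show "\<exists>g\<in>lincombs I g. norm2 lebesgue (\<lambda>x. f x - g x) < e"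
      using lincombsI[OF F, of d g] by (intro bexI[of _ p]) (simp_all only: p_def)
  qed (use C3 C4 g in auto)
qed

section \<open>Trigonometric polynomials on the torus\<close>

text \<open>Half-open, so that the translates by \<open>2 * pi\<close> times integer vectors cover the space without overlap.\<close>
definition cube :: "(real ^ 'd) set" where
  "cube = {\<xi>. \<forall>i. -pi \<le> \<xi> $ i \<and> \<xi> $ i < pi}"

abbreviation torus :: "(real ^ 'd) measure" where
  "torus \<equiv> lebesgue_on cube"

lemma cube_sets_borel: "(cube :: (real ^ 'd) set) \<in> sets borel"
proof -
  have "(cube :: (real ^ 'd) set) = (\<Inter>i\<in>UNIV. {\<xi>. -pi \<le> \<xi> $ i} \<inter> {\<xi>. \<xi> $ i < pi})"
    by (auto simp: cube_def)
  also have "\<dots> \<in> sets borel"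
    by (intro sets.finite_INT sets.Int borel_closed borel_open)
      (auto intro!: closed_Collect_le open_Collect_less continuous_intros)
  finally show ?thesis .
qed

lemma cube_sets [measurable, simp]: "(cube :: (real ^ 'd) set) \<in> sets lebesgue"
  by (rule sets_completionI_sets) (use cube_sets_borel in simp)

lemma cube_subset_cbox: "cube \<subseteq> cbox (\<chi> i. -pi) (\<chi> i. pi)"
  by (auto simp: cube_def mem_box_cart less_imp_le)

lemma emeasure_cube_finite: "emeasure lebesgue (cube :: (real ^ 'd) set) < \<infinity>"
proof -
  have "emeasure lborel (cube :: (real ^ 'd) set) < \<infinity>"
    by (rule emeasure_bounded_finite[OF bounded_subset[OF bounded_cbox cube_subset_cbox]])
  moreover have "main_part lborel (cube :: (real ^ 'd) set) = cube"
    by (rule main_part) (use cube_sets_borel in simp)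
  ultimately show ?thesis by (simp add: emeasure_completion)
qed

lemma finite_measure_torus: "finite_measure (torus :: (real ^ 'd) measure)"
proof
  show "emeasure (torus :: (real ^ 'd) measure) (space torus) \<noteq> \<infinity>"
    using emeasure_cube_finite[where 'd='d] by (simp add: emeasure_restrict_space less_top)
qed

lemma torus_integrable_iff:
  fixes f :: "real ^ 'd \<Rightarrow> 'b::{banach, second_countable_topology}"
  shows "integrable torus f \<longleftrightarrow> integrable lebesgue (\<lambda>x. indicator cube x *\<^sub>R f x)"
  by (rule integrable_restrict_space) simp

lemma torus_integral:
  fixes f :: "real ^ 'd \<Rightarrow> 'b::{banach, second_countable_topology}"
  shows "(LINT x|torus. f x) = (LINT x|lebesgue. indicator cube x *\<^sub>R f x)"
  by (rule integral_restrict_space) simp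

lemma AE_torus_iff: "(AE x in (torus :: (real ^ 'd) measure). P x) \<longleftrightarrow> (AE x in lebesgue. x \<in> cube \<longrightarrow> P x)"
  by (rule AE_restrict_space_iff) simp

lemma sq_int_torus_of_lebesgue:
  assumes f: "f \<in> sq_int lebesgue"
  shows "f \<in> sq_int torus" and "norm2 torus f \<le> norm2 lebesgue f"
proof -
  note [measurable] = sq_int_meas[OF f]
  have int: "integrable lebesgue (\<lambda>x. indicator cube x *\<^sub>R (cmod (f x))\<^sup>2)"
    by (rule Bochner_Integration.integrable_bound[OF sq_int_integrable[OF f]]) (auto split: split_indicator)
  show "f \<in> sq_int torus"
    by (rule sq_intI) (use int in \<open>auto simp: torus_integrable_iff intro: measurable_restrict_space1\<close>)
  have "(LINT x|torus. (cmod (f x))\<^sup>2) \<le> (LINT x|lebesgue. (cmod (f x))\<^sup>2)"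
    unfolding torus_integral
    by (rule integral_mono[OF int sq_int_integrable[OF f]]) (auto split: split_indicator)
  then show "norm2 torus f \<le> norm2 lebesgue f"
    unfolding norm2_def by (rule real_sqrt_le_mono)
qed

lemma L2_torus_iff:
  "a \<in> L2_torus \<longleftrightarrow> a \<in> borel_measurable lebesgue
     \<and> (\<forall>k\<in>int_lattice. \<forall>\<xi>. a (\<xi> + (2 * pi) *\<^sub>R k) = a \<xi>) \<and> a \<in> sq_int torus"
  unfolding L2_torus_def sq_int_def set_integrable_def cube_def[symmetric] torus_integrable_iff
  by (auto intro: measurable_restrict_space1)

lemma exp_int_2pi: "m \<in> \<int> \<Longrightarrow> exp (\<i> * complex_of_real (2 * pi * m)) = 1"
  by (metis Ints_cases exp_2pi_1_int exp_eq_1 complex_of_real_def mult.commute mult.left_commute of_real_mult of_real_of_int_eq of_real_numeral exp_integer_2pi mult.assoc)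

lemma integral_exp_int:
  fixes m :: real
  assumes m: "m \<in> \<int>"
  defines "f \<equiv> \<lambda>t. indicator {-pi..<pi} t *\<^sub>R exp (- (\<i> * complex_of_real (m * t)))"
  shows "integrable lborel f" "(LINT t|lborel. f t) = (if m = 0 then complex_of_real (2 * pi) else 0)"
proof -
  define g where "g = (\<lambda>t. indicator {-pi..pi} t *\<^sub>R exp (- (\<i> * complex_of_real (m * t))))"
  have fm: "f \<in> borel_measurable lborel" unfolding f_def by measurable
  have gm: "g \<in> borel_measurable lborel" unfolding g_def by measurable
  have ae: "AE t in lborel. g t = f t"
    using AE_lborel_singleton[of pi] by eventually_elim (auto simp: f_def g_def split: split_indicator)
  have cont: "continuous_on {-pi..pi} (\<lambda>t. exp (- (\<i> * complex_of_real (m * t))))"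
    by (intro continuous_intros)
  have "\<exists>F. (\<forall>x. -pi \<le> x \<longrightarrow> x \<le> pi \<longrightarrow> (F has_vector_derivative exp (- (\<i> * complex_of_real (m * x)))) (at x within {-pi..pi}))
     \<and> F pi - F (-pi) = (if m = 0 then complex_of_real (2 * pi) else 0)"
  proof (cases "m = 0")
    case True
    have "((\<lambda>t. complex_of_real t) has_vector_derivative 1) (at x within {-pi..pi})" for x
      by (auto intro!: derivative_eq_intros)
    then show ?thesis using True by (intro exI[of _ complex_of_real]) auto
  next
    case False
    define F where "F = (\<lambda>t. (\<i> / complex_of_real m) * exp (- (\<i> * complex_of_real (m * t))))"
    have "(F has_vector_derivative exp (- (\<i> * complex_of_real (m * x)))) (at x within {-pi..pi})" for x
      unfolding F_def using False
      by (auto intro!: derivative_eq_intros has_vector_derivative_real_field simp: field_simps)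
    moreover have "F pi = F (-pi)"
    proof -
      have "exp (- (\<i> * complex_of_real (m * - pi))) = exp (- (\<i> * complex_of_real (m * pi))) * exp (\<i> * complex_of_real (2 * pi * m))"
        by (simp add: algebra_simps flip: exp_add)
      then show ?thesis using exp_int_2pi[OF m] by (simp add: F_def)
    qed
    ultimately show ?thesis using False by (intro exI[of _ F]) auto
  qed
  then obtain F where F: "\<And>x. -pi \<le> x \<Longrightarrow> x \<le> pi \<Longrightarrow> (F has_vector_derivative exp (- (\<i> * complex_of_real (m * x)))) (at x within {-pi..pi})"
    and F0: "F pi - F (-pi) = (if m = 0 then complex_of_real (2 * pi) else 0)" by blast
  have hb: "has_bochner_integral lborel g (F pi - F (-pi))"
    unfolding g_def by (rule has_bochner_integral_FTC_Icc[OF _ F cont]) simp_all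
  have gi: "integrable lborel g" and gv: "integral\<^sup>L lborel g = F pi - F (-pi)"
    using hb by (auto simp: has_bochner_integral_iff)
  show "integrable lborel f" using gi integrable_cong_AE[OF gm fm ae] by simp
  show "(LINT t|lborel. f t) = (if m = 0 then complex_of_real (2 * pi) else 0)"
    using gv integral_cong_AE[OF gm fm ae] F0 by simp
qed

lemma torus_integral_wave:
  fixes k :: "real ^ 'd"
  assumes k: "k \<in> int_lattice"
  shows "(LINT \<xi>|torus. wave k \<xi>) = (if k = 0 then complex_of_real ((2 * pi) ^ CARD('d)) else 0)"
proof -
  define f where "f = (\<lambda>i t. indicator {-pi..<pi} t *\<^sub>R exp (- (\<i> * complex_of_real (k $ i * t))))"
  have kZ: "k $ i \<in> \<int>" for i using k by (simp add: int_lattice_def)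
  have fi: "integrable lborel (f i)" for i unfolding f_def by (rule integral_exp_int(1)[OF kZ])
  have eq: "indicator cube \<xi> *\<^sub>R wave k \<xi> = (\<Prod>i\<in>UNIV. f i (\<xi> $ i))" for \<xi>
  proof (cases "\<xi> \<in> cube")
    case True
    then have "\<And>i. \<xi> $ i \<in> {-pi..<pi}" by (auto simp: cube_def)
    then show ?thesis using True by (simp add: f_def wave_prod)
  next
    case False
    then obtain i where "\<xi> $ i \<notin> {-pi..<pi}" by (auto simp: cube_def)
    then have "f i (\<xi> $ i) = 0" by (simp add: f_def)
    then have "(\<Prod>i\<in>UNIV. f i (\<xi> $ i)) = 0" by (intro prod_zero) auto
    then show ?thesis using False by simp
  qed
  have "(LINT \<xi>|torus. wave k \<xi>) = (LINT \<xi>|lebesgue. (\<Prod>i\<in>UNIV. f i (\<xi> $ i)))"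
    unfolding torus_integral eq ..
  also have "\<dots> = (LINT \<xi>|lborel. (\<Prod>i\<in>UNIV. f i ((\<xi> :: real ^ 'd) $ i)))"
    using borel_measurable_integrable[OF lborel_integral_prod(1)[OF fi]] by (intro integral_completion) simp
  also have "\<dots> = (\<Prod>i\<in>UNIV. if k $ i = 0 then complex_of_real (2 * pi) else 0)"
    unfolding lborel_integral_prod(2)[OF fi] by (simp only: f_def integral_exp_int(2)[OF kZ])
  also have "\<dots> = (if k = 0 then complex_of_real ((2 * pi) ^ CARD('d)) else 0)"
  proof (cases "k = 0")
    case False
    then obtain i where "k $ i \<noteq> 0" by (auto simp: vec_eq_iff)
    then have "(\<Prod>i\<in>UNIV. if k $ i = 0 then complex_of_real (2 * pi) else 0) = 0"
      by (intro prod_zero) auto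
    then show ?thesis using False by simp
  qed simp
  finally show ?thesis .
qed

lemma int_lattice_add: "k \<in> int_lattice \<Longrightarrow> l \<in> int_lattice \<Longrightarrow> k + l \<in> int_lattice"
  and int_lattice_uminus: "k \<in> int_lattice \<Longrightarrow> - k \<in> int_lattice"
  and int_lattice_diff: "k \<in> int_lattice \<Longrightarrow> l \<in> int_lattice \<Longrightarrow> k - l \<in> int_lattice"
  and int_lattice_0: "0 \<in> int_lattice"
  by (auto simp: int_lattice_def)

lemma int_lattice_axis: "axis i 1 \<in> int_lattice"
  by (auto simp: int_lattice_def axis_def)

lemma countable_int_lattice: "countable (int_lattice :: (real ^ 'd) set)"
proof -
  have "int_lattice \<subseteq> range (\<lambda>f::'d \<Rightarrow> int. \<chi> i. real_of_int (f i))"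
  proof
    fix k :: "real ^ 'd" assume k: "k \<in> int_lattice"
    then have "k = (\<chi> i. real_of_int \<lfloor>k $ i\<rfloor>)"
      by (auto simp: vec_eq_iff int_lattice_def of_int_floor_cancel Ints_def)
    then show "k \<in> range (\<lambda>f::'d \<Rightarrow> int. \<chi> i. real_of_int (f i))"
      by (rule image_eqI[where x="\<lambda>i. \<lfloor>k $ i\<rfloor>"]) simp
  qed
  then show ?thesis by (rule countable_subset) simp
qed

lemma inner_int_lattice: "k \<in> int_lattice \<Longrightarrow> l \<in> int_lattice \<Longrightarrow> k \<bullet> l \<in> \<int>"
  by (auto simp: int_lattice_def inner_vec_def intro!: Ints_sum Ints_mult)

lemma wave_periodic:
  assumes "k \<in> int_lattice" "l \<in> int_lattice"
  shows "wave k (\<xi> + (2 * pi) *\<^sub>R l) = wave k \<xi>"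
proof -
  have "- (k \<bullet> l) \<in> \<int>" using inner_int_lattice[OF assms] by simp
  from exp_int_2pi[OF this] have "wave k ((2 * pi) *\<^sub>R l) = 1" by (simp add: wave_def)
  then show ?thesis by (simp add: wave_commute[of k] wave_add)
qed

lemma sq_int_torus_bounded:
  assumes f: "f \<in> borel_measurable lebesgue" and B: "\<And>x. cmod (f x) \<le> B"
  shows "f \<in> sq_int (torus :: (real ^ 'd) measure)"
proof (rule sq_intI)
  interpret finite_measure "torus :: (real ^ 'd) measure" by (rule finite_measure_torus)
  show fm: "f \<in> borel_measurable torus" using f by (rule measurable_restrict_space1)
  show "integrable torus (\<lambda>x. (cmod (f x))\<^sup>2)"
  proof (rule integrable_const_bound[of _ "B\<^sup>2"])
    show "AE x in torus. norm ((cmod (f x))\<^sup>2) \<le> B\<^sup>2"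
      using B by (intro AE_I2) (simp add: power_mono)
  qed (use fm in measurable)
qed

lemma wave_sq_int_torus: "wave k \<in> sq_int torus"
  by (rule sq_int_torus_bounded[of _ 1]) (auto intro: measurable_completion)

lemma ip2_torus_wave:
  fixes k l :: "real ^ 'd"
  assumes "k \<in> int_lattice" "l \<in> int_lattice"
  shows "ip2 torus (wave k) (wave l) = complex_of_real ((2 * pi) ^ CARD('d)) * of_bool (k = l)"
proof -
  have "(\<lambda>\<xi>. wave k \<xi> * cnj (wave l \<xi>)) = wave (k - l)"
    using wave_add[of k "- l"] by (simp add: cnj_wave fun_eq_iff)
  then show ?thesis
    using torus_integral_wave[OF int_lattice_diff[OF assms]] by (simp add: ip2_def)
qed

text \<open>The waves with integer frequencies are orthogonal on the cube, each with squared norm equal to its volume.\<close>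
lemma parseval_torus:
  fixes c :: "real ^ 'd \<Rightarrow> complex"
  assumes F: "finite F" "F \<subseteq> int_lattice"
  shows "(norm2 torus (\<lambda>\<xi>. \<Sum>k\<in>F. c k * wave k \<xi>))\<^sup>2 = (2 * pi) ^ CARD('d) * (\<Sum>k\<in>F. (cmod (c k))\<^sup>2)"
proof -
  let ?p = "\<lambda>\<xi>. \<Sum>k\<in>F. c k * wave k \<xi>" and ?K = "complex_of_real ((2 * pi) ^ CARD('d))"
  have "ip2 torus ?p ?p = (\<Sum>k\<in>F. c k * ip2 torus (wave k) ?p)"
    by (intro ip2_sum_left wave_sq_int_torus sq_int_lincomb)
  also have "\<dots> = (\<Sum>k\<in>F. c k * (\<Sum>l\<in>F. cnj (c l) * ip2 torus (wave k) (wave l)))"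
    by (intro sum.cong refl arg_cong2[where f="(*)"] ip2_sum_right wave_sq_int_torus)
  also have "\<dots> = (\<Sum>k\<in>F. c k * (\<Sum>l\<in>F. (?K * cnj (c l)) * of_bool (k = l)))"
  proof (rule sum.cong[OF refl])
    fix k assume k: "k \<in> F"
    have "(\<Sum>l\<in>F. cnj (c l) * ip2 torus (wave k) (wave l)) = (\<Sum>l\<in>F. (?K * cnj (c l)) * of_bool (k = l))"
    proof (rule sum.cong[OF refl])
      fix l assume "l \<in> F"
      then have "k \<in> int_lattice" "l \<in> int_lattice" using F k by auto
      then show "cnj (c l) * ip2 torus (wave k) (wave l) = (?K * cnj (c l)) * of_bool (k = l)"
        by (subst ip2_torus_wave) (simp_all add: mult_ac)
    qed
    then show "c k * (\<Sum>l\<in>F. cnj (c l) * ip2 torus (wave k) (wave l)) = c k * (\<Sum>l\<in>F. (?K * cnj (c l)) * of_bool (k = l))"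
      by (rule arg_cong[where f="(*) (c k)"])
  qed
  also have "\<dots> = (\<Sum>k\<in>F. c k * (?K * cnj (c k)))"
    using sum_of_bool_collapse[OF F(1) F(1), of c "\<lambda>l. ?K * cnj (c l)"] by simp
  also have "\<dots> = complex_of_real ((2 * pi) ^ CARD('d) * (\<Sum>k\<in>F. (cmod (c k))\<^sup>2))"
    by (simp add: sum_distrib_left complex_norm_square mult_ac del: of_real_power)
  finally show ?thesis by (simp only: ip2_self of_real_eq_iff)
qed

definition trigs :: "(real ^ 'd \<Rightarrow> complex) set" where
  "trigs = lincombs int_lattice wave"

lemma trigs_add: "p \<in> trigs \<Longrightarrow> q \<in> trigs \<Longrightarrow> (\<lambda>x. p x + q x) \<in> trigs"
  and trigs_cmult: "p \<in> trigs \<Longrightarrow> (\<lambda>x. a * p x) \<in> trigs"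
  unfolding trigs_def by (auto intro: lincombs_add lincombs_cmult)

lemma trigs_wave: "k \<in> int_lattice \<Longrightarrow> wave k \<in> trigs"
  unfolding trigs_def by (rule lincombs_base)

lemma trigs_const: "(\<lambda>x. a) \<in> trigs"
  using trigs_cmult[OF trigs_wave[OF int_lattice_0], of a] by simp

lemma trigs_sum: "(\<And>i. i \<in> F \<Longrightarrow> f i \<in> trigs) \<Longrightarrow> (\<lambda>x. \<Sum>i\<in>F. f i x) \<in> trigs"
  unfolding trigs_def by (rule lincombs_sum)

lemma trigs_mult:
  assumes p: "p \<in> trigs" and q: "q \<in> trigs"
  shows "(\<lambda>x. p x * q x) \<in> trigs"
proof -
  obtain F c where F: "finite F" "F \<subseteq> int_lattice" "p = (\<lambda>x. \<Sum>i\<in>F. c i * wave i x)"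
    using p unfolding trigs_def by (rule lincombsE)
  obtain G d where G: "finite G" "G \<subseteq> int_lattice" "q = (\<lambda>x. \<Sum>i\<in>G. d i * wave i x)"
    using q unfolding trigs_def by (rule lincombsE)
  have "(\<lambda>x. p x * q x) = (\<lambda>x. \<Sum>k\<in>F. \<Sum>l\<in>G. (c k * d l) * wave (k + l) x)"
    by (simp add: F(3) G(3) sum_product wave_add mult_ac)
  also have "\<dots> \<in> trigs"
    using F(2) G(2) by (intro trigs_sum trigs_cmult trigs_wave int_lattice_add) auto
  finally show ?thesis .
qed

text \<open>The quotient map onto the torus, embedded in a Euclidean space so that polynomial approximation on compact
  sets can be used there.\<close>
definition to_torus :: "real ^ 'd \<Rightarrow> complex ^ 'd" where
  "to_torus \<xi> = (\<chi> i. cis (\<xi> $ i))"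

text \<open>A linear functional on the ambient space restricts to a combination of sines and cosines of the
  coordinates, and trigonometric polynomials form an algebra.\<close>
lemma real_polynomial_trigs:
  fixes f :: "complex ^ 'd \<Rightarrow> real"
  assumes "real_polynomial_function f"
  shows "(\<lambda>\<xi>. complex_of_real (f (to_torus \<xi>))) \<in> trigs"
  using assms
proof (induction rule: real_polynomial_function.induct)
  case (linear f)
  interpret f: bounded_linear f by fact
  have cos_trig: "(\<lambda>\<xi>. complex_of_real (cos (\<xi> $ i))) \<in> trigs" for i :: 'd
  proof -
    have "complex_of_real (cos t) = (1/2) * exp (- (\<i> * complex_of_real t)) + (1/2) * exp (- (\<i> * complex_of_real (- t)))" for t
      by (simp add: cos_exp_eq field_simps flip: cos_of_real)
    then have "(\<lambda>\<xi>. complex_of_real (cos (\<xi> $ i))) = (\<lambda>\<xi>. (1/2) * wave (axis i 1) \<xi> + (1/2) * wave (- axis i 1) \<xi>)"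
      by (simp add: wave_def inner_axis' fun_eq_iff)
    then show ?thesis by (simp only:) (intro trigs_add trigs_cmult trigs_wave int_lattice_axis int_lattice_uminus)
  qed
  have sin_trig: "(\<lambda>\<xi>. complex_of_real (sin (\<xi> $ i))) \<in> trigs" for i :: 'd
  proof -
    have "complex_of_real (sin t) = (\<i>/2) * exp (- (\<i> * complex_of_real t)) + (- \<i>/2) * exp (- (\<i> * complex_of_real (- t)))" for t
      by (simp add: sin_exp_eq field_simps flip: sin_of_real)
    then have "(\<lambda>\<xi>. complex_of_real (sin (\<xi> $ i))) = (\<lambda>\<xi>. (\<i>/2) * wave (axis i 1) \<xi> + (- \<i>/2) * wave (- axis i 1) \<xi>)"
      by (simp add: wave_def inner_axis' fun_eq_iff)
    then show ?thesis by (simp only:) (intro trigs_add trigs_cmult trigs_wave int_lattice_axis int_lattice_uminus)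
  qed
  have eq: "to_torus \<xi> = (\<Sum>i\<in>UNIV. cos (\<xi> $ i) *\<^sub>R axis i 1 + sin (\<xi> $ i) *\<^sub>R axis i \<i>)" for \<xi> :: "real ^ 'd"
  proof (subst vec_eq_iff, intro allI)
    fix j
    have "(\<Sum>i\<in>UNIV. cos (\<xi> $ i) *\<^sub>R axis i 1 + sin (\<xi> $ i) *\<^sub>R axis i \<i>) $ j
        = (\<Sum>i\<in>UNIV. if i = j then cis (\<xi> $ i) else 0)"
      unfolding sum_component
      by (intro sum.cong refl) (auto simp: axis_def complex_eq_iff)
    then show "to_torus \<xi> $ j = (\<Sum>i\<in>UNIV. cos (\<xi> $ i) *\<^sub>R axis i 1 + sin (\<xi> $ i) *\<^sub>R axis i \<i>) $ j"
      by (simp add: to_torus_def)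
  qed
  have "(\<lambda>\<xi>. complex_of_real (f (to_torus \<xi>)))
      = (\<lambda>\<xi>. \<Sum>i\<in>UNIV. complex_of_real (f (axis i 1)) * complex_of_real (cos (\<xi> $ i)) + complex_of_real (f (axis i \<i>)) * complex_of_real (sin (\<xi> $ i)))"
    unfolding eq by (simp add: f.sum f.add f.scaleR mult.commute)
  also have "\<dots> \<in> trigs"
    by (intro trigs_sum trigs_add trigs_cmult cos_trig sin_trig)
  finally show ?case .
next
  case (const c)
  show ?case by (rule trigs_const)
next
  case (add f g)
  then show ?case using trigs_add by fastforce
next
  case (mult f g)
  then show ?case using trigs_mult by fastforce
qed

text \<open>On \<open>[- pi, pi]\<close> only the end points are identified on the circle.\<close>
lemma cis_eq_cube:
  assumes "cis x = cis y" "-pi \<le> x" "x \<le> pi" "-pi \<le> y" "y \<le> pi" "x \<noteq> y"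
  shows "\<bar>x\<bar> = pi" "\<bar>y\<bar> = pi"
proof -
  have "cis (x - y) = 1" using assms(1) by (simp flip: cis_divide)
  then have "exp (\<i> * complex_of_real (x - y)) = 1" by (simp add: cis_conv_exp)
  then obtain n :: int where "Im (\<i> * complex_of_real (x - y)) = of_int (2 * n) * pi"
    unfolding exp_eq_1 by blast
  then have n: "x - y = 2 * pi * n" by (simp add: mult_ac)
  have n0: "n \<noteq> 0" using n assms(6) by auto
  then have "1 \<le> \<bar>n\<bar>" by linarith
  then have "1 \<le> real_of_int \<bar>n\<bar>" by linarith
  then have "2 * pi * 1 \<le> 2 * pi * real_of_int \<bar>n\<bar>" by (intro mult_left_mono) auto
  also have "\<dots> = \<bar>x - y\<bar>" by (simp add: n abs_mult)
  finally have "2 * pi \<le> \<bar>x - y\<bar>" by simp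
  then show "\<bar>x\<bar> = pi" "\<bar>y\<bar> = pi" using assms(2-5) by linarith+
qed

text \<open>Points of the closed cube with the same image on the torus lie on the boundary, where \<open>u\<close> vanishes. Hence \<open>u\<close>
  factors through the quotient map as a continuous function on the torus, to which the theorem of Stone
  and Weierstrass applies.\<close>
lemma uniform_trig_approx:
  fixes u :: "real ^ 'd \<Rightarrow> complex"
  assumes cont: "continuous_on UNIV u" and bd: "\<And>\<xi> i. pi \<le> \<bar>\<xi> $ i\<bar> \<Longrightarrow> u \<xi> = 0" and e: "0 < e"
  obtains p where "p \<in> trigs" "\<And>\<xi>. \<xi> \<in> cube \<Longrightarrow> cmod (u \<xi> - p \<xi>) < e"
proof -
  define K where "K = (cbox (\<chi> i. -pi) (\<chi> i. pi) :: (real ^ 'd) set)"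
  define T where "T = to_torus ` K"
  \<comment> \<open>The function that \<open>u\<close> induces on the torus.\<close>
  define G where "G = (\<lambda>z. u (inv_into K to_torus z))"
  have tc: "continuous_on S to_torus" for S :: "(real ^ 'd) set"
    unfolding to_torus_def cis_conv_exp by (intro continuous_intros)
  have K: "compact K" by (simp add: K_def)
  have T: "compact T" unfolding T_def by (intro compact_continuous_image tc K)
  have fib: "u \<xi> = u \<eta>" if "\<xi> \<in> K" "\<eta> \<in> K" "to_torus \<xi> = to_torus \<eta>" for \<xi> \<eta>
  proof (cases "\<xi> = \<eta>")
    case False
    then obtain i where i: "\<xi> $ i \<noteq> \<eta> $ i" by (auto simp: vec_eq_iff)
    have c: "cis (\<xi> $ i) = cis (\<eta> $ i)" using that(3) by (simp add: to_torus_def vec_eq_iff)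
    have "\<bar>\<xi> $ i\<bar> = pi" "\<bar>\<eta> $ i\<bar> = pi"
      using that(1,2) by (intro cis_eq_cube[OF c] cis_eq_cube[OF c[symmetric]]; use i in \<open>auto simp: K_def mem_box_cart\<close>)+
    then show ?thesis using bd[of \<xi> i] bd[of \<eta> i] by simp
  qed simp
  have Gt: "G (to_torus \<xi>) = u \<xi>" if \<xi>: "\<xi> \<in> K" for \<xi>
    unfolding G_def
  proof (rule fib[OF _ \<xi>])
    have m: "to_torus \<xi> \<in> to_torus ` K" using \<xi> by (rule imageI)
    show "inv_into K to_torus (to_torus \<xi>) \<in> K" by (rule inv_into_into[OF m])
    show "to_torus (inv_into K to_torus (to_torus \<xi>)) = to_torus \<xi>" by (rule f_inv_into_f[OF m])
  qed
  have Gcont: "continuous_on T G"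
    unfolding continuous_openin_preimage_eq
  proof (intro allI impI)
    fix V :: "complex set" assume V: "open V"
    have eq: "K \<inter> to_torus -` (T \<inter> G -` V) = K \<inter> u -` V"
    proof -
      have "to_torus \<xi> \<in> T" if "\<xi> \<in> K" for \<xi> using that by (simp add: T_def)
      then show ?thesis using Gt by auto
    qed
    have "openin (top_of_set K) (K \<inter> u -` V)"
      by (rule continuous_openin_preimage_gen[OF continuous_on_subset[OF cont] V]) simp
    then have "openin (top_of_set K) (K \<inter> to_torus -` (T \<inter> G -` V))" by (simp only: eq)
    then show "openin (top_of_set T) (T \<inter> G -` V)"
      using Abstract_Topology_2.continuous_imp_quotient_map[OF tc _ K, of T "T \<inter> G -` V"] by (simp add: T_def)
  qed
  obtain g where g: "polynomial_function g" and ge: "\<And>z. z \<in> T \<Longrightarrow> norm (G z - g z) < e"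
    using Stone_Weierstrass_polynomial_function[OF T Gcont e] by blast
  have R: "real_polynomial_function (Re \<circ> g)" "real_polynomial_function (Im \<circ> g)"
    using g bounded_linear_Re bounded_linear_Im unfolding polynomial_function_def by blast+
  define p where "p = (\<lambda>\<xi>. complex_of_real ((Re \<circ> g) (to_torus \<xi>)) + \<i> * complex_of_real ((Im \<circ> g) (to_torus \<xi>)))"
  have pg: "p \<xi> = g (to_torus \<xi>)" for \<xi> by (simp add: p_def complex_eq_iff)
  show thesis
  proof
    show "p \<in> trigs" unfolding p_def by (intro trigs_add trigs_cmult real_polynomial_trigs R)
    fix \<xi> :: "real ^ 'd" assume "\<xi> \<in> cube"
    then have \<xi>: "\<xi> \<in> K" using cube_subset_cbox by (auto simp: K_def)
    then have "to_torus \<xi> \<in> T" by (simp add: T_def)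
    from ge[OF this] show "cmod (u \<xi> - p \<xi>) < e" by (simp add: pg Gt[OF \<xi>])
  qed
qed

lemma AE_interior_cube: "AE \<xi> in (torus :: (real ^ 'd) measure). \<forall>i. \<bar>\<xi> $ i\<bar> < pi"
proof -
  have "AE \<xi> in lebesgue. \<forall>i\<in>UNIV. (\<xi> :: real ^ 'd) $ i \<noteq> - pi"
  proof (subst AE_finite_all)
    show "\<forall>i\<in>UNIV. AE \<xi> in lebesgue. (\<xi> :: real ^ 'd) $ i \<noteq> - pi"
    proof
      fix i :: 'd
      have "negligible {x :: real ^ 'd. x \<bullet> axis i 1 = - pi}"
        by (rule negligible_standard_hyperplane) (simp add: Basis_vec_real)
      from AE_not_negligible[OF this] show "AE \<xi> in lebesgue. (\<xi> :: real ^ 'd) $ i \<noteq> - pi"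
        by (simp add: inner_axis)
    qed
  qed simp
  then show ?thesis
    unfolding AE_torus_iff
  proof eventually_elim
    fix \<xi> :: "real ^ 'd" assume *: "\<forall>i\<in>UNIV. \<xi> $ i \<noteq> - pi"
    show "\<xi> \<in> cube \<longrightarrow> (\<forall>i. \<bar>\<xi> $ i\<bar> < pi)"
    proof (intro impI allI)
      fix i assume "\<xi> \<in> cube"
      then have "- pi \<le> \<xi> $ i" "\<xi> $ i < pi" "\<xi> $ i \<noteq> - pi" using * by (auto simp: cube_def)
      then show "\<bar>\<xi> $ i\<bar> < pi" by linarith
    qed
  qed
qed

lemma norm2_torus_le:
  assumes f: "f \<in> borel_measurable lebesgue" and e: "0 \<le> e" and le: "\<And>\<xi>. \<xi> \<in> cube \<Longrightarrow> cmod (f \<xi>) \<le> e"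
  shows "f \<in> sq_int (torus :: (real ^ 'd) measure)"
    and "norm2 (torus :: (real ^ 'd) measure) f \<le> e * sqrt (measure lebesgue (cube :: (real ^ 'd) set))"
proof -
  interpret finite_measure "torus :: (real ^ 'd) measure" by (rule finite_measure_torus)
  have fm: "f \<in> borel_measurable torus" using f by (rule measurable_restrict_space1)
  have le2: "(cmod (f x))\<^sup>2 \<le> e\<^sup>2" if "x \<in> cube" for x using le[OF that] by (intro power_mono) auto
  have int: "integrable torus (\<lambda>x. (cmod (f x))\<^sup>2)"
    by (rule integrable_const_bound[of _ "e\<^sup>2"]) (use fm le2 in \<open>auto intro!: AE_I2\<close>)
  then show "f \<in> sq_int torus" using fm by (intro sq_intI)
  have "(LINT x|torus. (cmod (f x))\<^sup>2) \<le> (LINT x|(torus :: (real ^ 'd) measure). e\<^sup>2)"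
    by (rule integral_mono[OF int]) (use le2 in auto)
  also have "\<dots> = e\<^sup>2 * measure lebesgue (cube :: (real ^ 'd) set)"
    by (simp add: measure_restrict_space)
  finally have "sqrt (LINT x|torus. (cmod (f x))\<^sup>2) \<le> sqrt (e\<^sup>2 * measure lebesgue (cube :: (real ^ 'd) set))"
    by (rule real_sqrt_le_mono)
  then show "norm2 torus f \<le> e * sqrt (measure lebesgue (cube :: (real ^ 'd) set))"
    using e by (simp add: norm2_def real_sqrt_mult)
qed

lemma trigs_measurable: "p \<in> trigs \<Longrightarrow> p \<in> borel_measurable lebesgue"
  unfolding trigs_def by (erule lincombsE) simp

lemma trigs_sq_int: "p \<in> trigs \<Longrightarrow> p \<in> sq_int torus"
  unfolding trigs_def by (rule lincombs_sq_int[OF wave_sq_int_torus])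

lemma trigs_periodic:
  assumes "p \<in> trigs" "l \<in> int_lattice"
  shows "p (\<xi> + (2 * pi) *\<^sub>R l) = p \<xi>"
  using assms(1) unfolding trigs_def
  by (rule lincombsE) (use assms(2) in \<open>auto intro!: sum.cong simp: wave_periodic subset_iff\<close>)

text \<open>Three approximations with error \<open>e / 3\<close> each: by a bounded function, by a continuous one vanishing on the boundary of the
  cube, and by a trigonometric polynomial uniformly on the cube.\<close>
lemma trigs_dense:
  fixes a :: "real ^ 'd \<Rightarrow> complex"
  assumes a: "a \<in> borel_measurable lebesgue" "a \<in> sq_int torus" and e: "0 < e"
  obtains p where "p \<in> trigs" "norm2 torus (\<lambda>\<xi>. p \<xi> - a \<xi>) < e"
proof -
  have e3: "0 < e / 3" using e by simp
  define f where "f = (\<lambda>\<xi>. indicator cube \<xi> *\<^sub>R a \<xi>)"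
  have fm[measurable]: "f \<in> borel_measurable lebesgue" unfolding f_def using a(1) by measurable
  have "(\<lambda>\<xi>. (cmod (f \<xi>))\<^sup>2) = (\<lambda>\<xi>. indicator cube \<xi> *\<^sub>R (cmod (a \<xi>))\<^sup>2)"
    by (auto simp: f_def fun_eq_iff split: split_indicator)
  then have f: "f \<in> sq_int lebesgue"
    using sq_int_integrable[OF a(2)] by (intro sq_intI fm) (simp add: torus_integrable_iff)
  obtain g N where N: "0 < N" and gm: "g \<in> borel_measurable lebesgue" and gN: "\<And>x. cmod (g x) \<le> N"
    and g2: "g \<in> sq_int lebesgue" and gf: "norm2 lebesgue (\<lambda>x. g x - f x) < e / 3"
    by (rule bounded_approx_sq_int[OF f e3]) blast
  have gt: "g \<in> sq_int torus" by (rule sq_int_torus_of_lebesgue(1)[OF g2])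
  have ga: "norm2 torus (\<lambda>x. g x - a x) < e / 3"
  proof -
    have "norm2 torus (\<lambda>x. g x - a x) = norm2 torus (\<lambda>x. g x - f x)"
      unfolding norm2_def by (intro arg_cong[where f=sqrt] Bochner_Integration.integral_cong refl) (auto simp: f_def)
    also have "\<dots> \<le> norm2 lebesgue (\<lambda>x. g x - f x)"
      by (rule sq_int_torus_of_lebesgue(2)[OF sq_int_diff[OF g2 f]])
    finally show ?thesis using gf by simp
  qed
  obtain h N0 where N0: "negligible N0" and h: "\<And>n. continuous_on UNIV (h n)" "\<And>n x. cmod (h n x) \<le> N"
    "\<And>x. x \<notin> N0 \<Longrightarrow> (\<lambda>n. h n x) \<longlonglongrightarrow> g x"
    using continuous_approx_bounded[OF gm N gN] by metis
  \<comment> \<open>In each coordinate the cutoff vanishes at \<open>- pi\<close> and \<open>pi\<close> and tends to \<open>1\<close> between them.\<close>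
  define q where "q = (\<lambda>(n::nat) t. max 0 (min 1 (real n * (pi - \<bar>t\<bar>))))"
  define ct where "ct = (\<lambda>n (\<xi> :: real ^ 'd). \<Prod>i\<in>UNIV. q n (\<xi> $ i))"
  define u where "u = (\<lambda>n \<xi>. complex_of_real (ct n \<xi>) * h n \<xi>)"
  have q01: "0 \<le> q n t" "q n t \<le> 1" for n t by (auto simp: q_def)
  have ct01: "0 \<le> ct n \<xi>" "ct n \<xi> \<le> 1" for n \<xi>
    unfolding ct_def using q01 by (auto intro!: prod_nonneg prod_le_1)
  have ucont: "continuous_on UNIV (u n)" for n
    unfolding u_def ct_def q_def using h(1)[of n] by (intro continuous_intros)
  have um: "u n \<in> borel_measurable lebesgue" for n
    using borel_measurable_continuous_onI[OF ucont] by (simp add: measurable_completion)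
  have u0: "u n \<xi> = 0" if "pi \<le> \<bar>\<xi> $ i\<bar>" for n \<xi> i
  proof -
    have "real n * (pi - \<bar>\<xi> $ i\<bar>) \<le> 0" using that by (simp add: mult_nonneg_nonpos)
    then have "q n (\<xi> $ i) = 0" by (simp add: q_def)
    then have "ct n \<xi> = 0" unfolding ct_def by (intro prod_zero) auto
    then show ?thesis by (simp add: u_def)
  qed
  have uN: "cmod (u n \<xi>) \<le> N" for n \<xi>
    using mult_mono[OF ct01(2) h(2)[of n \<xi>]] ct01(1) by (simp add: u_def norm_mult)
  have ulim: "AE \<xi> in torus. (\<lambda>n. u n \<xi>) \<longlonglongrightarrow> g \<xi>"
  proof -
    have "AE \<xi> in torus. \<xi> \<notin> N0"
      unfolding AE_torus_iff using AE_not_negligible[OF N0] by eventually_elim simp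
    with AE_interior_cube show ?thesis
    proof eventually_elim
      fix \<xi> :: "real ^ 'd" assume int: "\<forall>i. \<bar>\<xi> $ i\<bar> < pi" and "\<xi> \<notin> N0"
      have qlim: "(\<lambda>n. q n (\<xi> $ i)) \<longlonglongrightarrow> 1" for i
      proof (rule tendsto_eventually)
        have pos: "0 < pi - \<bar>\<xi> $ i\<bar>" using int by simp
        obtain n0 where n0: "1 / (pi - \<bar>\<xi> $ i\<bar>) \<le> real n0" using real_arch_simple by blast
        show "\<forall>\<^sub>F n in sequentially. q n (\<xi> $ i) = 1"
          using eventually_ge_at_top[of n0]
        proof eventually_elim
          fix n assume "n0 \<le> n"
          then have "1 / (pi - \<bar>\<xi> $ i\<bar>) \<le> real n" using n0 by (meson of_nat_mono order_trans)
          then have "1 \<le> real n * (pi - \<bar>\<xi> $ i\<bar>)" using pos by (simp add: field_simps)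
          then show "q n (\<xi> $ i) = 1" by (simp add: q_def)
        qed
      qed
      have "(\<lambda>n. ct n \<xi>) \<longlonglongrightarrow> (\<Prod>i\<in>(UNIV :: 'd set). 1)"
        unfolding ct_def by (intro tendsto_prod qlim)
      then have "(\<lambda>n. u n \<xi>) \<longlonglongrightarrow> complex_of_real 1 * g \<xi>"
        unfolding u_def by (intro tendsto_mult tendsto_of_real h(3)[OF \<open>\<xi> \<notin> N0\<close>]) simp
      then show "(\<lambda>n. u n \<xi>) \<longlonglongrightarrow> g \<xi>" by simp
    qed
  qed
  have w: "(\<lambda>x. complex_of_real N) \<in> sq_int (torus :: (real ^ 'd) measure)"
    by (rule sq_int_torus_bounded[of _ N]) (use N in auto)
  have "(\<lambda>n. norm2 torus (\<lambda>x. u n x - g x)) \<longlonglongrightarrow> 0"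
    by (rule norm2_dominated_convergence(2)[OF _ _ w ulim])
      (use um gm uN N in \<open>auto intro: measurable_restrict_space1\<close>)
  then obtain n where n: "norm2 torus (\<lambda>x. u n x - g x) < e / 3" using e3 by (rule tendsto_zero_small)
  define m where "m = sqrt (measure lebesgue (cube :: (real ^ 'd) set))"
  have m: "0 \<le> m" by (simp add: m_def)
  \<comment> \<open>A uniform error on the cube enters the norm with the factor \<open>m\<close>; \<open>m + 1\<close> is surely positive.\<close>
  have em: "0 < e / (3 * (m + 1))" using e m by simp
  obtain p where p: "p \<in> trigs" and pu: "\<And>\<xi>. \<xi> \<in> cube \<Longrightarrow> cmod (u n \<xi> - p \<xi>) < e / (3 * (m + 1))"
  proof (rule uniform_trig_approx[OF ucont[of n] _ em])
    show "u n \<xi> = 0" if "pi \<le> \<bar>\<xi> $ i\<bar>" for \<xi> i using that by (rule u0)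
  qed blast
  have "norm2 torus (\<lambda>\<xi>. p \<xi> - u n \<xi>) \<le> e / (3 * (m + 1)) * m"
    unfolding m_def[symmetric]
    using em pu trigs_measurable[OF p] um[of n] unfolding m_def
    by (intro norm2_torus_le(2)) (auto simp: norm_minus_commute less_imp_le)
  also have "\<dots> \<le> e / 3"
    using e m by (simp add: field_simps)
  finally have pn: "norm2 torus (\<lambda>\<xi>. p \<xi> - u n \<xi>) \<le> e / 3" .
  have us: "u n \<in> sq_int torus" by (rule sq_int_torus_bounded[OF um uN])
  have "norm2 torus (\<lambda>\<xi>. p \<xi> - a \<xi>)
      \<le> norm2 torus (\<lambda>\<xi>. p \<xi> - u n \<xi>) + norm2 torus (\<lambda>\<xi>. u n \<xi> - a \<xi>)"
    by (intro norm2_triangle_diff trigs_sq_int p us a)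
  also have "norm2 torus (\<lambda>\<xi>. u n \<xi> - a \<xi>) \<le> norm2 torus (\<lambda>\<xi>. u n \<xi> - g \<xi>) + norm2 torus (\<lambda>\<xi>. g \<xi> - a \<xi>)"
    by (intro norm2_triangle_diff us gt a)
  finally have "norm2 torus (\<lambda>\<xi>. p \<xi> - a \<xi>) < e" using pn n ga by linarith
  then show thesis using that p by blast
qed

text \<open>Countably many translates of the cube cover the space.\<close>
lemma AE_of_periodic:
  fixes P :: "real ^ 'd \<Rightarrow> bool"
  assumes ae: "AE \<xi> in torus. P \<xi>" and per: "\<And>\<xi> l. l \<in> int_lattice \<Longrightarrow> P (\<xi> + (2 * pi) *\<^sub>R l) = P \<xi>"
  shows "AE \<xi> in lebesgue. P \<xi>"
proof -
  have "AE \<xi> in lebesgue. \<forall>l\<in>int_lattice. \<xi> - (2 * pi) *\<^sub>R l \<in> cube \<longrightarrow> P (\<xi> - (2 * pi) *\<^sub>R l)"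
  proof (subst AE_ball_countable[OF countable_int_lattice], intro ballI)
    fix l :: "real ^ 'd" assume "l \<in> int_lattice"
    show "AE \<xi> in lebesgue. \<xi> - (2 * pi) *\<^sub>R l \<in> cube \<longrightarrow> P (\<xi> - (2 * pi) *\<^sub>R l)"
      using ae unfolding AE_torus_iff by (rule scales_lborel_AE[OF scales_lborel_translate])
  qed
  then show ?thesis
  proof eventually_elim
    fix \<xi> :: "real ^ 'd"
    assume *: "\<forall>l\<in>int_lattice. \<xi> - (2 * pi) *\<^sub>R l \<in> cube \<longrightarrow> P (\<xi> - (2 * pi) *\<^sub>R l)"
    \<comment> \<open>The lattice vector that carries \<open>\<xi>\<close> into the cube.\<close>
    define l :: "real ^ 'd" where "l = (\<chi> i. real_of_int \<lfloor>(\<xi> $ i + pi) / (2 * pi)\<rfloor>)"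
    have l: "l \<in> int_lattice" by (simp add: l_def int_lattice_def)
    have "\<xi> - (2 * pi) *\<^sub>R l \<in> cube"
    proof (unfold cube_def, intro CollectI allI)
      fix i
      let ?y = "(\<xi> $ i + pi) / (2 * pi)"
      have "2 * pi * real_of_int \<lfloor>?y\<rfloor> \<le> 2 * pi * ?y" by (intro mult_left_mono) auto
      moreover have "2 * pi * ?y < 2 * pi * (real_of_int \<lfloor>?y\<rfloor> + 1)"
        by (intro mult_strict_left_mono) (auto simp: floor_correct)
      moreover have "2 * pi * ?y = \<xi> $ i + pi" by simp
      moreover have "(\<xi> - (2 * pi) *\<^sub>R l) $ i = \<xi> $ i - 2 * pi * real_of_int \<lfloor>?y\<rfloor>" by (simp add: l_def)
      ultimately show "- pi \<le> (\<xi> - (2 * pi) *\<^sub>R l) $ i \<and> (\<xi> - (2 * pi) *\<^sub>R l) $ i < pi"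
        by (simp only: distrib_left) linarith
    qed
    then have "P (\<xi> - (2 * pi) *\<^sub>R l)" using * l by blast
    then show "P \<xi>" using per[OF l, of "\<xi> - (2 * pi) *\<^sub>R l"] by simp
  qed
qed

section \<open>Closed spans\<close>

definition closed_span :: "'i set \<Rightarrow> ('i \<Rightarrow> real ^ 'd \<Rightarrow> complex) \<Rightarrow> (real ^ 'd \<Rightarrow> complex) set" where
  "closed_span I h = {f \<in> sq_int lebesgue. \<forall>e>0. \<exists>g\<in>lincombs I h. norm2 lebesgue (\<lambda>x. f x - g x) < e}"

lemma closed_spanD:
  assumes "f \<in> closed_span I h"
  shows "f \<in> sq_int lebesgue" and "0 < e \<Longrightarrow> \<exists>g\<in>lincombs I h. norm2 lebesgue (\<lambda>x. f x - g x) < e"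
  using assms by (auto simp: closed_span_def)

lemma closed_spanI:
  "f \<in> sq_int lebesgue \<Longrightarrow> (\<And>e. 0 < e \<Longrightarrow> \<exists>g\<in>lincombs I h. norm2 lebesgue (\<lambda>x. f x - g x) < e) \<Longrightarrow> f \<in> closed_span I h"
  by (simp add: closed_span_def)

lemma norm2_zero [simp]: "norm2 M (\<lambda>x. 0) = 0"
  by (simp add: norm2_def)

lemma lincombs_closed_span:
  assumes "\<And>i. i \<in> I \<Longrightarrow> h i \<in> sq_int lebesgue" "g \<in> lincombs I h"
  shows "g \<in> closed_span I h"
proof (rule closed_spanI)
  show "g \<in> sq_int lebesgue" by (rule lincombs_sq_int[OF assms])
  show "\<exists>g'\<in>lincombs I h. norm2 lebesgue (\<lambda>x. g x - g' x) < e" if "0 < e" for e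
    using assms(2) that by (intro bexI[of _ g]) auto
qed

lemma closed_span_closed:
  assumes h: "\<And>i. i \<in> I \<Longrightarrow> h i \<in> sq_int lebesgue" and f: "f \<in> sq_int lebesgue"
    and ap: "\<And>e. 0 < e \<Longrightarrow> \<exists>g\<in>closed_span I h. norm2 lebesgue (\<lambda>x. f x - g x) < e"
  shows "f \<in> closed_span I h"
proof (rule closed_spanI[OF f])
  fix e :: real assume "0 < e"
  then have e2: "0 < e / 2" by simp
  obtain g where g: "g \<in> closed_span I h" "norm2 lebesgue (\<lambda>x. f x - g x) < e / 2" using ap[OF e2] by blast
  obtain k where k: "k \<in> lincombs I h" "norm2 lebesgue (\<lambda>x. g x - k x) < e / 2" using closed_spanD(2)[OF g(1) e2] by blast
  have "norm2 lebesgue (\<lambda>x. f x - k x) \<le> norm2 lebesgue (\<lambda>x. f x - g x) + norm2 lebesgue (\<lambda>x. g x - k x)"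
    by (intro norm2_triangle_diff f closed_spanD(1)[OF g(1)] lincombs_sq_int[OF h k(1)])
  then have "norm2 lebesgue (\<lambda>x. f x - k x) < e" using g(2) k(2) by linarith
  then show "\<exists>k\<in>lincombs I h. norm2 lebesgue (\<lambda>x. f x - k x) < e" using k(1) by blast
qed

lemma closed_span_cmult:
  assumes f: "f \<in> closed_span I h"
  shows "(\<lambda>x. a * f x) \<in> closed_span I h"
proof (rule closed_spanI)
  show "(\<lambda>x. a * f x) \<in> sq_int lebesgue" by (rule sq_int_cmult[OF closed_spanD(1)[OF f]])
  fix e :: real assume e: "0 < e"
  have pos: "0 < cmod a + 1" by (simp add: add_nonneg_pos)
  then have "0 < e / (cmod a + 1)" using e by simp
  from closed_spanD(2)[OF f this] obtain g where g: "g \<in> lincombs I h" "norm2 lebesgue (\<lambda>x. f x - g x) < e / (cmod a + 1)"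
    by blast
  have "norm2 lebesgue (\<lambda>x. a * f x - a * g x) = cmod a * norm2 lebesgue (\<lambda>x. f x - g x)"
    unfolding right_diff_distrib[symmetric] by (rule norm2_cmult)
  also have "\<dots> \<le> (cmod a + 1) * norm2 lebesgue (\<lambda>x. f x - g x)"
    by (intro mult_right_mono) simp_all
  also have "\<dots> < (cmod a + 1) * (e / (cmod a + 1))"
    using g(2) pos by (rule mult_strict_left_mono)
  also have "\<dots> = e" using pos by simp
  finally show "\<exists>g\<in>lincombs I h. norm2 lebesgue (\<lambda>x. a * f x - g x) < e"
    using lincombs_cmult[OF g(1)] by (rule bexI)
qed

lemma closed_span_add:
  assumes h: "\<And>i. i \<in> I \<Longrightarrow> h i \<in> sq_int lebesgue" and f: "f \<in> closed_span I h" and f': "f' \<in> closed_span I h"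
  shows "(\<lambda>x. f x + f' x) \<in> closed_span I h"
proof (rule closed_spanI)
  show "(\<lambda>x. f x + f' x) \<in> sq_int lebesgue" by (intro sq_int_add closed_spanD(1)[OF f] closed_spanD(1)[OF f'])
  fix e :: real assume "0 < e"
  then have e2: "0 < e / 2" by simp
  obtain g where g: "g \<in> lincombs I h" "norm2 lebesgue (\<lambda>x. f x - g x) < e / 2" using closed_spanD(2)[OF f e2] by blast
  obtain g' where g': "g' \<in> lincombs I h" "norm2 lebesgue (\<lambda>x. f' x - g' x) < e / 2" using closed_spanD(2)[OF f' e2] by blast
  have "norm2 lebesgue (\<lambda>x. (f x - g x) + (f' x - g' x)) \<le> norm2 lebesgue (\<lambda>x. f x - g x) + norm2 lebesgue (\<lambda>x. f' x - g' x)"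
    by (intro norm2_triangle sq_int_diff closed_spanD(1)[OF f] closed_spanD(1)[OF f'] lincombs_sq_int[OF h g(1)] lincombs_sq_int[OF h g'(1)])
  moreover have "(\<lambda>x. (f x - g x) + (f' x - g' x)) = (\<lambda>x. (f x + f' x) - (g x + g' x))"
    by (simp add: fun_eq_iff)
  ultimately have "norm2 lebesgue (\<lambda>x. (f x + f' x) - (g x + g' x)) < e" using g(2) g'(2) by simp
  then show "\<exists>k\<in>lincombs I h. norm2 lebesgue (\<lambda>x. (f x + f' x) - k x) < e"
    using lincombs_add[OF g(1) g'(1)] by (rule bexI)
qed

lemma closed_span_sum:
  assumes h: "\<And>i. i \<in> I \<Longrightarrow> h i \<in> sq_int lebesgue" and "\<And>i. i \<in> F \<Longrightarrow> f i \<in> closed_span I h"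
  shows "(\<lambda>x. \<Sum>i\<in>F. c i * f i x) \<in> closed_span I h"
  using assms(2)
proof (induction F rule: infinite_finite_induct)
  case (insert i F)
  have "(\<lambda>x. c i * f i x + (\<Sum>i\<in>F. c i * f i x)) \<in> closed_span I h"
    by (intro closed_span_add[OF h] closed_span_cmult insert.IH insert.prems) auto
  then show ?case using insert.hyps by simp
qed (simp_all add: lincombs_closed_span[OF h lincombs_0])

lemma closed_span_orthogonal:
  assumes h: "\<And>i. i \<in> I \<Longrightarrow> h i \<in> sq_int lebesgue" and f: "f \<in> closed_span I h" and v: "v \<in> sq_int lebesgue"
    and orth: "\<And>i. i \<in> I \<Longrightarrow> ip2 lebesgue (h i) v = 0"
  shows "ip2 lebesgue f v = 0"
proof -
  have g0: "ip2 lebesgue g v = 0" if g: "g \<in> lincombs I h" for g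
  proof -
    obtain F c where F: "finite F" "F \<subseteq> I" "g = (\<lambda>x. \<Sum>i\<in>F. c i * h i x)" using g by (rule lincombsE)
    have "ip2 lebesgue g v = (\<Sum>i\<in>F. c i * ip2 lebesgue (h i) v)"
      unfolding F(3) using F(2) h v by (intro ip2_sum_left) auto
    also have "\<dots> = 0" using F(2) orth by (intro sum.neutral) auto
    finally show ?thesis .
  qed
  have "cmod (ip2 lebesgue f v) \<le> e" if e: "0 < e" for e
  proof -
    have pos: "0 < norm2 lebesgue v + 1" by (simp add: add_nonneg_pos)
    then have "0 < e / (norm2 lebesgue v + 1)" using e by simp
    from closed_spanD(2)[OF f this] obtain g where g: "g \<in> lincombs I h"
      "norm2 lebesgue (\<lambda>x. f x - g x) < e / (norm2 lebesgue v + 1)" by blast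
    have gs: "g \<in> sq_int lebesgue" by (rule lincombs_sq_int[OF h g(1)])
    have "ip2 lebesgue f v = ip2 lebesgue (\<lambda>x. f x - g x) v"
      by (subst ip2_diff_left[OF closed_spanD(1)[OF f] gs v]) (simp add: g0[OF g(1)])
    also have "cmod \<dots> \<le> norm2 lebesgue (\<lambda>x. f x - g x) * norm2 lebesgue v"
      by (intro Cauchy_Schwarz_ip2 sq_int_diff closed_spanD(1)[OF f] gs v)
    also have "\<dots> \<le> e / (norm2 lebesgue v + 1) * (norm2 lebesgue v + 1)"
      using g(2) e pos by (intro mult_mono) (auto intro: divide_nonneg_pos)
    also have "\<dots> = e" using pos by simp
    finally show ?thesis .
  qed
  then have "cmod (ip2 lebesgue f v) \<le> 0" by (rule field_le_epsilon[of _ 0, simplified])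
  then show ?thesis by simp
qed

text \<open>The expansion of \<open>f\<close> involves only the vectors with index in \<open>A\<close>. For a finite approximant \<open>p\<close> of \<open>f\<close>, the coefficients
  of \<open>p\<close> outside \<open>A\<close> are, up to sign, the inner products of \<open>f - p\<close> with dual vectors. Bessel's inequality
  bounds them by the norm of \<open>f - p\<close>, so the part of \<open>p\<close> outside \<open>A\<close> is small and can be dropped.\<close>
lemma riesz_biorthogonal_closed_span:
  fixes h g :: "'i \<Rightarrow> real ^ 'd \<Rightarrow> complex"
  assumes R: "riesz_basis I h" and Rg: "riesz_basis I g"
    and bi: "\<And>i j. i \<in> I \<Longrightarrow> j \<in> I \<Longrightarrow> ip2 lebesgue (h i) (g j) = of_bool (i = j)"
    and A: "A \<subseteq> I" and f: "f \<in> sq_int lebesgue"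
    and orth: "\<And>i. i \<in> I - A \<Longrightarrow> ip2 lebesgue f (g i) = 0"
  shows "f \<in> closed_span A h"
proof -
  obtain C3 C4 where h: "\<And>i. i \<in> I \<Longrightarrow> h i \<in> sq_int lebesgue"
    and dense: "\<And>f e. f \<in> sq_int lebesgue \<Longrightarrow> 0 < e \<Longrightarrow> \<exists>g\<in>lincombs I h. norm2 lebesgue (\<lambda>x. f x - g x) < e"
    and C4: "0 < C4"
    and upper: "\<And>F c. finite F \<Longrightarrow> F \<subseteq> I \<Longrightarrow> (norm2 lebesgue (\<lambda>x. \<Sum>i\<in>F. c i * h i x))\<^sup>2 \<le> C4 * (\<Sum>i\<in>F. (cmod (c i))\<^sup>2)"
    using R by (rule riesz_basisE) blast
  obtain D3 D4 where g: "\<And>i. i \<in> I \<Longrightarrow> g i \<in> sq_int lebesgue" and D4: "0 < D4"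
    and upperg: "\<And>F c. finite F \<Longrightarrow> F \<subseteq> I \<Longrightarrow> (norm2 lebesgue (\<lambda>x. \<Sum>i\<in>F. c i * g i x))\<^sup>2 \<le> D4 * (\<Sum>i\<in>F. (cmod (c i))\<^sup>2)"
    using Rg by (rule riesz_basisE) blast
  show ?thesis
  proof (rule closed_spanI[OF f])
    fix e :: real assume e: "0 < e"
    \<comment> \<open>The two summands account for the error of \<open>p\<close> and for the part of \<open>p\<close> that is dropped.\<close>
    define K where "K = 1 + sqrt (C4 * D4)"
    have K: "0 < K" using C4 D4 by (simp add: K_def add_pos_nonneg)
    then have "0 < e / K" using e by simp
    from dense[OF f this] obtain p where p: "p \<in> lincombs I h" and pe: "norm2 lebesgue (\<lambda>x. f x - p x) < e / K" by blast
    obtain F c where F: "finite F" "F \<subseteq> I" "p = (\<lambda>x. \<Sum>i\<in>F. c i * h i x)" using p by (rule lincombsE)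
    have ps: "p \<in> sq_int lebesgue" by (rule lincombs_sq_int[OF h p])
    define q where "q = (\<lambda>x. \<Sum>i\<in>F \<inter> A. c i * h i x)"
    define t where "t = (\<lambda>x. \<Sum>i\<in>F - A. c i * h i x)"
    have pqt: "p x = q x + t x" for x
      unfolding F(3) q_def t_def using F(1)
      by (subst sum.union_disjoint[symmetric]) (auto intro!: sum.cong)
    have q: "q \<in> lincombs A h" unfolding q_def using F(1) by (intro lincombsI) auto
    have qs: "q \<in> sq_int lebesgue" and ts: "t \<in> sq_int lebesgue"
      unfolding q_def t_def using F(2) h by (auto intro!: sq_int_lincomb)
    have coef: "c i = - ip2 lebesgue (\<lambda>x. f x - p x) (g i)" if i: "i \<in> F - A" for i
    proof -
      have iI: "i \<in> I" "i \<in> I - A" using i F(2) by auto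
      have "ip2 lebesgue p (g i) = (\<Sum>j\<in>F. c j * ip2 lebesgue (h j) (g i))"
        unfolding F(3) using F(2) h g iI by (intro ip2_sum_left) auto
      also have "\<dots> = (\<Sum>j\<in>F. if j = i then c j else 0)"
        using F(2) bi iI by (intro sum.cong) auto
      also have "\<dots> = c i" using F(1) i by simp
      finally have "ip2 lebesgue p (g i) = c i" .
      then show ?thesis using orth[OF iI(2)] by (subst ip2_diff_left[OF f ps g[OF iI(1)]]) simp
    qed
    have "(\<Sum>i\<in>F - A. (cmod (c i))\<^sup>2) = (\<Sum>i\<in>F - A. (cmod (ip2 lebesgue (\<lambda>x. f x - p x) (g i)))\<^sup>2)"
      by (intro sum.cong refl) (simp add: coef)
    also have "\<dots> \<le> D4 * (norm2 lebesgue (\<lambda>x. f x - p x))\<^sup>2"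
      using F(1,2) D4 by (intro bessel_inequality upperg g sq_int_diff f ps) auto
    also have "\<dots> \<le> D4 * (e / K)\<^sup>2"
      using D4 pe by (intro mult_left_mono power_mono) auto
    finally have c2: "(\<Sum>i\<in>F - A. (cmod (c i))\<^sup>2) \<le> D4 * (e / K)\<^sup>2" .
    have "(norm2 lebesgue t)\<^sup>2 \<le> C4 * (\<Sum>i\<in>F - A. (cmod (c i))\<^sup>2)"
      unfolding t_def using F(1,2) by (intro upper) auto
    also have "\<dots> \<le> C4 * (D4 * (e / K)\<^sup>2)"
      using C4 c2 by (intro mult_left_mono) auto
    also have "\<dots> = (sqrt (C4 * D4) * (e / K))\<^sup>2"
    proof -
      have "(sqrt (C4 * D4))\<^sup>2 = C4 * D4" using C4 D4 by simp
      then show ?thesis by (simp only: power_mult_distrib mult.assoc)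
    qed
    finally have tn: "norm2 lebesgue t \<le> sqrt (C4 * D4) * (e / K)"
      by (rule power2_le_imp_le) (use C4 D4 e K in simp)
    have "norm2 lebesgue (\<lambda>x. f x - q x) = norm2 lebesgue (\<lambda>x. (f x - p x) + t x)"
      by (simp add: pqt)
    also have "\<dots> \<le> norm2 lebesgue (\<lambda>x. f x - p x) + norm2 lebesgue t"
      by (intro norm2_triangle sq_int_diff f ps ts)
    also have "\<dots> < e / K + sqrt (C4 * D4) * (e / K)" using pe tn by linarith
    also have "\<dots> = K * (e / K)" by (simp only: K_def distrib_right mult_1)
    also have "\<dots> = e" using K by simp
    finally show "\<exists>q\<in>lincombs A h. norm2 lebesgue (\<lambda>x. f x - q x) < e" using q by blast
  qed
qed

section \<open>Matrix powers, dilations and shifts\<close>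

lemma mat_powi_0: "mat_powi A 0 = mat 1"
  by (simp add: mat_powi_def)

lemma mat_powi_Suc:
  assumes A: "invertible A"
  shows "mat_powi A (j + 1) = A ** mat_powi A j"
proof (cases "0 \<le> j")
  case True
  then have "nat (j + 1) = Suc (nat j)" by simp
  then show ?thesis using True by (simp add: mat_powi_def)
next
  case False
  then have n: "nat (- j) = Suc (nat (- (j + 1)))" by simp
  have "mat_powi A j = matrix_inv A ** ((((**) (matrix_inv A)) ^^ nat (- (j + 1))) (mat 1))"
    using False unfolding mat_powi_def n by simp
  moreover have "(((**) (matrix_inv A)) ^^ nat (- (j + 1))) (mat 1) = mat_powi A (j + 1)"
    using False by (cases "j = -1") (auto simp: mat_powi_def)
  ultimately show ?thesis by (simp add: matrix_mul_assoc matrix_inv_cancel[OF A])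
qed

lemma mat_powi_add:
  assumes A: "invertible A"
  shows "mat_powi A (i + j) = mat_powi A i ** mat_powi A j"
proof (induction i rule: int_induct[where k=0])
  case base
  then show ?case by (simp add: mat_powi_0)
next
  case (step1 i)
  have "mat_powi A (i + 1 + j) = A ** mat_powi A (i + j)"
    using mat_powi_Suc[OF A, of "i + j"] by (simp add: algebra_simps)
  then show ?case by (simp add: step1 mat_powi_Suc[OF A] matrix_mul_assoc)
next
  case (step2 i)
  have pred: "mat_powi A (k - 1) = matrix_inv A ** mat_powi A k" for k
    using mat_powi_Suc[OF A, of "k - 1"] by (simp add: matrix_mul_assoc matrix_inv_cancel[OF A])
  have "mat_powi A (i - 1 + j) = matrix_inv A ** mat_powi A (i + j)"
    using pred[of "i + j"] by (simp add: algebra_simps)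
  then show ?case by (simp add: step2 pred matrix_mul_assoc)
qed

lemma det_mat_powi_nz:
  assumes A: "invertible A"
  shows "det (mat_powi A j) \<noteq> 0"
proof -
  have "mat_powi A j ** mat_powi A (- j) = mat 1"
    using mat_powi_add[OF A, of j "- j"] by (simp add: mat_powi_0)
  then have "det (mat_powi A j) * det (mat_powi A (- j)) = 1"
    by (metis det_mul det_I)
  then show ?thesis by auto
qed

lemma mat_powi_minus_1:
  assumes A: "invertible A"
  shows "mat_powi A (- 1) = matrix_inv A"
  by (simp add: mat_powi_def)

lemma dil_shift_sq_int:
  assumes U: "det U \<noteq> 0" and f: "f \<in> sq_int lebesgue"
  shows "dil_shift U k f \<in> sq_int lebesgue"
  unfolding dil_shift_def by (intro sq_int_cmult sq_int_scales_lborel[OF scales_lborel_affine[OF U]] f)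

lemma dil_shift_ip2:
  assumes U: "det U \<noteq> 0" and f: "f \<in> sq_int lebesgue" and g: "g \<in> sq_int lebesgue"
  shows "ip2 lebesgue (dil_shift U k f) (dil_shift U k g) = ip2 lebesgue f g"
proof -
  have "complex_of_real (sqrt \<bar>det U\<bar>) * complex_of_real (sqrt \<bar>det U\<bar>) = complex_of_real \<bar>det U\<bar>"
    by (simp flip: of_real_mult)
  then show ?thesis
    unfolding dil_shift_def ip2_cmult_left ip2_cmult_right ip2_scales_lborel[OF scales_lborel_affine[OF U] f g]
    using U by (simp add: mult.assoc[symmetric])
qed

lemma dil_shift_norm2:
  assumes U: "det U \<noteq> 0" and f: "f \<in> sq_int lebesgue"
  shows "norm2 lebesgue (dil_shift U k f) = norm2 lebesgue f"
  unfolding dil_shift_def norm2_cmult norm2_scales_lborel[OF scales_lborel_affine[OF U] sq_int_meas[OF f]]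
  using U by simp

lemma dil_shift_mult: "dil_shift (A ** B) k f = dil_shift B 0 (dil_shift A k f)"
  by (simp add: dil_shift_def fun_eq_iff det_mul abs_mult real_sqrt_mult matrix_vector_mul_assoc mult_ac)

lemma dil_shift_translate: "dil_shift (mat 1) l (dil_shift A k f) = dil_shift A (A *v l + k) f"
  by (simp add: dil_shift_def fun_eq_iff matrix_vector_mult_diff_distrib algebra_simps)

lemma dil_shift_sum: "dil_shift U k (\<lambda>x. \<Sum>i\<in>F. c i * h i x) = (\<lambda>x. \<Sum>i\<in>F. c i * dil_shift U k (h i) x)"
  by (simp add: dil_shift_def fun_eq_iff sum_distrib_left mult_ac)

lemma dil_shift_diff: "dil_shift U k (\<lambda>x. f x - g x) = (\<lambda>x. dil_shift U k f x - dil_shift U k g x)"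
  by (simp add: dil_shift_def fun_eq_iff right_diff_distrib)

text \<open>Dilated shifts act isometrically and linearly, so it suffices to know where they send the spanning vectors.\<close>
lemma closed_span_dil_shift:
  assumes U: "det U \<noteq> 0" and h: "\<And>i. i \<in> I \<Longrightarrow> h i \<in> sq_int lebesgue"
    and h': "\<And>i. i \<in> I' \<Longrightarrow> h' i \<in> sq_int lebesgue"
    and maps: "\<And>i. i \<in> I \<Longrightarrow> dil_shift U k (h i) \<in> closed_span I' h'"
    and f: "f \<in> closed_span I h"
  shows "dil_shift U k f \<in> closed_span I' h'"
proof (rule closed_span_closed[OF h' dil_shift_sq_int[OF U closed_spanD(1)[OF f]]])
  fix e :: real assume "0 < e"
  from closed_spanD(2)[OF f this] obtain g where g: "g \<in> lincombs I h" and ge: "norm2 lebesgue (\<lambda>x. f x - g x) < e" by blast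
  have gs: "g \<in> sq_int lebesgue" by (rule lincombs_sq_int[OF h g])
  obtain F c where F: "finite F" "F \<subseteq> I" "g = (\<lambda>x. \<Sum>i\<in>F. c i * h i x)" using g by (rule lincombsE)
  have "dil_shift U k g \<in> closed_span I' h'"
    unfolding F(3) dil_shift_sum using F(2) by (intro closed_span_sum[OF h'] maps) auto
  moreover have "norm2 lebesgue (\<lambda>x. dil_shift U k f x - dil_shift U k g x) < e"
    unfolding dil_shift_diff[symmetric] dil_shift_norm2[OF U sq_int_diff[OF closed_spanD(1)[OF f] gs]] by (rule ge)
  ultimately show "\<exists>g\<in>closed_span I' h'. norm2 lebesgue (\<lambda>x. dil_shift U k f x - g x) < e" by blast
qed

section \<open>Closed spans of integer shifts on the Fourier side\<close>

text \<open>The system of all shifts of the generators, without dilation; the index consists of the number of the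
  generator and the shift.\<close>
definition shifts :: "(nat \<Rightarrow> real ^ 'd \<Rightarrow> complex) \<Rightarrow> nat \<times> (real ^ 'd) \<Rightarrow> real ^ 'd \<Rightarrow> complex" where
  "shifts \<phi> i = (\<lambda>x. \<phi> (fst i) (x - snd i))"

abbreviation shift_index :: "nat \<Rightarrow> (nat \<times> (real ^ 'd)) set" where
  "shift_index r \<equiv> {1..r} \<times> int_lattice"

lemma shifts_dil_shift: "shifts \<phi> (l, k) = dil_shift (mat 1) k (\<phi> l)"
  by (simp add: shifts_def dil_shift_def)

lemma shifts_sq_int:
  assumes "\<forall>l\<in>{1..r}. \<phi> l \<in> sq_int lebesgue" "i \<in> shift_index r"
  shows "shifts \<phi> i \<in> sq_int lebesgue"
  using assms by (cases i) (auto simp: shifts_dil_shift intro!: dil_shift_sq_int)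

text \<open>The trigonometric polynomial that multiplies the transform of generator \<open>m\<close> in the transform of the
  combination of shifts with index set \<open>F\<close> and coefficients \<open>c\<close>.\<close>
definition symbol :: "(nat \<times> (real ^ 'd)) set \<Rightarrow> (nat \<times> (real ^ 'd) \<Rightarrow> complex) \<Rightarrow> nat \<Rightarrow> real ^ 'd \<Rightarrow> complex" where
  "symbol F c m \<xi> = (\<Sum>k\<in>Pair m -` F. c (m, k) * wave k \<xi>)"

text \<open>A relation between a combination of shifts and its symbols, because the function determines the symbols
  only if the shifts are independent, and because both have to be subtracted together.\<close>
definition combination :: "(nat \<Rightarrow> real ^ 'd \<Rightarrow> complex) \<Rightarrow> nat \<Rightarrow> (real ^ 'd \<Rightarrow> complex) \<Rightarrow> (nat \<Rightarrow> real ^ 'd \<Rightarrow> complex) \<Rightarrow> bool" where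
  "combination \<phi> r g p \<longleftrightarrow> (\<exists>F c. finite F \<and> F \<subseteq> shift_index r \<and>
     g = (\<lambda>x. \<Sum>i\<in>F. c i * shifts \<phi> i x) \<and> p = symbol F c)"

lemma combinationE:
  assumes "combination \<phi> r g p"
  obtains F c where "finite F" "F \<subseteq> shift_index r" "g = (\<lambda>x. \<Sum>i\<in>F. c i * shifts \<phi> i x)" "p = symbol F c"
  using assms unfolding combination_def by blast

lemma finite_Pair_vimage: "finite F \<Longrightarrow> finite (Pair m -` F)"
  by (rule finite_vimageI) (auto intro: inj_onI)

lemma sum_shift_index:
  fixes r :: nat
  assumes F: "finite F" "F \<subseteq> shift_index r"
  shows "(\<Sum>i\<in>F. t i) = (\<Sum>m=1..r. \<Sum>k\<in>Pair m -` F. t (m, k))"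
proof -
  have eq: "F = Sigma {1..r} (\<lambda>m. Pair m -` F)" using F(2) by auto
  have "(\<Sum>m=1..r. \<Sum>k\<in>Pair m -` F. t (m, k)) = (\<Sum>(m, k)\<in>Sigma {1..r} (\<lambda>m. Pair m -` F). t (m, k))"
    using F(1) by (intro sum.Sigma) (auto intro: finite_Pair_vimage)
  then show ?thesis by (simp only: eq[symmetric]) simp
qed

lemma lincombs_combination:
  "g \<in> lincombs (shift_index r) (shifts \<phi>) \<longleftrightarrow> (\<exists>p. combination \<phi> r g p)"
  unfolding lincombs_def combination_def by blast

lemma combination_diff:
  assumes "combination \<phi> r g p" "combination \<phi> r g' p'"
  shows "combination \<phi> r (\<lambda>x. g x - g' x) (\<lambda>m \<xi>. p m \<xi> - p' m \<xi>)"
proof -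
  obtain F c where F: "finite F" "F \<subseteq> shift_index r" "g = (\<lambda>x. \<Sum>i\<in>F. c i * shifts \<phi> i x)" "p = symbol F c"
    using assms(1) by (rule combinationE)
  obtain F' c' where F': "finite F'" "F' \<subseteq> shift_index r" "g' = (\<lambda>x. \<Sum>i\<in>F'. c' i * shifts \<phi> i x)" "p' = symbol F' c'"
    using assms(2) by (rule combinationE)
  define G where "G = F \<union> F'"
  define d where "d = (\<lambda>i. (if i \<in> F then c i else 0) - (if i \<in> F' then c' i else 0))"
  have G: "finite G" "F \<subseteq> G" "F' \<subseteq> G" using F F' by (auto simp: G_def)
  show ?thesis
    unfolding combination_def
  proof (intro exI conjI)
    show "finite G" by fact
    show "G \<subseteq> shift_index r" using F F' by (auto simp: G_def)
    show "(\<lambda>x. g x - g' x) = (\<lambda>x. \<Sum>i\<in>G. d i * shifts \<phi> i x)"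
      unfolding F(3) F'(3) d_def left_diff_distrib sum_subtractf
        sum_extend_zero[OF G(1,2)] sum_extend_zero[OF G(1,3)] ..
    show "(\<lambda>m \<xi>. p m \<xi> - p' m \<xi>) = symbol G d"
    proof (intro ext)
      fix m \<xi>
      have V: "finite (Pair m -` G)" "Pair m -` F \<subseteq> Pair m -` G" "Pair m -` F' \<subseteq> Pair m -` G"
        using G by (auto intro: finite_Pair_vimage)
      show "p m \<xi> - p' m \<xi> = symbol G d m \<xi>"
        unfolding F(4) F'(4) symbol_def d_def left_diff_distrib sum_subtractf
        by (subst sum_extend_zero[OF V(1,2)], subst sum_extend_zero[OF V(1,3)]) (simp add: vimage_def)
    qed
  qed
qed

text \<open>The symbols of a combination vanish for indices outside \<open>{1..r}\<close>, hence the prescribed polynomials can be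
  matched on \<open>{1..r}\<close> only.\<close>
lemma combination_exists:
  assumes p: "\<And>m. m \<in> {1..r} \<Longrightarrow> p m \<in> trigs"
  shows "\<exists>g p'. combination \<phi> r g p' \<and> (\<forall>m\<in>{1..r}. p' m = p m)"
proof -
  have "\<forall>m\<in>{1..r}. \<exists>F c. finite F \<and> F \<subseteq> int_lattice \<and> p m = (\<lambda>\<xi>. \<Sum>k\<in>F. c k * wave k \<xi>)"
    using p unfolding trigs_def lincombs_def by blast
  then obtain F c where F: "\<And>m. m \<in> {1..r} \<Longrightarrow> finite (F m)" "\<And>m. m \<in> {1..r} \<Longrightarrow> F m \<subseteq> int_lattice"
    "\<And>m. m \<in> {1..r} \<Longrightarrow> p m = (\<lambda>\<xi>. \<Sum>k\<in>F m. c m k * wave k \<xi>)"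
    by metis
  define G where "G = Sigma {1..r} F"
  define d where "d = (\<lambda>i. c (fst i) (snd i))"
  show ?thesis
  proof (intro exI conjI ballI)
    show "combination \<phi> r (\<lambda>x. \<Sum>i\<in>G. d i * shifts \<phi> i x) (symbol G d)"
      unfolding combination_def
    proof (intro exI conjI)
      show "finite G" unfolding G_def using F(1) by (intro finite_SigmaI) auto
      show "G \<subseteq> shift_index r" using F(2) unfolding G_def by blast
    qed (rule refl)+
    show "symbol G d m = p m" if m: "m \<in> {1..r}" for m
    proof -
      have "Pair m -` G = F m" using m by (auto simp: G_def)
      then show ?thesis unfolding F(3)[OF m] by (simp add: symbol_def fun_eq_iff d_def)
    qed
  qed
qed

lemma combination_trigs:
  assumes "combination \<phi> r g p"
  shows "p m \<in> trigs"
proof -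
  obtain F c where F: "finite F" "F \<subseteq> shift_index r" "p = symbol F c"
    using assms by (rule combinationE)
  have "(\<lambda>\<xi>. \<Sum>k\<in>Pair m -` F. c (m, k) * wave k \<xi>) \<in> trigs"
    unfolding trigs_def using F(1,2) by (intro lincombsI finite_Pair_vimage) auto
  then show ?thesis by (simp add: F(3) symbol_def[abs_def])
qed

lemma combination_fourier:
  fixes \<phi> :: "nat \<Rightarrow> real ^ 'd \<Rightarrow> complex"
  assumes \<phi>: "\<forall>l\<in>{1..r}. \<phi> l \<in> sq_int lebesgue" and g: "combination \<phi> r g p"
  shows "is_fourier_L2 g (\<lambda>\<xi>. \<Sum>m=1..r. p m \<xi> * fourier_L2 (\<phi> m) \<xi>)"
proof -
  obtain F c where F: "finite F" "F \<subseteq> shift_index r" "g = (\<lambda>x. \<Sum>i\<in>F. c i * shifts \<phi> i x)" "p = symbol F c"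
    using g by (rule combinationE)
  have "is_fourier_L2 g (\<lambda>\<xi>. \<Sum>i\<in>F. c i * (wave (snd i) \<xi> * fourier_L2 (\<phi> (fst i)) \<xi>))"
    unfolding F(3)
  proof (rule is_fourier_L2_lincomb)
    fix i assume "i \<in> F"
    then have "\<phi> (fst i) \<in> sq_int lebesgue" using F(2) \<phi> by auto
    from is_fourier_L2_translate[OF fourier_L2_is_fourier[OF this]]
    show "is_fourier_L2 (shifts \<phi> i) (\<lambda>\<xi>. wave (snd i) \<xi> * fourier_L2 (\<phi> (fst i)) \<xi>)"
      unfolding shifts_def .
  qed
  also have "(\<lambda>\<xi>. \<Sum>i\<in>F. c i * (wave (snd i) \<xi> * fourier_L2 (\<phi> (fst i)) \<xi>))
      = (\<lambda>\<xi>. \<Sum>m=1..r. p m \<xi> * fourier_L2 (\<phi> m) \<xi>)"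
    unfolding sum_shift_index[OF F(1,2)] F(4) symbol_def by (simp add: sum_distrib_right mult.assoc)
  finally show ?thesis .
qed

lemma combination_parseval:
  assumes "finite F" "F \<subseteq> shift_index r"
  shows "(\<Sum>m=1..r. (norm2 torus (symbol F c m))\<^sup>2)
    = (2 * pi) ^ CARD('d) * (\<Sum>i\<in>F. (cmod (c (i :: nat \<times> (real ^ 'd))))\<^sup>2)"
proof -
  have "(norm2 torus (symbol F c m))\<^sup>2 = (2 * pi) ^ CARD('d) * (\<Sum>k\<in>Pair m -` F. (cmod (c (m, k)))\<^sup>2)" for m
    unfolding symbol_def using assms by (intro parseval_torus finite_Pair_vimage) auto
  then show ?thesis by (simp add: sum_shift_index[OF assms] sum_distrib_left)
qed

text \<open>The shifts form a Riesz sequence. One constant serves for both inequalities, since each is weakened by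
  enlarging it.\<close>
definition shift_bounds :: "(nat \<Rightarrow> real ^ 'd \<Rightarrow> complex) \<Rightarrow> nat \<Rightarrow> real \<Rightarrow> bool" where
  "shift_bounds \<phi> r K \<longleftrightarrow> 0 < K \<and> (\<forall>l\<in>{1..r}. \<phi> l \<in> sq_int lebesgue) \<and>
    (\<forall>F c. finite F \<longrightarrow> F \<subseteq> shift_index r \<longrightarrow>
      (\<Sum>i\<in>F. (cmod (c i))\<^sup>2) \<le> K * (norm2 lebesgue (\<lambda>x. \<Sum>i\<in>F. c i * shifts \<phi> i x))\<^sup>2
    \<and> (norm2 lebesgue (\<lambda>x. \<Sum>i\<in>F. c i * shifts \<phi> i x))\<^sup>2 \<le> K * (\<Sum>i\<in>F. (cmod (c i))\<^sup>2))"

text \<open>By Parseval's identity the squared norms of the symbols add up to a constant times the sum of the squared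
  coefficients, which the Riesz bounds compare with the norm of the function.\<close>
lemma combination_bounds:
  fixes \<phi> :: "nat \<Rightarrow> real ^ 'd \<Rightarrow> complex"
  assumes B: "shift_bounds \<phi> r K" and g: "combination \<phi> r g p"
  shows "m \<in> {1..r} \<Longrightarrow> norm2 torus (p m) \<le> sqrt (K * (2 * pi) ^ CARD('d)) * norm2 lebesgue g"
    and "norm2 lebesgue g \<le> sqrt K * (\<Sum>m=1..r. norm2 torus (p m))"
proof -
  have K: "0 < K" using B by (simp add: shift_bounds_def)
  obtain F c where F: "finite F" "F \<subseteq> shift_index r" "g = (\<lambda>x. \<Sum>i\<in>F. c i * shifts \<phi> i x)" "p = symbol F c"
    using g by (rule combinationE)
  have b1: "(\<Sum>i\<in>F. (cmod (c i))\<^sup>2) \<le> K * (norm2 lebesgue g)\<^sup>2"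
    and b2: "(norm2 lebesgue g)\<^sup>2 \<le> K * (\<Sum>i\<in>F. (cmod (c i))\<^sup>2)"
    using B F unfolding shift_bounds_def by blast+
  have par: "(\<Sum>m=1..r. (norm2 torus (p m))\<^sup>2) = (2 * pi) ^ CARD('d) * (\<Sum>i\<in>F. (cmod (c i))\<^sup>2)"
    unfolding F(4) by (rule combination_parseval[OF F(1,2)])
  show "norm2 torus (p m) \<le> sqrt (K * (2 * pi) ^ CARD('d)) * norm2 lebesgue g" if m: "m \<in> {1..r}"
  proof (rule power2_le_imp_le)
    have "(norm2 torus (p m))\<^sup>2 \<le> (\<Sum>m=1..r. (norm2 torus (p m))\<^sup>2)"
      using m by (intro member_le_sum) auto
    also have "\<dots> \<le> (2 * pi) ^ CARD('d) * (K * (norm2 lebesgue g)\<^sup>2)"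
      unfolding par by (intro mult_left_mono b1) simp
    also have "\<dots> = (sqrt (K * (2 * pi) ^ CARD('d)) * norm2 lebesgue g)\<^sup>2"
      using K by (simp add: power_mult_distrib)
    finally show "(norm2 torus (p m))\<^sup>2 \<le> (sqrt (K * (2 * pi) ^ CARD('d)) * norm2 lebesgue g)\<^sup>2" .
  qed (use K in simp)
  have le: "(\<Sum>i\<in>F. (cmod (c i))\<^sup>2) \<le> (\<Sum>m=1..r. (norm2 torus (p m))\<^sup>2)"
  proof -
    have "1 \<le> (2 * pi) ^ CARD('d)" using pi_ge_two by (intro one_le_power) simp
    then have "1 * (\<Sum>i\<in>F. (cmod (c i))\<^sup>2) \<le> (2 * pi) ^ CARD('d) * (\<Sum>i\<in>F. (cmod (c i))\<^sup>2)"
      by (intro mult_right_mono) (auto simp: sum_nonneg)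
    then show ?thesis by (simp only: par mult_1)
  qed
  have sq: "(\<Sum>m=1..r. (norm2 torus (p m))\<^sup>2) \<le> (\<Sum>m=1..r. norm2 torus (p m))\<^sup>2"
  proof -
    have "L2_set (\<lambda>m. norm2 torus (p m)) {1..r} \<le> (\<Sum>m=1..r. norm2 torus (p m))"
      by (rule L2_set_le_sum) simp
    then have "(L2_set (\<lambda>m. norm2 torus (p m)) {1..r})\<^sup>2 \<le> (\<Sum>m=1..r. norm2 torus (p m))\<^sup>2"
      by (intro power_mono) auto
    then show ?thesis by (simp add: L2_set_def sum_nonneg)
  qed
  show "norm2 lebesgue g \<le> sqrt K * (\<Sum>m=1..r. norm2 torus (p m))"
  proof (rule power2_le_imp_le)
    have "(norm2 lebesgue g)\<^sup>2 \<le> K * (\<Sum>m=1..r. norm2 torus (p m))\<^sup>2"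
      using b2 mult_left_mono[OF order_trans[OF le sq], of K] K by linarith
    then show "(norm2 lebesgue g)\<^sup>2 \<le> (sqrt K * (\<Sum>m=1..r. norm2 torus (p m)))\<^sup>2"
      using K by (simp add: power_mult_distrib)
  qed (use K in \<open>simp add: sum_nonneg\<close>)
qed

text \<open>The symbols of combinations converging to \<open>f\<close> form Cauchy sequences on the torus, and their limits are the
  coefficients. Pointwise limits almost everywhere, of the symbols and of the transforms, give the
  equation.\<close>
lemma closed_span_imp_factorisation:
  fixes \<phi> :: "nat \<Rightarrow> real ^ 'd \<Rightarrow> complex"
  assumes B: "shift_bounds \<phi> r K" and f: "f \<in> closed_span (shift_index r) (shifts \<phi>)"
  obtains a where "\<And>m. m \<in> {1..r} \<Longrightarrow> a m \<in> L2_torus"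
    "AE \<xi> in lebesgue. fourier_L2 f \<xi> = (\<Sum>m=1..r. a m \<xi> * fourier_L2 (\<phi> m) \<xi>)"
proof -
  have \<phi>: "\<forall>l\<in>{1..r}. \<phi> l \<in> sq_int lebesgue" and K: "0 < K" using B by (auto simp: shift_bounds_def)
  note fs = closed_spanD(1)[OF f]
  \<comment> \<open>With a geometric rate, convergence in norm implies convergence almost everywhere.\<close>
  have "\<forall>n. \<exists>g. g \<in> lincombs (shift_index r) (shifts \<phi>) \<and> norm2 lebesgue (\<lambda>x. f x - g x) < (1/2) ^ n"
  proof
    fix n
    have "0 < (1/2::real) ^ n" by simp
    from closed_spanD(2)[OF f this]
    show "\<exists>g. g \<in> lincombs (shift_index r) (shifts \<phi>) \<and> norm2 lebesgue (\<lambda>x. f x - g x) < (1/2) ^ n" by blast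
  qed
  then obtain g where g: "\<And>n. g n \<in> lincombs (shift_index r) (shifts \<phi>)"
    and gf: "\<And>n. norm2 lebesgue (\<lambda>x. f x - g n x) < (1/2) ^ n" by metis
  have gs: "g n \<in> sq_int lebesgue" for n by (rule lincombs_sq_int[OF shifts_sq_int[OF \<phi>] g])
  obtain p where p: "\<And>n. combination \<phi> r (g n) (p n)" using g unfolding lincombs_combination by metis
  let ?C = "sqrt ((2 * pi) ^ CARD('d))" and ?D = "sqrt (K * (2 * pi) ^ CARD('d))"
  have gg: "norm2 lebesgue (\<lambda>x. g (Suc n) x - g n x) \<le> 2 * (1/2) ^ n" for n
  proof -
    have "norm2 lebesgue (\<lambda>x. g (Suc n) x - g n x) \<le> norm2 lebesgue (\<lambda>x. g (Suc n) x - f x) + norm2 lebesgue (\<lambda>x. f x - g n x)"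
      by (intro norm2_triangle_diff gs fs)
    also have "\<dots> \<le> (1/2) ^ Suc n + (1/2) ^ n"
      using gf[of n] gf[of "Suc n"] by (intro add_mono) (auto simp: norm2_minus_commute[of _ "g _" f])
    also have "\<dots> \<le> 2 * (1/2) ^ n" by simp
    finally show ?thesis .
  qed
  have step: "norm2 torus (\<lambda>\<xi>. p (Suc n) m \<xi> - p n m \<xi>) \<le> (?D * 2) * (1/2) ^ n" if "m \<in> {1..r}" for n m
  proof -
    have "norm2 torus (\<lambda>\<xi>. p (Suc n) m \<xi> - p n m \<xi>) \<le> ?D * norm2 lebesgue (\<lambda>x. g (Suc n) x - g n x)"
      using combination_bounds(1)[OF B combination_diff[OF p p] that] .
    also have "\<dots> \<le> ?D * (2 * (1/2) ^ n)" using K by (intro mult_left_mono gg) simp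
    finally show ?thesis by simp
  qed
  note pt = combination_trigs[OF p]
  define a where "a = (\<lambda>m \<xi>. lim (\<lambda>n. p n m \<xi>))"
  have a_sq: "a m \<in> sq_int torus" and a_lim: "AE \<xi> in torus. (\<lambda>n. p n m \<xi>) \<longlonglongrightarrow> a m \<xi>" if "m \<in> {1..r}" for m
    unfolding a_def by (rule sq_int_complete[OF trigs_sq_int[OF pt] step[OF that]])+
  have a_per: "a m (\<xi> + (2 * pi) *\<^sub>R l) = a m \<xi>" if "l \<in> int_lattice" for m l \<xi>
    unfolding a_def by (simp only: trigs_periodic[OF pt that])
  have a_meas: "a m \<in> borel_measurable lebesgue" for m
    unfolding a_def by (rule borel_measurable_lim_metric) (rule trigs_measurable[OF pt])
  have a_torus: "a m \<in> L2_torus" if "m \<in> {1..r}" for m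
    unfolding L2_torus_iff using a_meas a_per a_sq[OF that] by blast
  have a_AE: "AE \<xi> in lebesgue. (\<lambda>n. p n m \<xi>) \<longlonglongrightarrow> a m \<xi>" if "m \<in> {1..r}" for m
    by (rule AE_of_periodic[OF a_lim[OF that]]) (simp only: trigs_periodic[OF pt] a_per)
  have a_all: "AE \<xi> in lebesgue. \<forall>m\<in>{1..r}. (\<lambda>n. p n m \<xi>) \<longlonglongrightarrow> a m \<xi>"
    by (subst AE_finite_all) (use a_AE in auto)
  define G where "G = (\<lambda>n \<xi>. \<Sum>m=1..r. p n m \<xi> * fourier_L2 (\<phi> m) \<xi>)"
  have GF: "is_fourier_L2 (g n) (G n)" for n unfolding G_def by (rule combination_fourier[OF \<phi> p])
  note F = fourier_L2_is_fourier[OF fs]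
  have "norm2 lebesgue (\<lambda>\<xi>. G n \<xi> - fourier_L2 f \<xi>) \<le> ?C * (1/2) ^ n" for n
  proof -
    have "norm2 lebesgue (\<lambda>\<xi>. G n \<xi> - fourier_L2 f \<xi>) = ?C * norm2 lebesgue (\<lambda>x. g n x - f x)"
      by (rule is_fourier_L2_norm[OF is_fourier_L2_diff[OF GF F]])
    also have "\<dots> \<le> ?C * (1/2) ^ n"
      using gf[of n] by (intro mult_left_mono) (auto simp: norm2_minus_commute[of _ "g _" f])
    finally show ?thesis .
  qed
  then have "AE \<xi> in lebesgue. (\<lambda>n. G n \<xi>) \<longlonglongrightarrow> fourier_L2 f \<xi>"
    by (rule AE_tendsto_of_geometric_norm2[OF is_fourier_L2_sq_int(2)[OF GF] is_fourier_L2_sq_int(2)[OF F]])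
  with a_all have "AE \<xi> in lebesgue. fourier_L2 f \<xi> = (\<Sum>m=1..r. a m \<xi> * fourier_L2 (\<phi> m) \<xi>)"
  proof eventually_elim
    fix \<xi> assume 1: "\<forall>m\<in>{1..r}. (\<lambda>n. p n m \<xi>) \<longlonglongrightarrow> a m \<xi>" and 2: "(\<lambda>n. G n \<xi>) \<longlonglongrightarrow> fourier_L2 f \<xi>"
    have "(\<lambda>n. G n \<xi>) \<longlonglongrightarrow> (\<Sum>m=1..r. a m \<xi> * fourier_L2 (\<phi> m) \<xi>)"
      unfolding G_def using 1 by (intro tendsto_sum tendsto_mult tendsto_const) auto
    then show "fourier_L2 f \<xi> = (\<Sum>m=1..r. a m \<xi> * fourier_L2 (\<phi> m) \<xi>)" using 2 LIMSEQ_unique by blast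
  qed
  then show thesis using that a_torus by blast
qed

text \<open>The combinations whose symbols approximate the coefficients form a Cauchy sequence. The transform of its
  limit \<open>v\<close> is the given sum of products, so \<open>v = f\<close> almost everywhere.\<close>
lemma factorisation_imp_closed_span:
  fixes \<phi> :: "nat \<Rightarrow> real ^ 'd \<Rightarrow> complex"
  assumes B: "shift_bounds \<phi> r K" and f: "f \<in> sq_int lebesgue"
    and a: "\<And>m. m \<in> {1..r} \<Longrightarrow> a m \<in> L2_torus"
    and eq: "AE \<xi> in lebesgue. fourier_L2 f \<xi> = (\<Sum>m=1..r. a m \<xi> * fourier_L2 (\<phi> m) \<xi>)"
  shows "f \<in> closed_span (shift_index r) (shifts \<phi>)"
proof -
  have \<phi>: "\<forall>l\<in>{1..r}. \<phi> l \<in> sq_int lebesgue" and K: "0 < K" using B by (auto simp: shift_bounds_def)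
  have am: "a m \<in> borel_measurable lebesgue" and as: "a m \<in> sq_int torus"
    and aper: "\<And>l \<xi>. l \<in> int_lattice \<Longrightarrow> a m (\<xi> + (2 * pi) *\<^sub>R l) = a m \<xi>" if "m \<in> {1..r}" for m
    using a[OF that] unfolding L2_torus_iff by blast+
  have "\<forall>n. \<forall>m\<in>{1..r}. \<exists>p. p \<in> trigs \<and> norm2 torus (\<lambda>\<xi>. p \<xi> - a m \<xi>) < (1/2) ^ n"
  proof (intro allI ballI)
    fix n m assume m: "m \<in> {1..r}"
    have "0 < (1/2::real) ^ n" by simp
    from trigs_dense[OF am[OF m] as[OF m] this]
    show "\<exists>p. p \<in> trigs \<and> norm2 torus (\<lambda>\<xi>. p \<xi> - a m \<xi>) < (1/2) ^ n" by blast
  qed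
  then obtain p0 where p0: "\<And>n m. m \<in> {1..r} \<Longrightarrow> p0 n m \<in> trigs"
    and p0a: "\<And>n m. m \<in> {1..r} \<Longrightarrow> norm2 torus (\<lambda>\<xi>. p0 n m \<xi> - a m \<xi>) < (1/2) ^ n" by metis
  have "\<forall>n. \<exists>g p'. combination \<phi> r g p' \<and> (\<forall>m\<in>{1..r}. p' m = p0 n m)"
  proof
    fix n
    show "\<exists>g p'. combination \<phi> r g p' \<and> (\<forall>m\<in>{1..r}. p' m = p0 n m)"
      by (rule combination_exists[OF p0])
  qed
  then obtain g p where g: "\<And>n. combination \<phi> r (g n) (p n)" and pp0: "\<And>n m. m \<in> {1..r} \<Longrightarrow> p n m = p0 n m"
    by metis
  have pa: "norm2 torus (\<lambda>\<xi>. p n m \<xi> - a m \<xi>) \<le> 1 * (1/2) ^ n" if "m \<in> {1..r}" for n m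
    using p0a[OF that, of n] pp0[OF that] by simp
  note pt = combination_trigs[OF g]
  have gl: "g n \<in> lincombs (shift_index r) (shifts \<phi>)" for n
    unfolding lincombs_combination using g by blast
  have gs: "g n \<in> sq_int lebesgue" for n
    by (rule lincombs_sq_int[OF shifts_sq_int[OF \<phi>] gl])
  define C where "C = sqrt K * (real r * 2)"
  have step: "norm2 lebesgue (\<lambda>x. g (Suc n) x - g n x) \<le> C * (1/2) ^ n" for n
  proof -
    have "norm2 lebesgue (\<lambda>x. g (Suc n) x - g n x) \<le> sqrt K * (\<Sum>m=1..r. norm2 torus (\<lambda>\<xi>. p (Suc n) m \<xi> - p n m \<xi>))"
      by (rule combination_bounds(2)[OF B combination_diff[OF g g]])
    also have "\<dots> \<le> sqrt K * (\<Sum>m=1..r. 2 * (1/2) ^ n)"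
    proof (intro mult_left_mono sum_mono)
      fix m assume m: "m \<in> {1..r}"
      have "norm2 torus (\<lambda>\<xi>. p (Suc n) m \<xi> - p n m \<xi>)
          \<le> norm2 torus (\<lambda>\<xi>. p (Suc n) m \<xi> - a m \<xi>) + norm2 torus (\<lambda>\<xi>. a m \<xi> - p n m \<xi>)"
        by (intro norm2_triangle_diff trigs_sq_int pt as m)
      also have "\<dots> \<le> (1/2) ^ Suc n + (1/2) ^ n"
        using pa[OF m, of "Suc n"] pa[OF m, of n] by (intro add_mono) (auto simp: norm2_minus_commute[of _ "a m"])
      also have "\<dots> \<le> 2 * (1/2) ^ n" by simp
      finally show "norm2 torus (\<lambda>\<xi>. p (Suc n) m \<xi> - p n m \<xi>) \<le> 2 * (1/2) ^ n" .
    qed (use K in simp)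
    finally show ?thesis by (simp add: C_def)
  qed
  define v where "v = (\<lambda>x. lim (\<lambda>n. g n x))"
  have v: "v \<in> sq_int lebesgue" and gv: "norm2 lebesgue (\<lambda>x. g n x - v x) \<le> 2 * C * (1/2) ^ n" for n
    unfolding v_def by (rule sq_int_complete[OF gs step])+
  define G where "G = (\<lambda>n \<xi>. \<Sum>m=1..r. p n m \<xi> * fourier_L2 (\<phi> m) \<xi>)"
  have GF: "is_fourier_L2 (g n) (G n)" for n unfolding G_def by (rule combination_fourier[OF \<phi> g])
  note F = fourier_L2_is_fourier[OF v]
  let ?P = "sqrt ((2 * pi) ^ CARD('d))"
  have "norm2 lebesgue (\<lambda>\<xi>. G n \<xi> - fourier_L2 v \<xi>) \<le> (?P * (2 * C)) * (1/2) ^ n" for n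
  proof -
    have "norm2 lebesgue (\<lambda>\<xi>. G n \<xi> - fourier_L2 v \<xi>) = ?P * norm2 lebesgue (\<lambda>x. g n x - v x)"
      by (rule is_fourier_L2_norm[OF is_fourier_L2_diff[OF GF F]])
    also have "\<dots> \<le> ?P * (2 * C * (1/2) ^ n)" by (intro mult_left_mono gv) simp
    finally show ?thesis by simp
  qed
  then have Gv: "AE \<xi> in lebesgue. (\<lambda>n. G n \<xi>) \<longlonglongrightarrow> fourier_L2 v \<xi>"
    by (rule AE_tendsto_of_geometric_norm2[OF is_fourier_L2_sq_int(2)[OF GF] is_fourier_L2_sq_int(2)[OF F]])
  have p_AE: "AE \<xi> in lebesgue. (\<lambda>n. p n m \<xi>) \<longlonglongrightarrow> a m \<xi>" if m: "m \<in> {1..r}" for m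
  proof (rule AE_of_periodic)
    show "AE \<xi> in torus. (\<lambda>n. p n m \<xi>) \<longlonglongrightarrow> a m \<xi>"
      by (rule AE_tendsto_of_geometric_norm2[OF trigs_sq_int[OF pt] as[OF m] pa[OF m]])
  qed (simp only: trigs_periodic[OF pt] aper[OF m])
  have "AE \<xi> in lebesgue. \<forall>m\<in>{1..r}. (\<lambda>n. p n m \<xi>) \<longlonglongrightarrow> a m \<xi>"
    by (subst AE_finite_all) (use p_AE in auto)
  with Gv eq have "AE \<xi> in lebesgue. fourier_L2 v \<xi> = fourier_L2 f \<xi>"
  proof eventually_elim
    fix \<xi> assume 1: "\<forall>m\<in>{1..r}. (\<lambda>n. p n m \<xi>) \<longlonglongrightarrow> a m \<xi>" and 2: "(\<lambda>n. G n \<xi>) \<longlonglongrightarrow> fourier_L2 v \<xi>"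
      and 3: "fourier_L2 f \<xi> = (\<Sum>m=1..r. a m \<xi> * fourier_L2 (\<phi> m) \<xi>)"
    have "(\<lambda>n. G n \<xi>) \<longlonglongrightarrow> fourier_L2 f \<xi>"
      unfolding G_def 3 using 1 by (intro tendsto_sum tendsto_mult tendsto_const) auto
    then show "fourier_L2 v \<xi> = fourier_L2 f \<xi>" using 2 LIMSEQ_unique by blast
  qed
  then have vf: "AE x in lebesgue. v x = f x"
    using is_fourier_L2_AE_iff[OF F fourier_L2_is_fourier[OF f]] by simp
  show ?thesis
  proof (rule closed_spanI[OF f])
    fix e :: real assume e: "0 < e"
    obtain n where n: "2 * C * (1/2) ^ n < e"
      using tendsto_zero_small[OF tendsto_half_geometric e] by blast
    have "norm2 lebesgue (\<lambda>x. f x - g n x) = norm2 lebesgue (\<lambda>x. v x - g n x)"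
      using vf by (intro norm2_cong_AE sq_int_meas sq_int_diff f gs v) auto
    also have "\<dots> < e" using gv[of n] n by (simp add: norm2_minus_commute[of _ v])
    finally show "\<exists>g\<in>lincombs (shift_index r) (shifts \<phi>). norm2 lebesgue (\<lambda>x. f x - g x) < e"
      using gl by blast
  qed
qed

section \<open>Wavelet systems\<close>

lemma dil_shift_mat_1_0 [simp]: "dil_shift (mat 1) 0 f = f"
  by (simp add: dil_shift_def)

text \<open>Changing the level on both sides by the same amount is a unitary operation.\<close>
lemma ip2_level:
  assumes M: "invertible M" and f: "f \<in> sq_int lebesgue" and g: "g \<in> sq_int lebesgue"
  shows "ip2 lebesgue (dil_shift (mat_powi M (j + p)) k f) (dil_shift (mat_powi M (j' + p)) k' g)
    = ip2 lebesgue (dil_shift (mat_powi M j) k f) (dil_shift (mat_powi M j') k' g)"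
  unfolding mat_powi_add[OF M] dil_shift_mult[of _ "mat_powi M p"]
  by (intro dil_shift_ip2 dil_shift_sq_int det_mat_powi_nz M f g)

lemma ip2_translate:
  assumes A: "det A \<noteq> 0" and B: "det B \<noteq> 0" and f: "f \<in> sq_int lebesgue" and g: "g \<in> sq_int lebesgue"
  shows "ip2 lebesgue (dil_shift A (A *v l + k) f) (dil_shift B (B *v l + k') g)
    = ip2 lebesgue (dil_shift A k f) (dil_shift B k' g)"
  unfolding dil_shift_translate[symmetric]
  by (intro dil_shift_ip2 dil_shift_sq_int A B f g) simp

lemma matrix_int_lattice:
  assumes M: "\<forall>i j. M $ i $ j \<in> \<int>" and k: "k \<in> int_lattice"
  shows "M *v k \<in> int_lattice"
  using assms by (auto simp: int_lattice_def matrix_vector_mult_def intro!: Ints_sum Ints_mult)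

lemma mat_powi_int_lattice:
  assumes M: "\<forall>i j. M $ i $ j \<in> \<int>" and j: "0 \<le> j" and k: "k \<in> int_lattice"
  shows "mat_powi M j *v k \<in> int_lattice"
proof -
  have "(((**) M) ^^ n) (mat 1) *v k \<in> int_lattice" for n
  proof (induction n)
    case (Suc n)
    have "(((**) M) ^^ Suc n) (mat 1) *v k = M *v ((((**) M) ^^ n) (mat 1) *v k)"
      by (simp add: matrix_vector_mul_assoc)
    then show ?case using matrix_int_lattice[OF M Suc] by simp
  qed (simp add: k)
  then show ?thesis using j by (simp add: mat_powi_def)
qed

lemma WS_Inl: "WS M J \<phi> \<psi> (Inl (l, k)) = dil_shift (mat_powi M J) k (\<phi> l)"
  and WS_Inr: "WS M J \<phi> \<psi> (Inr (n, j, k)) = dil_shift (mat_powi M j) k (\<psi> n)"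
  by (simp_all add: WS_def)

lemma Inl_in_WS_index: "Inl (l, k) \<in> WS_index r s J \<longleftrightarrow> l \<in> {1..r} \<and> k \<in> int_lattice"
  and Inr_in_WS_index: "Inr (n, j, k) \<in> WS_index r s J \<longleftrightarrow> n \<in> {1..s} \<and> J \<le> j \<and> k \<in> int_lattice"
  by (auto simp: WS_index_def)

lemma ball_WS_index:
  "(\<forall>i\<in>WS_index r s J. P i) \<longleftrightarrow> (\<forall>l\<in>{1..r}. \<forall>k\<in>int_lattice. P (Inl (l, k)))
     \<and> (\<forall>n\<in>{1..s}. \<forall>j\<ge>J. \<forall>k\<in>int_lattice. P (Inr (n, j, k)))"
  unfolding WS_index_def by (auto simp: Plus_def)

text \<open>The four families of relations are the cases of a single one over the index set of the whole
  system.\<close>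
lemma biorthogonal_wavelet_bases_iff:
  fixes M :: "real ^ 'd ^ 'd"
  shows "biorthogonal_wavelet_bases M J r s \<phi> \<psi> \<phi>' \<psi>' \<longleftrightarrow>
     riesz_basis (WS_index r s J) (WS M J \<phi> \<psi>) \<and> riesz_basis (WS_index r s J) (WS M J \<phi>' \<psi>')
   \<and> (\<forall>i\<in>WS_index r s J. \<forall>i'\<in>WS_index r s J. ip2 lebesgue (WS M J \<phi> \<psi> i) (WS M J \<phi>' \<psi>' i') = of_bool (i = i'))"
proof -
  have 1: "(l = l' \<and> k = k') = (k = k' \<and> l = l')" for l l' :: nat and k k' :: "real ^ 'd"
    by blast
  have 2: "(n = n' \<and> j = j' \<and> k = k') = (k = k' \<and> n = n' \<and> j = j')" for n n' :: nat and j j' :: int and k k' :: "real ^ 'd"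
    by blast
  have 3: "(Inr y = Inl x) = False" "(Inl x = Inr y) = False" for x :: 'a and y :: 'b
    by simp_all
  let ?L = "int_lattice :: (real ^ 'd) set"
  \<comment> \<open>The quantifiers are brought into the order in which the index set is traversed.\<close>
  have q1: "(\<forall>k\<in>?L. \<forall>k'\<in>?L. \<forall>l\<in>{1..r}. \<forall>l'\<in>{1..r}. P k k' l l')
      = (\<forall>l\<in>{1..r}. \<forall>k\<in>?L. \<forall>l'\<in>{1..r}. \<forall>k'\<in>?L. P k k' l l')" for P
    by blast
  have q2: "(\<forall>k\<in>?L. \<forall>k'\<in>?L. \<forall>j\<ge>J. \<forall>n\<in>{1..s}. \<forall>l\<in>{1..r}. P k k' j n l)
      = (\<forall>n\<in>{1..s}. \<forall>j\<ge>J. \<forall>k\<in>?L. \<forall>l\<in>{1..r}. \<forall>k'\<in>?L. P k k' j n l)" for P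
    by blast
  have q3: "(\<forall>k\<in>?L. \<forall>k'\<in>?L. \<forall>j\<ge>J. \<forall>l\<in>{1..r}. \<forall>n\<in>{1..s}. P k k' j l n)
      = (\<forall>l\<in>{1..r}. \<forall>k\<in>?L. \<forall>n\<in>{1..s}. \<forall>j\<ge>J. \<forall>k'\<in>?L. P k k' j l n)" for P
    by blast
  have q4: "(\<forall>k\<in>?L. \<forall>k'\<in>?L. \<forall>j\<ge>J. \<forall>j'\<ge>J. \<forall>n\<in>{1..s}. \<forall>n'\<in>{1..s}. P k k' j j' n n')
      = (\<forall>n\<in>{1..s}. \<forall>j\<ge>J. \<forall>k\<in>?L. \<forall>n'\<in>{1..s}. \<forall>j'\<ge>J. \<forall>k'\<in>?L. P k k' j j' n n')" for P
    by blast
  show ?thesis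
    unfolding biorthogonal_wavelet_bases_def riesz_wavelet_basis_def L2_inner_eq q1 q2 q3 q4
      ball_WS_index WS_Inl WS_Inr sum.inject prod.inject 3 of_bool_eq 1 2
      ball_conj_distrib imp_conjR all_conj_distrib
    by (intro iffI; elim conjE; intro conjI; assumption)
qed

lemma WS_sq_int:
  assumes M: "invertible M" and \<phi>: "\<forall>l\<in>{1..r}. \<phi> l \<in> sq_int lebesgue" and \<psi>: "\<forall>n\<in>{1..s}. \<psi> n \<in> sq_int lebesgue"
    and i: "i \<in> WS_index r s J"
  shows "WS M J \<phi> \<psi> i \<in> sq_int lebesgue"
proof -
  have "\<forall>i\<in>WS_index r s J. WS M J \<phi> \<psi> i \<in> sq_int lebesgue"
    unfolding ball_WS_index WS_Inl WS_Inr using \<phi> \<psi> by (auto intro!: dil_shift_sq_int det_mat_powi_nz M)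
  then show ?thesis using i by blast
qed

lemma dil_shift_shifts: "dil_shift (mat_powi M J) 0 (shifts \<phi> (l, k)) = dil_shift (mat_powi M J) k (\<phi> l)"
  unfolding shifts_dil_shift dil_shift_mult[symmetric] by simp

text \<open>The coarsest level of the wavelet system is the image of the shifts under a unitary dilation, so it inherits
  the bounds whatever \<open>J\<close> is.\<close>
lemma riesz_wavelet_shift_bounds:
  fixes M :: "real ^ 'd ^ 'd"
  assumes M: "invertible M" and \<phi>: "\<forall>l\<in>{1..r}. \<phi> l \<in> sq_int lebesgue"
    and R: "riesz_basis (WS_index r s J) (WS M J \<phi> \<psi>)"
  obtains K where "shift_bounds \<phi> r K"
proof -
  obtain C3 C4 where C: "0 < C3" "0 < C4"
    and lower: "\<And>F c. finite F \<Longrightarrow> F \<subseteq> WS_index r s J \<Longrightarrow>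
      C3 * (\<Sum>i\<in>F. (cmod (c i))\<^sup>2) \<le> (norm2 lebesgue (\<lambda>x. \<Sum>i\<in>F. c i * WS M J \<phi> \<psi> i x))\<^sup>2"
    and upper: "\<And>F c. finite F \<Longrightarrow> F \<subseteq> WS_index r s J \<Longrightarrow>
      (norm2 lebesgue (\<lambda>x. \<Sum>i\<in>F. c i * WS M J \<phi> \<psi> i x))\<^sup>2 \<le> C4 * (\<Sum>i\<in>F. (cmod (c i))\<^sup>2)"
    using R by (rule riesz_basisE) blast
  define K where "K = max (1 / C3) C4"
  have K: "0 < K" "1 / C3 \<le> K" "C4 \<le> K" using C by (auto simp: K_def)
  have "(\<Sum>i\<in>F. (cmod (c i))\<^sup>2) \<le> K * (norm2 lebesgue (\<lambda>x. \<Sum>i\<in>F. c i * shifts \<phi> i x))\<^sup>2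
    \<and> (norm2 lebesgue (\<lambda>x. \<Sum>i\<in>F. c i * shifts \<phi> i x))\<^sup>2 \<le> K * (\<Sum>i\<in>F. (cmod (c i))\<^sup>2)"
    if F: "finite F" "F \<subseteq> shift_index r" for F and c :: "nat \<times> (real ^ 'd) \<Rightarrow> complex"
  proof -
    define c' where "c' = (\<lambda>i :: nat \<times> (real ^ 'd) + nat \<times> int \<times> (real ^ 'd). case i of Inl j \<Rightarrow> c j | Inr _ \<Rightarrow> 0)"
    have sub: "Inl ` F \<subseteq> WS_index r s J" using F(2) by (auto simp: WS_index_def)
    have inj: "inj_on Inl F" by (simp add: inj_on_def)
    have S: "(\<Sum>i\<in>Inl ` F. (cmod (c' i))\<^sup>2) = (\<Sum>i\<in>F. (cmod (c i))\<^sup>2)"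
      by (subst sum.reindex[OF inj]) (simp add: c'_def)
    have gs: "(\<lambda>x. \<Sum>i\<in>F. c i * shifts \<phi> i x) \<in> sq_int lebesgue"
      using F(2) by (intro sq_int_lincomb shifts_sq_int[OF \<phi>]) auto
    have "(\<lambda>x. \<Sum>i\<in>Inl ` F. c' i * WS M J \<phi> \<psi> i x) = (\<lambda>x. \<Sum>i\<in>F. c i * dil_shift (mat_powi M J) 0 (shifts \<phi> i) x)"
    proof
      fix x
      have "(\<Sum>i\<in>Inl ` F. c' i * WS M J \<phi> \<psi> i x) = (\<Sum>i\<in>F. c i * WS M J \<phi> \<psi> (Inl i) x)"
        by (subst sum.reindex[OF inj]) (simp add: c'_def)
      also have "\<dots> = (\<Sum>i\<in>F. c i * dil_shift (mat_powi M J) 0 (shifts \<phi> i) x)"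
      proof (rule sum.cong[OF refl])
        fix i assume "i \<in> F"
        show "c i * WS M J \<phi> \<psi> (Inl i) x = c i * dil_shift (mat_powi M J) 0 (shifts \<phi> i) x"
          by (cases i) (simp add: WS_Inl dil_shift_shifts)
      qed
      finally show "(\<Sum>i\<in>Inl ` F. c' i * WS M J \<phi> \<psi> i x) = (\<Sum>i\<in>F. c i * dil_shift (mat_powi M J) 0 (shifts \<phi> i) x)" .
    qed
    then have N: "norm2 lebesgue (\<lambda>x. \<Sum>i\<in>Inl ` F. c' i * WS M J \<phi> \<psi> i x) = norm2 lebesgue (\<lambda>x. \<Sum>i\<in>F. c i * shifts \<phi> i x)"
      unfolding dil_shift_sum[symmetric] using dil_shift_norm2[OF det_mat_powi_nz[OF M] gs] by simp
    let ?S = "\<Sum>i\<in>F. (cmod (c i))\<^sup>2" and ?N = "(norm2 lebesgue (\<lambda>x. \<Sum>i\<in>F. c i * shifts \<phi> i x))\<^sup>2"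
    have "C3 * ?S \<le> ?N" "?N \<le> C4 * ?S"
      using lower[OF _ sub, of c'] upper[OF _ sub, of c'] F(1) unfolding S N by auto
    moreover have "C4 * ?S \<le> K * ?S" using K(3) by (intro mult_right_mono) (auto simp: sum_nonneg)
    moreover have "1 / C3 * ?N \<le> K * ?N" using K(2) by (intro mult_right_mono) auto
    moreover have "?S \<le> 1 / C3 * ?N" using \<open>C3 * ?S \<le> ?N\<close> C by (simp add: field_simps)
    ultimately show ?thesis by linarith
  qed
  then show thesis using that[of K] K(1) \<phi> unfolding shift_bounds_def by blast
qed

section \<open>Refinement equations\<close>

lemma L2_torus_cmult:
  assumes a: "a \<in> L2_torus"
  shows "(\<lambda>\<xi>. c * a \<xi>) \<in> L2_torus"
proof -
  have 1: "a \<in> borel_measurable lebesgue" "a \<in> sq_int torus"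
    "\<forall>k\<in>int_lattice. \<forall>\<xi>. a (\<xi> + (2 * pi) *\<^sub>R k) = a \<xi>"
    using a unfolding L2_torus_iff by blast+
  show ?thesis
    unfolding L2_torus_iff
  proof (intro conjI)
    show "(\<lambda>\<xi>. c * a \<xi>) \<in> borel_measurable lebesgue" using 1(1) by measurable
    show "(\<lambda>\<xi>. c * a \<xi>) \<in> sq_int torus" by (rule sq_int_cmult[OF 1(2)])
  qed (simp add: 1(3))
qed

text \<open>The constant \<open>\<kappa>\<close> is going to be absorbed in the coefficients of a refinement equation.\<close>
lemma fourier_L2_dil_inv:
  fixes M :: "real ^ 'd ^ 'd"
  assumes M: "invertible M" and f: "f \<in> sq_int lebesgue"
  obtains \<kappa> where "\<kappa> \<noteq> 0"
    "AE \<xi> in lebesgue. fourier_L2 (dil_shift (matrix_inv M) 0 f) \<xi> = \<kappa> * fourier_L2 f (transpose M *v \<xi>)"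
proof
  let ?s = "complex_of_real (sqrt \<bar>det (matrix_inv M)\<bar>)"
  have d: "det (matrix_inv M) \<noteq> 0" using det_mat_powi_nz[OF M, of "-1"] by (simp add: mat_powi_minus_1[OF M])
  have dM: "det M \<noteq> 0" using M by (simp add: invertible_det_nz)
  show "?s * complex_of_real \<bar>det M\<bar> \<noteq> 0" using d dM by simp
  have "is_fourier_L2 (dil_shift (matrix_inv M) 0 f) (\<lambda>\<xi>. ?s * (complex_of_real \<bar>det M\<bar> * fourier_L2 f (transpose M *v \<xi>)))"
    using is_fourier_L2_cmult[OF is_fourier_L2_dilate[OF M fourier_L2_is_fourier[OF f]], of ?s]
    by (simp only: dil_shift_def diff_0_right)
  from is_fourier_L2_AE_iff[OF fourier_L2_is_fourier[OF dil_shift_sq_int[OF d f, of 0]] this]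
  show "AE \<xi> in lebesgue. fourier_L2 (dil_shift (matrix_inv M) 0 f) \<xi> = ?s * complex_of_real \<bar>det M\<bar> * fourier_L2 f (transpose M *v \<xi>)"
    by (simp add: mult.assoc)
qed

text \<open>On the Fourier side the coarser copy of \<open>f\<close> is a multiple of the transform of \<open>f\<close> at \<open>transpose M *v \<xi>\<close>, so the
  refinement equation is the factorisation that characterises the span of the shifts.\<close>
lemma refinement_iff:
  fixes M :: "real ^ 'd ^ 'd"
  assumes B: "shift_bounds \<phi> r K" and M: "invertible M" and f: "f \<in> sq_int lebesgue"
  shows "dil_shift (matrix_inv M) 0 f \<in> closed_span (shift_index r) (shifts \<phi>) \<longleftrightarrow>
    (\<exists>a. (\<forall>m\<in>{1..r}. a m \<in> L2_torus) \<and>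
      (AE \<xi> in lebesgue. fourier_L2 f (transpose M *v \<xi>) = (\<Sum>m=1..r. a m \<xi> * fourier_L2 (\<phi> m) \<xi>)))"
proof -
  obtain \<kappa> where \<kappa>: "\<kappa> \<noteq> 0"
    and eq: "AE \<xi> in lebesgue. fourier_L2 (dil_shift (matrix_inv M) 0 f) \<xi> = \<kappa> * fourier_L2 f (transpose M *v \<xi>)"
    using fourier_L2_dil_inv[OF M f] by blast
  have d: "det (matrix_inv M) \<noteq> 0" using det_mat_powi_nz[OF M, of "-1"] by (simp add: mat_powi_minus_1[OF M])
  show ?thesis
  proof
    assume "dil_shift (matrix_inv M) 0 f \<in> closed_span (shift_index r) (shifts \<phi>)"
    then obtain a where a: "\<And>m. m \<in> {1..r} \<Longrightarrow> a m \<in> L2_torus"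
      and ae: "AE \<xi> in lebesgue. fourier_L2 (dil_shift (matrix_inv M) 0 f) \<xi> = (\<Sum>m=1..r. a m \<xi> * fourier_L2 (\<phi> m) \<xi>)"
      by (rule closed_span_imp_factorisation[OF B]) blast
    show "\<exists>a. (\<forall>m\<in>{1..r}. a m \<in> L2_torus) \<and>
      (AE \<xi> in lebesgue. fourier_L2 f (transpose M *v \<xi>) = (\<Sum>m=1..r. a m \<xi> * fourier_L2 (\<phi> m) \<xi>))"
    proof (intro exI[of _ "\<lambda>m \<xi>. (1 / \<kappa>) * a m \<xi>"] conjI ballI L2_torus_cmult a)
      show "AE \<xi> in lebesgue. fourier_L2 f (transpose M *v \<xi>) = (\<Sum>m=1..r. (1 / \<kappa>) * a m \<xi> * fourier_L2 (\<phi> m) \<xi>)"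
        using ae eq
      proof eventually_elim
        fix \<xi>
        assume "fourier_L2 (dil_shift (matrix_inv M) 0 f) \<xi> = (\<Sum>m=1..r. a m \<xi> * fourier_L2 (\<phi> m) \<xi>)"
          "fourier_L2 (dil_shift (matrix_inv M) 0 f) \<xi> = \<kappa> * fourier_L2 f (transpose M *v \<xi>)"
        then have "\<kappa> * fourier_L2 f (transpose M *v \<xi>) = (\<Sum>m=1..r. a m \<xi> * fourier_L2 (\<phi> m) \<xi>)" by simp
        then have "fourier_L2 f (transpose M *v \<xi>) = (1 / \<kappa>) * (\<Sum>m=1..r. a m \<xi> * fourier_L2 (\<phi> m) \<xi>)"
          using \<kappa> by (simp add: field_simps)
        then show "fourier_L2 f (transpose M *v \<xi>) = (\<Sum>m=1..r. (1 / \<kappa>) * a m \<xi> * fourier_L2 (\<phi> m) \<xi>)"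
          by (simp only: sum_distrib_left mult.assoc)
      qed
    qed
  next
    assume "\<exists>a. (\<forall>m\<in>{1..r}. a m \<in> L2_torus) \<and>
      (AE \<xi> in lebesgue. fourier_L2 f (transpose M *v \<xi>) = (\<Sum>m=1..r. a m \<xi> * fourier_L2 (\<phi> m) \<xi>))"
    then obtain a where a: "\<And>m. m \<in> {1..r} \<Longrightarrow> a m \<in> L2_torus"
      and ae: "AE \<xi> in lebesgue. fourier_L2 f (transpose M *v \<xi>) = (\<Sum>m=1..r. a m \<xi> * fourier_L2 (\<phi> m) \<xi>)"
      by blast
    show "dil_shift (matrix_inv M) 0 f \<in> closed_span (shift_index r) (shifts \<phi>)"
    proof (rule factorisation_imp_closed_span[OF B dil_shift_sq_int[OF d f], where a="\<lambda>m \<xi>. \<kappa> * a m \<xi>"])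
      show "AE \<xi> in lebesgue. fourier_L2 (dil_shift (matrix_inv M) 0 f) \<xi> = (\<Sum>m=1..r. \<kappa> * a m \<xi> * fourier_L2 (\<phi> m) \<xi>)"
        using ae eq by eventually_elim (simp only: sum_distrib_left mult.assoc)
    qed (intro L2_torus_cmult a)
  qed
qed

section \<open>Nested spaces and the dual wavelet system\<close>

lemma shifts_closed_span:
  assumes \<phi>: "\<forall>l\<in>{1..r}. \<phi> l \<in> sq_int lebesgue" and i: "i \<in> shift_index r"
  shows "shifts \<phi> i \<in> closed_span (shift_index r) (shifts \<phi>)"
  by (rule lincombs_closed_span[OF shifts_sq_int[OF \<phi>] lincombs_base[where h="shifts \<phi>", OF i]])

text \<open>The copy of \<open>f\<close> at level \<open>J - 1\<close> is orthogonal to all dual wavelets of levels \<open>j \<ge> J\<close>: this is the hypothesis after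
  raising both sides by one level. What remains of the system is the coarsest level, which the dilation by
  the power \<open>- J\<close> takes to the shifts of \<open>\<phi>\<close>.\<close>
lemma biorthogonal_imp_closed_span:
  fixes M :: "real ^ 'd ^ 'd"
  assumes M: "invertible M" and \<phi>: "\<forall>l\<in>{1..r}. \<phi> l \<in> sq_int lebesgue" and \<psi>: "\<forall>n\<in>{1..s}. \<psi> n \<in> sq_int lebesgue"
    and \<psi>': "\<forall>n\<in>{1..s}. \<psi>' n \<in> sq_int lebesgue"
    and bi: "biorthogonal_wavelet_bases M J r s \<phi> \<psi> \<phi>' \<psi>'"
    and f: "f \<in> sq_int lebesgue"
    and orth: "\<And>n j k. n \<in> {1..s} \<Longrightarrow> J < j \<Longrightarrow> k \<in> int_lattice \<Longrightarrow>
      ip2 lebesgue (dil_shift (mat_powi M J) 0 f) (dil_shift (mat_powi M j) k (\<psi>' n)) = 0"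
  shows "dil_shift (matrix_inv M) 0 f \<in> closed_span (shift_index r) (shifts \<phi>)"
proof -
  let ?I = "WS_index r s J :: (nat \<times> (real ^ 'd) + nat \<times> int \<times> (real ^ 'd)) set"
  let ?A = "Inl ` shift_index r :: (nat \<times> (real ^ 'd) + nat \<times> int \<times> (real ^ 'd)) set"
  have R: "riesz_basis ?I (WS M J \<phi> \<psi>)" and R': "riesz_basis ?I (WS M J \<phi>' \<psi>')"
    and b: "\<And>i i'. i \<in> ?I \<Longrightarrow> i' \<in> ?I \<Longrightarrow> ip2 lebesgue (WS M J \<phi> \<psi> i) (WS M J \<phi>' \<psi>' i') = of_bool (i = i')"
    using bi unfolding biorthogonal_wavelet_bases_iff by blast+
  define g where "g = dil_shift (mat_powi M (J - 1)) 0 f"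
  have g: "g \<in> closed_span ?A (WS M J \<phi> \<psi>)"
  proof (rule riesz_biorthogonal_closed_span[OF R R' b])
    show "?A \<subseteq> ?I" by (auto simp: WS_index_def)
    show "g \<in> sq_int lebesgue" unfolding g_def by (intro dil_shift_sq_int det_mat_powi_nz M f)
    fix i assume "i \<in> ?I - ?A"
    then obtain n j k where i: "i = Inr (n, j, k)" "n \<in> {1..s}" "J \<le> j" "k \<in> int_lattice"
      by (auto simp: WS_index_def)
    have "ip2 lebesgue g (WS M J \<phi>' \<psi>' i)
        = ip2 lebesgue (dil_shift (mat_powi M (J - 1)) 0 f) (dil_shift (mat_powi M j) k (\<psi>' n))"
      by (simp only: g_def i(1) WS_Inr)
    also have "\<dots> = ip2 lebesgue (dil_shift (mat_powi M (J - 1 + 1)) 0 f) (dil_shift (mat_powi M (j + 1)) k (\<psi>' n))"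
      using \<psi>' i(2) by (intro ip2_level[symmetric] M f) auto
    also have "\<dots> = 0" using orth[of n "j + 1" k] i by simp
    finally show "ip2 lebesgue g (WS M J \<phi>' \<psi>' i) = 0" .
  qed auto
  have "dil_shift (mat_powi M (- J)) 0 g \<in> closed_span (shift_index r) (shifts \<phi>)"
  proof (rule closed_span_dil_shift[OF det_mat_powi_nz[OF M] _ _ _ g])
    fix i assume "i \<in> ?A"
    then obtain l k where i: "i = Inl (l, k)" "(l, k) \<in> shift_index r" by auto
    have "dil_shift (mat_powi M (- J)) 0 (WS M J \<phi> \<psi> i) = dil_shift (mat_powi M (J + - J)) k (\<phi> l)"
      unfolding mat_powi_add[OF M] dil_shift_mult i(1) WS_Inl ..
    also have "\<dots> = shifts \<phi> (l, k)" by (simp add: mat_powi_0 shifts_dil_shift)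
    finally show "dil_shift (mat_powi M (- J)) 0 (WS M J \<phi> \<psi> i) \<in> closed_span (shift_index r) (shifts \<phi>)"
      using shifts_closed_span[OF \<phi> i(2)] by (simp only:)
    show "WS M J \<phi> \<psi> i \<in> sq_int lebesgue"
      using i by (intro WS_sq_int[OF M \<phi> \<psi>]) (auto simp: WS_index_def)
  qed (rule shifts_sq_int[OF \<phi>])
  also have "dil_shift (mat_powi M (- J)) 0 g = dil_shift (mat_powi M (J - 1 + - J)) 0 f"
    unfolding mat_powi_add[OF M, of "J - 1" "- J"] dil_shift_mult g_def ..
  also have "J - 1 + - J = -1" by simp
  finally show ?thesis by (simp only: mat_powi_minus_1[OF M])
qed

lemma closed_span_translate:
  fixes \<phi> :: "nat \<Rightarrow> real ^ 'd \<Rightarrow> complex"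
  assumes \<phi>: "\<forall>l\<in>{1..r}. \<phi> l \<in> sq_int lebesgue" and k: "k \<in> int_lattice"
    and f: "f \<in> closed_span (shift_index r) (shifts \<phi>)"
  shows "dil_shift (mat 1) k f \<in> closed_span (shift_index r) (shifts \<phi>)"
proof (rule closed_span_dil_shift[OF _ shifts_sq_int[OF \<phi>] shifts_sq_int[OF \<phi>] _ f])
  fix i :: "nat \<times> (real ^ 'd)" assume "i \<in> shift_index r"
  then obtain m l where i: "i = (m, l)" "m \<in> {1..r}" "l \<in> int_lattice" by auto
  have "dil_shift (mat 1) k (shifts \<phi> i) = shifts \<phi> (m, k + l)"
    unfolding i(1) shifts_dil_shift dil_shift_translate by simp
  moreover have "(m, k + l) \<in> shift_index r" using i k int_lattice_add by blast
  ultimately show "dil_shift (mat 1) k (shifts \<phi> i) \<in> closed_span (shift_index r) (shifts \<phi>)"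
    using shifts_closed_span[OF \<phi>] by (simp only:)
qed simp_all

text \<open>A shift by \<open>k\<close> after coarsening is a shift by \<open>M *v k\<close> of the coarser function, and \<open>M *v k\<close> is an integer vector.\<close>
lemma closed_span_coarser:
  fixes M :: "real ^ 'd ^ 'd"
  assumes Z: "\<forall>i j. M $ i $ j \<in> \<int>" and M: "invertible M" and \<phi>: "\<forall>l\<in>{1..r}. \<phi> l \<in> sq_int lebesgue"
    and k: "k \<in> int_lattice"
    and f: "dil_shift (matrix_inv M) 0 f \<in> closed_span (shift_index r) (shifts \<phi>)"
  shows "dil_shift (matrix_inv M) k f \<in> closed_span (shift_index r) (shifts \<phi>)"
proof -
  have "dil_shift (mat 1) (M *v k) (dil_shift (matrix_inv M) 0 f) = dil_shift (matrix_inv M) k f"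
    unfolding dil_shift_translate by (simp add: matrix_vector_mul_assoc matrix_inv_cancel[OF M])
  then show ?thesis using closed_span_translate[OF \<phi> matrix_int_lattice[OF Z k] f] by simp
qed

text \<open>Since the refinable \<open>\<phi>\<close> make the span of the shifts invariant under coarsening, the level can be lowered step
  by step.\<close>
lemma closed_span_coarse_levels:
  fixes M :: "real ^ 'd ^ 'd"
  assumes Z: "\<forall>i j. M $ i $ j \<in> \<int>" and M: "invertible M" and \<phi>: "\<forall>l\<in>{1..r}. \<phi> l \<in> sq_int lebesgue"
    and ref: "\<And>l. l \<in> {1..r} \<Longrightarrow> dil_shift (matrix_inv M) 0 (\<phi> l) \<in> closed_span (shift_index r) (shifts \<phi>)"
    and f: "dil_shift (mat_powi M j) k f \<in> closed_span (shift_index r) (shifts \<phi>)" and i: "i \<le> j"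
  shows "dil_shift (mat_powi M i) k f \<in> closed_span (shift_index r) (shifts \<phi>)"
  using i
proof (induction i rule: int_le_induct)
  case base
  show ?case by (rule f)
next
  case (step i)
  have d: "det (matrix_inv M) \<noteq> 0" using det_mat_powi_nz[OF M, of "-1"] by (simp add: mat_powi_minus_1[OF M])
  have "dil_shift (matrix_inv M) 0 (dil_shift (mat_powi M i) k f) \<in> closed_span (shift_index r) (shifts \<phi>)"
  proof (rule closed_span_dil_shift[OF d shifts_sq_int[OF \<phi>] shifts_sq_int[OF \<phi>] _ step.IH])
    fix p :: "nat \<times> (real ^ 'd)" assume "p \<in> shift_index r"
    then obtain m l where p: "p = (m, l)" "m \<in> {1..r}" "l \<in> int_lattice" by auto
    have "dil_shift (matrix_inv M) 0 (shifts \<phi> p) = dil_shift (matrix_inv M) l (\<phi> m)"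
      unfolding p(1) shifts_dil_shift dil_shift_mult[symmetric] by simp
    then show "dil_shift (matrix_inv M) 0 (shifts \<phi> p) \<in> closed_span (shift_index r) (shifts \<phi>)"
      using closed_span_coarser[OF Z M \<phi> p(3) ref[OF p(2)]] by simp
  qed
  moreover have "dil_shift (matrix_inv M) 0 (dil_shift (mat_powi M i) k f) = dil_shift (mat_powi M (i - 1)) k f"
    using mat_powi_add[OF M, of i "-1"] by (simp add: mat_powi_minus_1[OF M] dil_shift_mult)
  ultimately show ?case by simp
qed

text \<open>The dual generators come from the dual vectors of the unshifted generators at level \<open>J\<close>, which yields the relations
  with one side unshifted at the lowest level. A common change of level and a common
  shift reduce all others to these, except those pairing a dual wavelet with a coarser vector; there the
  coarser vector lies in the span of the shifts of \<open>\<phi>\<close>, which is orthogonal to the dual wavelets.\<close>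
lemma nested_imp_biorthogonal:
  fixes M :: "real ^ 'd ^ 'd"
  assumes Z: "\<forall>i j. M $ i $ j \<in> \<int>" and M: "invertible M"
    and \<phi>: "\<forall>l\<in>{1..r}. \<phi> l \<in> sq_int lebesgue" and \<psi>: "\<forall>n\<in>{1..s}. \<psi> n \<in> sq_int lebesgue"
    and R: "riesz_basis (WS_index r s J) (WS M J \<phi> \<psi>)"
    and ref\<phi>: "\<And>l. l \<in> {1..r} \<Longrightarrow> dil_shift (matrix_inv M) 0 (\<phi> l) \<in> closed_span (shift_index r) (shifts \<phi>)"
    and ref\<psi>: "\<And>n. n \<in> {1..s} \<Longrightarrow> dil_shift (matrix_inv M) 0 (\<psi> n) \<in> closed_span (shift_index r) (shifts \<phi>)"
  obtains \<phi>' \<psi>' where "\<forall>l\<in>{1..r}. \<phi>' l \<in> sq_int lebesgue" "\<forall>n\<in>{1..s}. \<psi>' n \<in> sq_int lebesgue"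
    "biorthogonal_wavelet_bases M J r s \<phi> \<psi> \<phi>' \<psi>'"
proof -
  let ?I = "WS_index r s J :: (nat \<times> (real ^ 'd) + nat \<times> int \<times> (real ^ 'd)) set"
  let ?W = "\<lambda>j k f. dil_shift (mat_powi M j) k f"
  let ?V = "closed_span (shift_index r) (shifts \<phi>)"
  have "\<forall>i\<in>?I. \<exists>v. v \<in> sq_int lebesgue \<and> (\<forall>j\<in>?I. ip2 lebesgue (WS M J \<phi> \<psi> j) v = of_bool (j = i))"
  proof
    fix i assume i: "i \<in> ?I"
    obtain u where "u \<in> sq_int lebesgue" "\<And>j. j \<in> ?I \<Longrightarrow> ip2 lebesgue (WS M J \<phi> \<psi> j) u = of_bool (j = i)"
      by (rule dual_vector_exists[OF R i]) blast
    then show "\<exists>v. v \<in> sq_int lebesgue \<and> (\<forall>j\<in>?I. ip2 lebesgue (WS M J \<phi> \<psi> j) v = of_bool (j = i))" by blast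
  qed
  then obtain v where v: "\<And>i. i \<in> ?I \<Longrightarrow> v i \<in> sq_int lebesgue"
    and dual: "\<And>i j. i \<in> ?I \<Longrightarrow> j \<in> ?I \<Longrightarrow> ip2 lebesgue (WS M J \<phi> \<psi> j) (v i) = of_bool (j = i)"
    by metis
  have vL: "v (Inl (l, 0)) \<in> sq_int lebesgue" if "l \<in> {1..r}" for l
    using that by (intro v) (auto simp: WS_index_def int_lattice_0)
  have vR: "v (Inr (n, J, 0)) \<in> sq_int lebesgue" if "n \<in> {1..s}" for n
    using that by (intro v) (auto simp: WS_index_def int_lattice_0)
  \<comment> \<open>Lowered from level \<open>J\<close> to level \<open>0\<close>, since the system itself raises them to level \<open>J\<close>.\<close>
  define \<phi>' where "\<phi>' = (\<lambda>l. ?W (- J) 0 (v (Inl (l, 0))))"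
  define \<psi>' where "\<psi>' = (\<lambda>n. ?W (- J) 0 (v (Inr (n, J, 0))))"
  have iL: "Inl (l, k) \<in> ?I" if "l \<in> {1..r}" "k \<in> int_lattice" for l k
    using that by (auto simp: WS_index_def)
  have iR: "Inr (n, j, k) \<in> ?I" if "n \<in> {1..s}" "J \<le> j" "k \<in> int_lattice" for n j k
    using that by (auto simp: WS_index_def)
  have \<phi>': "\<phi>' l \<in> sq_int lebesgue" if "l \<in> {1..r}" for l
    unfolding \<phi>'_def by (intro dil_shift_sq_int det_mat_powi_nz M vL that)
  have \<psi>': "\<psi>' n \<in> sq_int lebesgue" if "n \<in> {1..s}" for n
    unfolding \<psi>'_def by (intro dil_shift_sq_int det_mat_powi_nz M vR that)
  have \<phi>s: "\<phi> l \<in> sq_int lebesgue" if "l \<in> {1..r}" for l using \<phi> that by blast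
  have \<psi>s: "\<psi> n \<in> sq_int lebesgue" if "n \<in> {1..s}" for n using \<psi> that by blast
  have down: "ip2 lebesgue (?W j k f) (?W (- J) 0 u) = ip2 lebesgue (?W (j + J) k f) u"
    if "f \<in> sq_int lebesgue" "u \<in> sq_int lebesgue" for j k f u
    using ip2_level[OF M that, of "j + J" "- J" k 0 0] by (simp add: mat_powi_0)
  have \<phi>\<phi>': "ip2 lebesgue (?W 0 k (\<phi> l)) (\<phi>' l') = of_bool (k = 0 \<and> l = l')"
    if "l \<in> {1..r}" "l' \<in> {1..r}" "k \<in> int_lattice" for l l' k
    unfolding \<phi>'_def down[OF \<phi>s[OF that(1)] vL[OF that(2)]]
    using dual[OF iL[OF that(2) int_lattice_0] iL[OF that(1,3)]] by (auto simp: WS_Inl)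
  have \<psi>\<phi>': "ip2 lebesgue (?W j k (\<psi> n)) (\<phi>' l) = 0"
    if "n \<in> {1..s}" "l \<in> {1..r}" "0 \<le> j" "k \<in> int_lattice" for n l j k
    unfolding \<phi>'_def down[OF \<psi>s[OF that(1)] vL[OF that(2)]]
    using dual[OF iL[OF that(2) int_lattice_0] iR[OF that(1) _ that(4), of "j + J"]] that(3) by (auto simp: WS_Inr)
  have \<phi>\<psi>': "ip2 lebesgue (?W 0 k (\<phi> l)) (\<psi>' n) = 0"
    if "l \<in> {1..r}" "n \<in> {1..s}" "k \<in> int_lattice" for l n k
    unfolding \<psi>'_def down[OF \<phi>s[OF that(1)] vR[OF that(2)]]
    using dual[OF iR[OF that(2) order_refl int_lattice_0] iL[OF that(1,3)]] by (auto simp: WS_Inl)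
  have \<psi>\<psi>': "ip2 lebesgue (?W j k (\<psi> n)) (\<psi>' n') = of_bool (n = n' \<and> j = 0 \<and> k = 0)"
    if "n \<in> {1..s}" "n' \<in> {1..s}" "0 \<le> j" "k \<in> int_lattice" for n n' j k
    unfolding \<psi>'_def down[OF \<psi>s[OF that(1)] vR[OF that(2)]]
    using dual[OF iR[OF that(2) order_refl int_lattice_0] iR[OF that(1) _ that(4), of "j + J"]] that(3) by (auto simp: WS_Inr)
  \<comment> \<open>The dual side is brought to level \<open>0\<close> and shift \<open>0\<close>.\<close>
  have move: "ip2 lebesgue (?W j k f) (?W j' k' g) = ip2 lebesgue (?W (j - j') (k - mat_powi M (j - j') *v k') f) g"
    if "f \<in> sq_int lebesgue" "g \<in> sq_int lebesgue" for j j' k k' f g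
  proof -
    have "ip2 lebesgue (?W j k f) (?W j' k' g) = ip2 lebesgue (?W (j - j') k f) (dil_shift (mat 1) k' g)"
      using ip2_level[OF M that, of "j - j'" j' k 0 k'] by (simp add: mat_powi_0)
    also have "\<dots> = ip2 lebesgue (?W (j - j') (k - mat_powi M (j - j') *v k') f) g"
      using ip2_translate[OF det_mat_powi_nz[OF M] _ that, of "mat 1" "j - j'" k' "k - mat_powi M (j - j') *v k'" 0]
      by simp
    finally show ?thesis .
  qed
  have lat: "k - mat_powi M j *v k' \<in> int_lattice" if "0 \<le> j" "k \<in> int_lattice" "k' \<in> int_lattice" for j k k'
    using that by (intro int_lattice_diff mat_powi_int_lattice[OF Z])
  have V\<phi>: "?W i k (\<phi> l) \<in> ?V" if "l \<in> {1..r}" "k \<in> int_lattice" "i \<le> 0" for i k l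
  proof (rule closed_span_coarse_levels[OF Z M \<phi> ref\<phi> _ that(3)])
    have "shifts \<phi> (l, k) \<in> ?V" by (rule shifts_closed_span[OF \<phi>]) (use that in blast)
    then show "?W 0 k (\<phi> l) \<in> ?V" by (simp add: shifts_dil_shift mat_powi_0)
  qed
  have V\<psi>: "?W i k (\<psi> n) \<in> ?V" if "n \<in> {1..s}" "k \<in> int_lattice" "i \<le> -1" for i k n
  proof (rule closed_span_coarse_levels[OF Z M \<phi> ref\<phi> _ that(3)])
    show "?W (-1) k (\<psi> n) \<in> ?V"
      unfolding mat_powi_minus_1[OF M] by (rule closed_span_coarser[OF Z M \<phi> that(2) ref\<psi>[OF that(1)]])
  qed
  have orth: "ip2 lebesgue (?W j k f) (?W j' k' (\<psi>' n)) = 0"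
    if fV: "?W (j - j') k f \<in> ?V" and f: "f \<in> sq_int lebesgue" and n: "n \<in> {1..s}" and k': "k' \<in> int_lattice"
    for j j' k k' f n
  proof -
    have "ip2 lebesgue (?W j k f) (?W j' k' (\<psi>' n)) = ip2 lebesgue (?W (j - j') k f) (dil_shift (mat 1) k' (\<psi>' n))"
      using ip2_level[OF M f \<psi>'[OF n], of "j - j'" j' k 0 k'] by (simp add: mat_powi_0)
    also have "\<dots> = 0"
    proof (rule closed_span_orthogonal[OF shifts_sq_int[OF \<phi>] fV])
      show "dil_shift (mat 1) k' (\<psi>' n) \<in> sq_int lebesgue" by (intro dil_shift_sq_int \<psi>' n) simp
      fix i :: "nat \<times> (real ^ 'd)" assume "i \<in> shift_index r"
      then obtain m l where i: "i = (m, l)" "m \<in> {1..r}" "l \<in> int_lattice" by auto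
      have "ip2 lebesgue (shifts \<phi> i) (dil_shift (mat 1) k' (\<psi>' n)) = ip2 lebesgue (?W 0 (l - k') (\<phi> m)) (\<psi>' n)"
        using move[OF \<phi>s[OF i(2)] \<psi>'[OF n], of 0 l 0 k'] i(1) by (simp add: mat_powi_0 shifts_dil_shift)
      then show "ip2 lebesgue (shifts \<phi> i) (dil_shift (mat 1) k' (\<psi>' n)) = 0"
        using \<phi>\<psi>'[OF i(2) n int_lattice_diff[OF i(3) k']] by simp
    qed
    finally show ?thesis .
  qed
  have b: "\<forall>i\<in>?I. \<forall>i'\<in>?I. ip2 lebesgue (WS M J \<phi> \<psi> i) (WS M J \<phi>' \<psi>' i') = of_bool (i = i')"
    unfolding ball_WS_index WS_Inl WS_Inr
  proof (intro conjI ballI allI impI)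
    fix l l' :: nat and k k' :: "real ^ 'd"
    assume a: "l \<in> {1..r}" "k \<in> int_lattice" "l' \<in> {1..r}" "k' \<in> int_lattice"
    show "ip2 lebesgue (?W J k (\<phi> l)) (?W J k' (\<phi>' l')) = of_bool (Inl (l, k) = Inl (l', k'))"
      unfolding move[OF \<phi>s[OF a(1)] \<phi>'[OF a(3)]]
      using \<phi>\<phi>'[OF a(1,3) int_lattice_diff[OF a(2,4)]] by (auto simp: mat_powi_0)
  next
    fix l n :: nat and j :: int and k k' :: "real ^ 'd"
    assume a: "l \<in> {1..r}" "k \<in> int_lattice" "n \<in> {1..s}" "J \<le> j" "k' \<in> int_lattice"
    have "ip2 lebesgue (?W J k (\<phi> l)) (?W j k' (\<psi>' n)) = 0"
      by (rule orth[OF V\<phi>[OF a(1,2)] \<phi>s[OF a(1)] a(3,5)]) (use a(4) in simp)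
    then show "ip2 lebesgue (?W J k (\<phi> l)) (?W j k' (\<psi>' n)) = of_bool (Inl (l, k) = Inr (n, j, k'))" by simp
  next
    fix l n :: nat and j :: int and k k' :: "real ^ 'd"
    assume a: "n \<in> {1..s}" "J \<le> j" "k \<in> int_lattice" "l \<in> {1..r}" "k' \<in> int_lattice"
    have "ip2 lebesgue (?W j k (\<psi> n)) (?W J k' (\<phi>' l)) = 0"
      unfolding move[OF \<psi>s[OF a(1)] \<phi>'[OF a(4)]]
      by (rule \<psi>\<phi>'[OF a(1,4) _ lat[OF _ a(3,5)]]) (use a(2) in simp_all)
    then show "ip2 lebesgue (?W j k (\<psi> n)) (?W J k' (\<phi>' l)) = of_bool (Inr (n, j, k) = Inl (l, k'))" by simp
  next
    fix n n' :: nat and j j' :: int and k k' :: "real ^ 'd"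
    assume a: "n \<in> {1..s}" "J \<le> j" "k \<in> int_lattice" "n' \<in> {1..s}" "J \<le> j'" "k' \<in> int_lattice"
    show "ip2 lebesgue (?W j k (\<psi> n)) (?W j' k' (\<psi>' n')) = of_bool (Inr (n, j, k) = Inr (n', j', k'))"
    proof (cases "j < j'")
      case True
      have "ip2 lebesgue (?W j k (\<psi> n)) (?W j' k' (\<psi>' n')) = 0"
        by (rule orth[OF V\<psi>[OF a(1,3)] \<psi>s[OF a(1)] a(4,6)]) (use True in simp)
      then show ?thesis using True by simp
    next
      case False
      have "ip2 lebesgue (?W j k (\<psi> n)) (?W j' k' (\<psi>' n')) = of_bool (n = n' \<and> j - j' = 0 \<and> k - mat_powi M (j - j') *v k' = 0)"
        unfolding move[OF \<psi>s[OF a(1)] \<psi>'[OF a(4)]]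
        by (rule \<psi>\<psi>'[OF a(1,4) _ lat[OF _ a(3,6)]]) (use False in simp_all)
      then show ?thesis by (auto simp: mat_powi_0)
    qed
  qed
  have "riesz_basis ?I (WS M J \<phi>' \<psi>')"
  proof (rule biorthogonal_riesz_basis[OF R])
    show "WS M J \<phi>' \<psi>' i \<in> sq_int lebesgue" if "i \<in> ?I" for i
      using \<phi>' \<psi>' that by (intro WS_sq_int[OF M]) auto
  qed (use b in blast)
  then have "biorthogonal_wavelet_bases M J r s \<phi> \<psi> \<phi>' \<psi>'"
    unfolding biorthogonal_wavelet_bases_iff using R b by blast
  then show thesis using that \<phi>' \<psi>' by blast
qed

theorem theorem8:
  fixes M :: "real ^ 'd ^ 'd"
    and r s :: nat
    and \<phi> \<psi> :: "nat \<Rightarrow> real ^ 'd \<Rightarrow> complex"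
    and J :: int
  assumes "\<forall>i j. M $ i $ j \<in> \<int>" and "invertible M"
    and "\<forall>l\<in>{1..r}. \<phi> l \<in> L2" and "\<forall>n\<in>{1..s}. \<psi> n \<in> L2"
    and "riesz_wavelet_basis M J r s \<phi> \<psi>"
  shows "(\<exists>\<phi>' \<psi>' :: nat \<Rightarrow> real ^ 'd \<Rightarrow> complex.
            (\<forall>l\<in>{1..r}. \<phi>' l \<in> L2) \<and> (\<forall>n\<in>{1..s}. \<psi>' n \<in> L2)
          \<and> biorthogonal_wavelet_bases M J r s \<phi> \<psi> \<phi>' \<psi>')
     \<longleftrightarrow>
         (\<exists>a b :: nat \<Rightarrow> nat \<Rightarrow> real ^ 'd \<Rightarrow> complex.
            (\<forall>l\<in>{1..r}. \<forall>m\<in>{1..r}. a l m \<in> L2_torus)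
          \<and> (\<forall>n\<in>{1..s}. \<forall>m\<in>{1..r}. b n m \<in> L2_torus)
          \<and> (AE \<xi> in lebesgue.
               (\<forall>l\<in>{1..r}. fourier_L2 (\<phi> l) (transpose M *v \<xi>)
                   = (\<Sum>m=1..r. a l m \<xi> * fourier_L2 (\<phi> m) \<xi>))
             \<and> (\<forall>n\<in>{1..s}. fourier_L2 (\<psi> n) (transpose M *v \<xi>)
                   = (\<Sum>m=1..r. b n m \<xi> * fourier_L2 (\<phi> m) \<xi>))))" (is "?biorthogonal \<longleftrightarrow> ?refinable")
proof -
  note Z = assms(1) and M = assms(2)
  have \<phi>: "\<forall>l\<in>{1..r}. \<phi> l \<in> sq_int lebesgue" and \<psi>: "\<forall>n\<in>{1..s}. \<psi> n \<in> sq_int lebesgue"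
    using assms(3,4) by (simp_all add: L2_eq)
  have R: "riesz_basis (WS_index r s J) (WS M J \<phi> \<psi>)"
    using assms(5) by (simp add: riesz_wavelet_basis_def)
  obtain K where B: "shift_bounds \<phi> r K" using riesz_wavelet_shift_bounds[OF M \<phi> R] by blast
  let ?V = "closed_span (shift_index r) (shifts \<phi>)"
  let ?ref = "\<lambda>f a. (\<forall>m\<in>{1..r}. a m \<in> L2_torus) \<and>
      (AE \<xi> in lebesgue. fourier_L2 f (transpose M *v \<xi>) = (\<Sum>m=1..r. a m \<xi> * fourier_L2 (\<phi> m) \<xi>))"
  have iff: "dil_shift (matrix_inv M) 0 f \<in> ?V \<longleftrightarrow> (\<exists>a. ?ref f a)" if "f \<in> sq_int lebesgue" for f
    by (rule refinement_iff[OF B M that])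
  \<comment> \<open>The refinement equations are independent conditions on the individual generators.\<close>
  have split: "?refinable \<longleftrightarrow> (\<forall>l\<in>{1..r}. \<exists>a. ?ref (\<phi> l) a) \<and> (\<forall>n\<in>{1..s}. \<exists>b. ?ref (\<psi> n) b)"
    unfolding AE_conj_iff AE_finite_all[OF finite_atLeastAtMost] bchoice_iff by blast
  show ?thesis
  proof
    assume ?biorthogonal
    then obtain \<phi>' \<psi>' where \<psi>': "\<forall>n\<in>{1..s}. \<psi>' n \<in> sq_int lebesgue"
      and bi: "biorthogonal_wavelet_bases M J r s \<phi> \<psi> \<phi>' \<psi>'"
      unfolding L2_eq by blast
    have b: "ip2 lebesgue (WS M J \<phi> \<psi> i) (WS M J \<phi>' \<psi>' i') = of_bool (i = i')"
      if "i \<in> WS_index r s J" "i' \<in> WS_index r s J" for i i'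
      using bi that unfolding biorthogonal_wavelet_bases_iff by blast
    have "dil_shift (matrix_inv M) 0 (\<phi> l) \<in> ?V" if l: "l \<in> {1..r}" for l
    proof (rule biorthogonal_imp_closed_span[OF M \<phi> \<psi> \<psi>' bi])
      show "ip2 lebesgue (dil_shift (mat_powi M J) 0 (\<phi> l)) (dil_shift (mat_powi M j) k (\<psi>' n)) = 0"
        if "n \<in> {1..s}" "J < j" "k \<in> int_lattice" for n j k
        using b[of "Inl (l, 0)" "Inr (n, j, k)"] that l
        by (simp add: WS_Inl WS_Inr Inl_in_WS_index Inr_in_WS_index int_lattice_0)
    qed (use \<phi> l in blast)
    moreover have "dil_shift (matrix_inv M) 0 (\<psi> n) \<in> ?V" if n: "n \<in> {1..s}" for n
    proof (rule biorthogonal_imp_closed_span[OF M \<phi> \<psi> \<psi>' bi])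
      show "ip2 lebesgue (dil_shift (mat_powi M J) 0 (\<psi> n)) (dil_shift (mat_powi M j) k (\<psi>' n')) = 0"
        if "n' \<in> {1..s}" "J < j" "k \<in> int_lattice" for n' j k
        using b[of "Inr (n, J, 0)" "Inr (n', j, k)"] that n
        by (simp add: WS_Inr Inr_in_WS_index int_lattice_0)
    qed (use \<psi> n in blast)
    ultimately show ?refinable unfolding split using iff \<phi> \<psi> by blast
  next
    assume ?refinable
    then have "\<And>l. l \<in> {1..r} \<Longrightarrow> dil_shift (matrix_inv M) 0 (\<phi> l) \<in> ?V"
      and "\<And>n. n \<in> {1..s} \<Longrightarrow> dil_shift (matrix_inv M) 0 (\<psi> n) \<in> ?V"
      unfolding split using iff \<phi> \<psi> by blast+
    then obtain \<phi>' \<psi>' where "\<forall>l\<in>{1..r}. \<phi>' l \<in> sq_int lebesgue" "\<forall>n\<in>{1..s}. \<psi>' n \<in> sq_int lebesgue"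
      "biorthogonal_wavelet_bases M J r s \<phi> \<psi> \<phi>' \<psi>'"
      by (rule nested_imp_biorthogonal[OF Z M \<phi> \<psi> R]) blast
    then show ?biorthogonal unfolding L2_eq by blast
  qed
qed

end
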